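(* Let $\mathcal X$ be a standard Borel space, $\Phi:\mathcal X\to\mathbb R^m$ a Borel map, and $S\subseteq\mathbb R^m$ a non-empty convex set. A non-negative process $E=(E_t)_{t\ge 0}$ on $\mathcal X^\infty$ is an e-process for $\mathcal H_{\Phi,S}^\infty$ if and only if there is $\hat E=(\hat E_t)_{t\ge0}\in\mathcal E^\infty_{\Lambda_{\Phi,S}}$ such that $E_t(x^t)\le\hat E_t(x^t)$ for every $t\ge 0$ and every $x^t\in\mathcal X^t$.
   Context: Notation: $x^t=(x_1,\dots,x_t)$, $\mathcal X^0=\{\emptyset\}$, $x^0=\emptyset$. $\mathcal X^\infty$ is the space of infinite sequences in $\mathcal X$, with the sigma-field generated by cylinders. $S$ need not be Borel. Single-step hypothesis: $\mathscr P$ is the set of Borel probability measures on $\mathcal X$, $\mathscr P_\Phi=\{P\in\mathscr P: \mathbb E_P[\|\Phi\|_1]<\infty\}$, and $\mathcal H_{\Phi,S}=\{P\in\mathscr P_\Phi:\mathbb E_P[\Phi]\in S\}$. Conditional hypothesis: $\mathscr P^\infty$ is the set of probability measures on $\mathcal X^\infty$ and, with $(X_t)_{t\ge1}$ the coordinate process, $$\mathcal H_{\Phi,S}^\infty=\{P\in\mathscr P^\infty:\ \mathbb E_P[\|\Phi(X_t)\|_1]<\infty \text{ for all finite } t\ge1,\ \text{and } \mathbb E_P[\Phi(X_t)\mid X^{t-1}]\in S\ \text{ for all finite } t\ge1,\ P\text{-a.s.}\},$$ where for $t=1$ the conditional expectation is $\mathbb E_P[\Phi(X_1)]$. A non-negative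 process on $\mathcal X^\infty$ is a sequence $(f_t)_{t\ge0}$ of Borel functions $f_t:\mathcal X^t\to[0,\infty]$. $\mathcal T_\star$ is the set of bounded stopping times (values in $\{0,\dots,T\}$ for some finite $T\geq 1$) relative to the natural filtration generated by the coordinates of $\mathcal X^\infty$; for $\tau\in\mathcal T_\star$, $f_\tau$ is the function $x^\infty\mapsto f_{\tau(x^\infty)}(x^{\tau(x^\infty)})$. A non-negative process $E$ is an e-process for a set $\mathcal H\subseteq\mathscr P^\infty$ if $E_0\le1$ and $\mathbb E_P[E_\tau]\le1$ for every $\tau\in\mathcal T_\star$ and $P\in\mathcal H$. Effective domain: $\mathcal X_{\Phi,S}=\{x\in\mathcal X:\exists P\in\mathcal H_{\Phi,S},\ P(\{x\})>0\}$ (this is a Borel set). Support function: $\sigma_{\Phi,S}(\lambda)=\sup_{y\in S\cap\operatorname{aff}\Phi(\mathcal X_{\Phi,S})}\lambda\cdot y$ for $\lambda\in\mathbb R^m$, where $\operatorname{aff}$ is the affine hull, $\operatorname{aff}\emptyset=\emptyset$, $\sup\emptyset=-\infty$. Let $$\Lambda_{\Phi,S}=\{\lambda\in\mathbb R^m: 1+\lambda\cdot\Phi(x)\ge\sigma_{\Phi,S}(\lambda)\ \forall x\in\mathcal X_{\Phi,S}\}.$$ For $\lambda\in\Lambda_{\Phi,S}$, define $e_\lambda:\mathcal X\to[0,\infty]$ by $e_\lambda(x)=1+\lambda\cdot\Phi(x)-\sigma_{\Phi,S}(\lambda)$ if $x\in\mathcal X_{\Phi,S}$ and $e_\lambda(x)=+\infty$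 if $x\notin\mathcal X_{\Phi,S}$. Predictable products: $\Lambda_{\Phi,S}^\infty$ is the set of sequences $\lambda^\infty=(\lambda_t)_{t\ge1}$ where each $\lambda_t:\mathcal X_{\Phi,S}^{t-1}\to\Lambda_{\Phi,S}$ is Borel. For $\lambda^\infty\in\Lambda_{\Phi,S}^\infty$, define $E^{\lambda^\infty}_0=1$ and, for $t\ge1$, $E_t^{\lambda^\infty}(x^t)=E_{t-1}^{\lambda^\infty}(x^{t-1})\,e_{\lambda_t(x^{t-1})}(x_t)$ if $x^{t-1}\in\mathcal X_{\Phi,S}^{t-1}$, and $E_t^{\lambda^\infty}(x^t)=+\infty$ otherwise; in this product the convention $0\cdot\infty=\infty$ is used (in expectations the usual convention $0\cdot\infty=0$ is used). Finally $\mathcal E_{\Lambda_{\Phi,S}}^\infty=\{E^{\lambda^\infty}:\lambda^\infty\in\Lambda_{\Phi,S}^\infty\}$. *)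

theory Defs
  imports "HOL-Probability.Probability"
begin

text \<open>
  A measurable space is represented by a measure \<open>M\<close> of which only \<open>space M\<close> and \<open>sets M\<close> matter.
\<close>

definition standard_borel :: "'a measure \<Rightarrow> bool" where
  "standard_borel M \<longleftrightarrow>
     (\<exists>T. topspace T = space M \<and> completely_metrizable_space T \<and> separable_space T \<and>
          sets M = sigma_sets (space M) {U. openin T U})"


subsection \<open>Sequence spaces\<close>

text \<open>
  Coordinates are numbered from 0: the \<open>t\<close>-th observation \<open>X\<^sub>t\<close>, \<open>t \<ge> 1\<close>, is \<open>\<omega> (t - 1)\<close>.
  The finite history \<open>x\<^sup>t\<close> is the extensional function \<open>restrict \<omega> {0..<t}\<close>, so that the only
  point of \<open>hist_space M 0\<close> is \<open>\<lambda>_. undefined\<close>.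
\<close>

definition hist_space :: "'a measure \<Rightarrow> nat \<Rightarrow> (nat \<Rightarrow> 'a) measure" where
  "hist_space M t = PiM {0..<t} (\<lambda>_. M)"

definition path_space :: "'a measure \<Rightarrow> (nat \<Rightarrow> 'a) measure" where
  "path_space M = PiM UNIV (\<lambda>_. M)"

definition nat_filtration :: "'a measure \<Rightarrow> nat \<Rightarrow> (nat \<Rightarrow> 'a) measure" where
  "nat_filtration M t =
     vimage_algebra (space (path_space M)) (\<lambda>\<omega>. restrict \<omega> {0..<t}) (hist_space M t)"


subsection \<open>Hypotheses\<close>

definition l1_norm :: "real ^ 'm \<Rightarrow> real" where
  "l1_norm v = (\<Sum>i\<in>UNIV. \<bar>v $ i\<bar>)"

definition hyp :: "'a measure \<Rightarrow> ('a \<Rightarrow> real ^ 'm) \<Rightarrow> (real ^ 'm) set \<Rightarrow> 'a measure set" where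
  "hyp M \<Phi> S =
     {P \<in> space (prob_algebra M).
        (\<integral>\<^sup>+x. ennreal (l1_norm (\<Phi> x)) \<partial>P) < \<infinity> \<and> (\<integral>x. \<Phi> x \<partial>P) \<in> S}"

text \<open>
  The conditional expectation of \<open>\<Phi> (X\<^sub>t\<^sub>+\<^sub>1)\<close> given the first \<open>t\<close> observations, taken componentwise
  because \<^const>\<open>real_cond_exp\<close> is only available for real-valued functions.
\<close>

definition cond_mean ::
  "'a measure \<Rightarrow> ('a \<Rightarrow> real ^ 'm) \<Rightarrow> (nat \<Rightarrow> 'a) measure \<Rightarrow> nat \<Rightarrow> (nat \<Rightarrow> 'a) \<Rightarrow> real ^ 'm" where
  "cond_mean M \<Phi> P t =
     (if t = 0 then (\<lambda>_. \<integral>\<omega>. \<Phi> (\<omega> 0) \<partial>P)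
      else (\<lambda>\<omega>. \<chi> i. real_cond_exp P (nat_filtration M t) (\<lambda>\<omega>'. \<Phi> (\<omega>' t) $ i) \<omega>))"

text \<open>
  As \<open>S\<close> need not be Borel, \<open>AE\<close> says here that the exceptional set lies in a measurable null set.
\<close>

definition cond_hyp ::
  "'a measure \<Rightarrow> ('a \<Rightarrow> real ^ 'm) \<Rightarrow> (real ^ 'm) set \<Rightarrow> (nat \<Rightarrow> 'a) measure set" where
  "cond_hyp M \<Phi> S =
     {P \<in> space (prob_algebra (path_space M)).
        (\<forall>t. (\<integral>\<^sup>+\<omega>. ennreal (l1_norm (\<Phi> (\<omega> t))) \<partial>P) < \<infinity>) \<and>
        (AE \<omega> in P. \<forall>t. cond_mean M \<Phi> P t \<omega> \<in> S)}"


subsection \<open>E-processes\<close>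

definition nonneg_process :: "'a measure \<Rightarrow> (nat \<Rightarrow> (nat \<Rightarrow> 'a) \<Rightarrow> ennreal) \<Rightarrow> bool" where
  "nonneg_process M f \<longleftrightarrow> (\<forall>t. f t \<in> hist_space M t \<rightarrow>\<^sub>M borel)"

definition bounded_stopping_times :: "'a measure \<Rightarrow> ((nat \<Rightarrow> 'a) \<Rightarrow> nat) set" where
  "bounded_stopping_times M =
     {\<tau>. stopping_time (nat_filtration M) \<tau> \<and>
         (\<exists>T\<ge>1. \<forall>\<omega>\<in>space (path_space M). \<tau> \<omega> \<le> T)}"

definition stopped ::
  "(nat \<Rightarrow> (nat \<Rightarrow> 'a) \<Rightarrow> ennreal) \<Rightarrow> ((nat \<Rightarrow> 'a) \<Rightarrow> nat) \<Rightarrow> (nat \<Rightarrow> 'a) \<Rightarrow> ennreal" where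
  "stopped f \<tau> \<omega> = f (\<tau> \<omega>) (restrict \<omega> {0..<\<tau> \<omega>})"

definition e_process ::
  "'a measure \<Rightarrow> (nat \<Rightarrow> 'a) measure set \<Rightarrow> (nat \<Rightarrow> (nat \<Rightarrow> 'a) \<Rightarrow> ennreal) \<Rightarrow> bool" where
  "e_process M H E \<longleftrightarrow>
     nonneg_process M E \<and>
     (\<forall>x\<in>space (hist_space M 0). E 0 x \<le> 1) \<and>
     (\<forall>\<tau>\<in>bounded_stopping_times M. \<forall>P\<in>H. (\<integral>\<^sup>+\<omega>. stopped E \<tau> \<omega> \<partial>P) \<le> 1)"


subsection \<open>Predictable products\<close>

definition eff_domain :: "'a measure \<Rightarrow> ('a \<Rightarrow> real ^ 'm) \<Rightarrow> (real ^ 'm) set \<Rightarrow> 'a set" where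
  "eff_domain M \<Phi> S = {x \<in> space M. \<exists>P\<in>hyp M \<Phi> S. emeasure P {x} > 0}"

text \<open>In \<^typ>\<open>ereal\<close> the supremum of the empty set is \<open>-\<infinity>\<close>.\<close>

definition support_fun ::
  "'a measure \<Rightarrow> ('a \<Rightarrow> real ^ 'm) \<Rightarrow> (real ^ 'm) set \<Rightarrow> real ^ 'm \<Rightarrow> ereal" where
  "support_fun M \<Phi> S l = (SUP y \<in> S \<inter> affine hull (\<Phi> ` eff_domain M \<Phi> S). ereal (l \<bullet> y))"

definition Lambda :: "'a measure \<Rightarrow> ('a \<Rightarrow> real ^ 'm) \<Rightarrow> (real ^ 'm) set \<Rightarrow> (real ^ 'm) set" where
  "Lambda M \<Phi> S = {l. \<forall>x\<in>eff_domain M \<Phi> S. ereal (1 + l \<bullet> \<Phi> x) \<ge> support_fun M \<Phi> S l}"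

text \<open>
  For \<open>l \<in> Lambda M \<Phi> S\<close>, the only case of interest, the argument of \<^const>\<open>e2ennreal\<close> is
  non-negative and so is not truncated.
\<close>

definition e_var ::
  "'a measure \<Rightarrow> ('a \<Rightarrow> real ^ 'm) \<Rightarrow> (real ^ 'm) set \<Rightarrow> real ^ 'm \<Rightarrow> 'a \<Rightarrow> ennreal" where
  "e_var M \<Phi> S l x =
     (if x \<in> eff_domain M \<Phi> S then e2ennreal (ereal (1 + l \<bullet> \<Phi> x) - support_fun M \<Phi> S l) else \<infinity>)"

text \<open>
  Multiplication with \<open>0 \<cdot> \<infinity> = \<infinity>\<close>; the product of \<^typ>\<open>ennreal\<close> has \<open>0 \<cdot> \<infinity> = 0\<close>.
\<close>

definition mult_top :: "ennreal \<Rightarrow> ennreal \<Rightarrow> ennreal" where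
  "mult_top a b = (if a = \<infinity> \<or> b = \<infinity> then \<infinity> else a * b)"

text \<open>
  \<open>l t\<close> is chosen after \<open>t\<close> observations and used as the bet on observation number \<open>t + 1\<close>.
\<close>

definition Lambda_seq ::
  "'a measure \<Rightarrow> ('a \<Rightarrow> real ^ 'm) \<Rightarrow> (real ^ 'm) set \<Rightarrow> (nat \<Rightarrow> (nat \<Rightarrow> 'a) \<Rightarrow> real ^ 'm) set" where
  "Lambda_seq M \<Phi> S =
     {l. \<forall>t. l t \<in> hist_space (restrict_space M (eff_domain M \<Phi> S)) t
                 \<rightarrow>\<^sub>M restrict_space borel (Lambda M \<Phi> S)}"

primrec pred_product ::
  "'a measure \<Rightarrow> ('a \<Rightarrow> real ^ 'm) \<Rightarrow> (real ^ 'm) set \<Rightarrow> (nat \<Rightarrow> (nat \<Rightarrow> 'a) \<Rightarrow> real ^ 'm) \<Rightarrow>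
     nat \<Rightarrow> (nat \<Rightarrow> 'a) \<Rightarrow> ennreal" where
  "pred_product M \<Phi> S l 0 = (\<lambda>x. 1)"
| "pred_product M \<Phi> S l (Suc t) =
     (\<lambda>x. let h = restrict x {0..<t} in
        if h \<in> {0..<t} \<rightarrow>\<^sub>E eff_domain M \<Phi> S
        then mult_top (pred_product M \<Phi> S l t h) (e_var M \<Phi> S (l t h) (x t))
        else \<infinity>)"

definition pred_products ::
  "'a measure \<Rightarrow> ('a \<Rightarrow> real ^ 'm) \<Rightarrow> (real ^ 'm) set \<Rightarrow> (nat \<Rightarrow> (nat \<Rightarrow> 'a) \<Rightarrow> ennreal) set" where
  "pred_products M \<Phi> S = pred_product M \<Phi> S ` Lambda_seq M \<Phi> S"

end

theory Submission
  imports Defs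
begin

text \<open>
  Dominated processes are e-processes because a predictable product stopped at a bounded time is a
  supermartingale: facial reduction shows that under every law of the conditional hypothesis the
  observations stay in the effective domain and their conditional means in its affine hull.

  Conversely, let nature play finitely supported distributions on the effective domain whose mean lies
  in the relative interior of the admissible means. The value of the resulting game of optimal
  stopping for an e-process \<open>E\<close> dominates \<open>E\<close> and is at most 1 at the start, since almost optimal
  strategies on finitely many histories generate, by Ionescu-Tulcea, a law of the conditional
  hypothesis. By convex duality, in every state a single affine bet dominates the growth of the value
  over one step. The admissible bets form a compact convex set and the value is upper semianalytic,
  so that Lusin's separation theorem yields a Borel choice of the bet.
\<close>

text \<open>The obstacle is measurability. The value of the game is a supremum over uncountably many
  strategies and need not be Borel, whereas bets must be Borel functions of the history. What helps
  is that the good bets in a given state are those satisfying a family of closed inequalities whose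
  right-hand sides come from the value. By compactness, a closed piece of this set is empty iff
  finitely many of these inequalities contradict each other, and that is an analytic condition on
  the state. When the set is cut into two halves, the events "this half is empty" are analytic and
  disjoint, so a Borel set between them can decide which half to keep; repeating this pins down one
  bet. For the same reason the bets are chosen relative to the Borel product of the earlier bets,
  which dominates the value, and not relative to the value itself. Nature's means are confined to a
  relative interior because \<open>S\<close> need not be Borel while a relative interior always is.
  Nothing is lost: the affine inequalities obtained there extend to all admissible means by
  closure.\<close>

section \<open>Baire space and analytic predicates\<close>

definition baire :: "(nat \<Rightarrow> nat) measure" where
  "baire = PiM UNIV (\<lambda>_. count_space UNIV)"

lemma space_baire [simp]: "space baire = UNIV"
  by (simp add: baire_def space_PiM)

lemma measurable_baire_component [measurable]: "(\<lambda>w. w i) \<in> baire \<rightarrow>\<^sub>M count_space UNIV"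
  unfolding baire_def by (rule measurable_component_singleton) simp

lemma measurable_baireI:
  assumes "\<And>i. (\<lambda>z. f z i) \<in> N \<rightarrow>\<^sub>M count_space UNIV"
  shows "f \<in> N \<rightarrow>\<^sub>M baire"
  unfolding baire_def by (rule measurable_PiM_single') (use assms in auto)

text \<open>Through \<open>prod_encode\<close>, one point of Baire space stores a whole sequence of
  points. This is how countably many witnesses are merged into a single one below.\<close>

definition slice :: "nat \<Rightarrow> (nat \<Rightarrow> 'b) \<Rightarrow> nat \<Rightarrow> 'b" where
  "slice k w = (\<lambda>n. w (prod_encode (k, n)))"

definition unslice :: "(nat \<Rightarrow> nat \<Rightarrow> 'b) \<Rightarrow> nat \<Rightarrow> 'b" where
  "unslice f m = f (fst (prod_decode m)) (snd (prod_decode m))"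

lemma slice_unslice [simp]: "slice k (unslice f) = f k"
  by (simp add: slice_def unslice_def)

lemma measurable_slice [measurable]: "slice k \<in> baire \<rightarrow>\<^sub>M baire"
  by (rule measurable_baireI) (simp add: slice_def)

text \<open>Analytic sets over a bare measurable space: projections along Baire space of measurable
  subsets of the product. Only the values of \<open>P\<close> on \<open>space Z\<close>
  count.\<close>

definition analytic :: "'a measure \<Rightarrow> ('a \<Rightarrow> bool) \<Rightarrow> bool" where
  "analytic Z P \<longleftrightarrow>
     (\<exists>Q. Measurable.pred (Z \<Otimes>\<^sub>M baire) Q \<and> (\<forall>z\<in>space Z. P z \<longleftrightarrow> (\<exists>w. Q (z, w))))"

lemma analyticI:
  assumes "Measurable.pred (Z \<Otimes>\<^sub>M baire) Q" "\<And>z. z \<in> space Z \<Longrightarrow> P z \<longleftrightarrow> (\<exists>w. Q (z, w))"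
  shows "analytic Z P"
  using assms unfolding analytic_def by blast

lemma analyticE:
  assumes "analytic Z P"
  obtains Q where "Measurable.pred (Z \<Otimes>\<^sub>M baire) Q"
    "\<And>z. z \<in> space Z \<Longrightarrow> P z \<longleftrightarrow> (\<exists>w. Q (z, w))"
  using assms unfolding analytic_def by blast

lemma analytic_measurable:
  assumes [measurable]: "Measurable.pred Z P"
  shows "analytic Z P"
  by (rule analyticI[where Q = "\<lambda>(z, w). P z"]) auto

lemma analytic_compose:
  assumes "analytic Z' P" and [measurable]: "f \<in> Z \<rightarrow>\<^sub>M Z'"
  shows "analytic Z (\<lambda>z. P (f z))"
proof -
  obtain Q where [measurable]: "Measurable.pred (Z' \<Otimes>\<^sub>M baire) Q"
    and Q: "\<And>z. z \<in> space Z' \<Longrightarrow> P z \<longleftrightarrow> (\<exists>w. Q (z, w))"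
    using analyticE[OF assms(1)] by metis
  show ?thesis
    by (rule analyticI[where Q = "\<lambda>(z, w). Q (f z, w)"])
      (use Q measurable_space[OF assms(2)] in auto)
qed

lemma analytic_ex_nat:
  fixes P :: "nat \<Rightarrow> 'a \<Rightarrow> bool"
  assumes "\<And>k. analytic Z (P k)"
  shows "analytic Z (\<lambda>z. \<exists>k. P k z)"
proof -
  have "\<forall>k. \<exists>Q. Measurable.pred (Z \<Otimes>\<^sub>M baire) Q \<and> (\<forall>z\<in>space Z. P k z \<longleftrightarrow> (\<exists>w. Q (z, w)))"
    using assms unfolding analytic_def by blast
  then obtain Q where [measurable]: "\<And>k. Measurable.pred (Z \<Otimes>\<^sub>M baire) (Q k)"
    and Q: "\<And>k z. z \<in> space Z \<Longrightarrow> P k z \<longleftrightarrow> (\<exists>w. Q k (z, w))"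
    by metis
  show ?thesis
  proof (rule analyticI[where Q = "\<lambda>(z, w). \<exists>k. Q k (z, slice k w)"])
    fix z assume z: "z \<in> space Z"
    show "(\<exists>k. P k z) \<longleftrightarrow> (\<exists>w. case (z, w) of (z, w) \<Rightarrow> \<exists>k. Q k (z, slice k w))"
      using Q[OF z] by auto (metis slice_unslice)
  qed measurable
qed

lemma analytic_ex_countable:
  fixes P :: "'k::countable \<Rightarrow> 'a \<Rightarrow> bool"
  assumes "\<And>k. analytic Z (P k)"
  shows "analytic Z (\<lambda>z. \<exists>k. P k z)"
proof -
  have "(\<exists>k. P k z) \<longleftrightarrow> (\<exists>n. P (from_nat n) z)" for z
    by (metis from_nat_to_nat)
  then show ?thesis
    using analytic_ex_nat[of Z "\<lambda>n. P (from_nat n)"] assms by simp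
qed

lemma analytic_all_nat:
  fixes P :: "nat \<Rightarrow> 'a \<Rightarrow> bool"
  assumes "\<And>k. analytic Z (P k)"
  shows "analytic Z (\<lambda>z. \<forall>k. P k z)"
proof -
  have "\<forall>k. \<exists>Q. Measurable.pred (Z \<Otimes>\<^sub>M baire) Q \<and> (\<forall>z\<in>space Z. P k z \<longleftrightarrow> (\<exists>w. Q (z, w)))"
    using assms unfolding analytic_def by blast
  then obtain Q where [measurable]: "\<And>k. Measurable.pred (Z \<Otimes>\<^sub>M baire) (Q k)"
    and Q: "\<And>k z. z \<in> space Z \<Longrightarrow> P k z \<longleftrightarrow> (\<exists>w. Q k (z, w))"
    by metis
  show ?thesis
  proof (rule analyticI[where Q = "\<lambda>(z, w). \<forall>k. Q k (z, slice k w)"])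
    fix z assume z: "z \<in> space Z"
    show "(\<forall>k. P k z) \<longleftrightarrow> (\<exists>w. case (z, w) of (z, w) \<Rightarrow> \<forall>k. Q k (z, slice k w))"
    proof
      assume "\<forall>k. P k z"
      then obtain w where "\<And>k. Q k (z, w k)" using Q[OF z] by metis
      then show "\<exists>w. case (z, w) of (z, w) \<Rightarrow> \<forall>k. Q k (z, slice k w)"
        by (intro exI[of _ "unslice w"]) simp
    qed (use Q[OF z] in auto)
  qed measurable
qed

lemma analytic_conj:
  assumes "analytic Z P" "analytic Z Q"
  shows "analytic Z (\<lambda>z. P z \<and> Q z)"
proof -
  have "analytic Z (\<lambda>z. \<forall>k::nat. (if k = 0 then P else Q) z)"
    by (rule analytic_all_nat) (simp add: assms)
  moreover have "(\<forall>k::nat. (if k = 0 then P else Q) z) \<longleftrightarrow> P z \<and> Q z" for z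
    by (metis zero_neq_one)
  ultimately show ?thesis by simp
qed

lemma analytic_disj:
  assumes "analytic Z P" "analytic Z Q"
  shows "analytic Z (\<lambda>z. P z \<or> Q z)"
proof -
  have "analytic Z (\<lambda>z. \<exists>k::nat. (if k = 0 then P else Q) z)"
    by (rule analytic_ex_nat) (simp add: assms)
  moreover have "(\<exists>k::nat. (if k = 0 then P else Q) z) \<longleftrightarrow> P z \<or> Q z" for z
    by (metis zero_neq_one)
  ultimately show ?thesis by simp
qed

lemma analytic_all_less:
  assumes "\<And>k. k < (n::nat) \<Longrightarrow> analytic Z (P k)"
  shows "analytic Z (\<lambda>z. \<forall>k<n. P k z)"
proof -
  have "analytic Z (\<lambda>z. k < n \<longrightarrow> P k z)" for k
    using assms[of k] by (cases "k < n") (auto intro!: analytic_measurable)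
  then show ?thesis by (rule analytic_all_nat)
qed

subsection \<open>Coded spaces\<close>

text \<open>
  All that is needed of a non-empty standard Borel space. It is stable under countable products and
  measurable subspaces and, unlike topological completeness, only mentions measurable maps.
\<close>

definition coded :: "'a measure \<Rightarrow> bool" where
  "coded N \<longleftrightarrow> (\<exists>c \<in> N \<rightarrow>\<^sub>M baire. inj_on c (space N)) \<and> (\<exists>g \<in> baire \<rightarrow>\<^sub>M N. range g = space N)"

lemma codedE:
  assumes "coded N"
  obtains c g where "c \<in> N \<rightarrow>\<^sub>M baire" "inj_on c (space N)" "g \<in> baire \<rightarrow>\<^sub>M N" "range g = space N"
  using assms unfolding coded_def by blast

lemma coded_baire: "coded baire"
  unfolding coded_def by (intro conjI bexI[of _ "\<lambda>x. x"] measurable_ident_sets) auto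

text \<open>The surjection from Baire space onto \<open>Y\<close> turns the quantifier over
  \<open>Y\<close> into one over Baire space; it then merges with the existing witness, one slice
  for each.\<close>

lemma analytic_proj:
  assumes P: "analytic (Z \<Otimes>\<^sub>M Y) P" and Y: "coded Y"
  shows "analytic Z (\<lambda>z. \<exists>y\<in>space Y. P (z, y))"
proof -
  obtain g where [measurable]: "g \<in> baire \<rightarrow>\<^sub>M Y" and g: "range g = space Y"
    using codedE[OF Y] by metis
  obtain Q where [measurable]: "Measurable.pred ((Z \<Otimes>\<^sub>M Y) \<Otimes>\<^sub>M baire) Q"
    and Q: "\<And>z. z \<in> space (Z \<Otimes>\<^sub>M Y) \<Longrightarrow> P z \<longleftrightarrow> (\<exists>w. Q (z, w))"
    using analyticE[OF P] by metis
  show ?thesis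
  proof (rule analyticI[where Q = "\<lambda>(z, w). Q ((z, g (slice 0 w)), slice 1 w)"])
    fix z assume z: "z \<in> space Z"
    have "(\<exists>y\<in>space Y. P (z, y)) \<longleftrightarrow> (\<exists>v. P (z, g v))"
      unfolding g[symmetric] by auto
    also have "\<dots> \<longleftrightarrow> (\<exists>v w. Q ((z, g v), w))"
      using Q z g by (metis rangeI space_pair_measure mem_Sigma_iff)
    also have "\<dots> \<longleftrightarrow> (\<exists>w. Q ((z, g (slice 0 w)), slice 1 w))"
    proof
      assume "\<exists>v w. Q ((z, g v), w)"
      then obtain v w where "Q ((z, g v), w)" by blast
      then show "\<exists>w. Q ((z, g (slice 0 w)), slice 1 w)"
        by (intro exI[of _ "unslice (\<lambda>k. if k = 0 then v else w)"]) simp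
    qed blast
    finally show "(\<exists>y\<in>space Y. P (z, y)) \<longleftrightarrow>
      (\<exists>w. case (z, w) of (z, w) \<Rightarrow> Q ((z, g (slice 0 w)), slice 1 w))" by simp
  qed measurable
qed

lemma coded_PiM:
  fixes I :: "nat set"
  assumes N: "coded N"
  shows "coded (PiM I (\<lambda>_. N))"
proof -
  obtain c g where c[measurable]: "c \<in> N \<rightarrow>\<^sub>M baire" and inj: "inj_on c (space N)"
    and g[measurable]: "g \<in> baire \<rightarrow>\<^sub>M N" and surj: "range g = space N"
    using codedE[OF N] .
  let ?c = "\<lambda>x. unslice (\<lambda>i n. if i \<in> I then c (x i) n else 0)"
  let ?g = "\<lambda>w. \<lambda>i\<in>I. g (slice i w)"
  have "?c \<in> PiM I (\<lambda>_. N) \<rightarrow>\<^sub>M baire"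
  proof (rule measurable_baireI)
    fix m
    show "(\<lambda>x. ?c x m) \<in> PiM I (\<lambda>_. N) \<rightarrow>\<^sub>M count_space UNIV"
    proof (cases "fst (prod_decode m) \<in> I")
      case True
      have [measurable]: "(\<lambda>x. x (fst (prod_decode m))) \<in> PiM I (\<lambda>_. N) \<rightarrow>\<^sub>M N"
        using True by (rule measurable_component_singleton)
      show ?thesis using True by (simp add: unslice_def)
    qed (simp add: unslice_def)
  qed
  moreover have "inj_on ?c (space (PiM I (\<lambda>_. N)))"
  proof (rule inj_onI)
    fix x y assume xy: "x \<in> space (PiM I (\<lambda>_. N))" "y \<in> space (PiM I (\<lambda>_. N))" and eq: "?c x = ?c y"
    show "x = y"
    proof (rule extensionalityI[where A = I])
      fix i assume i: "i \<in> I"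
      have "slice i (?c x) = slice i (?c y)" by (simp only: eq)
      then have "c (x i) = c (y i)" using i by simp
      then show "x i = y i"
        using inj xy i by (auto simp: space_PiM inj_on_def PiE_iff)
    qed (use xy in \<open>auto simp: space_PiM PiE_iff\<close>)
  qed
  moreover have "?g \<in> baire \<rightarrow>\<^sub>M PiM I (\<lambda>_. N)"
    by (rule measurable_restrict) measurable
  moreover have "range ?g = space (PiM I (\<lambda>_. N))"
  proof (rule set_eqI, rule iffI)
    fix x assume "x \<in> range ?g"
    then show "x \<in> space (PiM I (\<lambda>_. N))" using surj by (auto simp: space_PiM)
  next
    fix x assume x: "x \<in> space (PiM I (\<lambda>_. N))"
    have "\<forall>i\<in>I. \<exists>w. x i = g w"
      using x surj by (auto simp: space_PiM PiE_iff image_iff set_eq_iff)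
    then obtain w where w: "\<And>i. i \<in> I \<Longrightarrow> x i = g (w i)" by metis
    have "x = ?g (unslice w)"
      by (rule extensionalityI[where A = I]) (use x w in \<open>auto simp: space_PiM PiE_iff\<close>)
    then show "x \<in> range ?g" by blast
  qed
  ultimately show ?thesis unfolding coded_def by blast
qed

lemma coded_restrict_space:
  assumes N: "coded N" and D: "D \<in> sets N" "D \<noteq> {}"
  shows "coded (restrict_space N D)"
proof -
  obtain c g where c[measurable]: "c \<in> N \<rightarrow>\<^sub>M baire" and inj: "inj_on c (space N)"
    and g[measurable]: "g \<in> baire \<rightarrow>\<^sub>M N" and surj: "range g = space N"
    using codedE[OF N] .
  have DN: "D \<subseteq> space N" using D(1) by (rule sets.sets_into_space)
  obtain d where d: "d \<in> D" using D by auto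
  let ?g = "\<lambda>w. if g w \<in> D then g w else d"
  have "c \<in> restrict_space N D \<rightarrow>\<^sub>M baire" by (rule measurable_restrict_space1) fact
  moreover have "inj_on c (space (restrict_space N D))"
    using inj by (auto simp: space_restrict_space inj_on_def)
  moreover have "?g \<in> baire \<rightarrow>\<^sub>M restrict_space N D"
  proof (rule measurable_restrict_space2)
    have [measurable]: "Measurable.pred baire (\<lambda>w. g w \<in> D)" using D(1) by measurable
    have [measurable]: "(\<lambda>_. d) \<in> baire \<rightarrow>\<^sub>M N" using d DN by (intro measurable_const) auto
    show "?g \<in> baire \<rightarrow>\<^sub>M N" by measurable
  qed (use d in auto)
  moreover have "range ?g = space (restrict_space N D)"
  proof (rule set_eqI, rule iffI)
    fix x assume x: "x \<in> space (restrict_space N D)"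
    then obtain w where "x = g w" using surj by (auto simp: space_restrict_space)
    then have "x = ?g w" using x by (simp add: space_restrict_space)
    then show "x \<in> range ?g" by blast
  qed (use d DN in \<open>auto simp: space_restrict_space\<close>)
  ultimately show ?thesis unfolding coded_def by blast
qed

text \<open>Injection: the code of \<open>x\<close> records which balls of radius
  \<open>1 / Suc j\<close> around the points of a dense sequence \<open>q\<close> contain
  \<open>x\<close>. Surjection: a point of Baire space is read as a list of indices into
  \<open>q\<close> and sent to the limit if the listed points converge fast; all other lists go to
  \<open>q 0\<close>.\<close>

lemma coded_standard_borel:
  assumes "standard_borel N" "space N \<noteq> {}"
  shows "coded N"
proof -
  obtain T where T: "topspace T = space N" "completely_metrizable_space T" "separable_space T"
    and sets_N: "sets N = sigma_sets (space N) {U. openin T U}"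
    using assms(1) unfolding standard_borel_def by blast
  obtain M d where "Metric_space M d" and complete: "Metric_space.mcomplete M d"
    and T_eq: "T = Metric_space.mtopology M d"
    using T(2) unfolding completely_metrizable_space_def by blast
  interpret Metric_space M d by fact
  have M: "space N = M" using T(1) unfolding T_eq by simp
  obtain C where C: "countable C" "C \<subseteq> M" "mtopology closure_of C = M"
    using T(3) unfolding separable_space_def T_eq by auto
  have "C \<noteq> {}" using C(3) assms(2) M by auto
  define q where "q = from_nat_into C"
  have q: "q n \<in> M" for n using from_nat_into[OF \<open>C \<noteq> {}\<close>] C(2) unfolding q_def by blast
  have dense: "\<exists>n. d x (q n) < e" if x: "x \<in> M" and e: "e > 0" for x e
  proof -
    have "x \<in> mtopology closure_of C" using x C(3) by simp
    then obtain y where "y \<in> C" "y \<in> mball x e" using e unfolding metric_closure_of by blast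
    then show ?thesis
      using from_nat_into_surj[OF C(1)] unfolding q_def by (metis in_mball)
  qed
  have open_sets: "U \<in> sets N" if "openin mtopology U" for U
    using that unfolding sets_N T_eq by auto

  define c where "c x = unslice (\<lambda>i j. if d x (q i) < 1 / Suc j then 1 else 0 :: nat)" for x
  have "c \<in> N \<rightarrow>\<^sub>M baire"
  proof (rule measurable_baireI)
    fix m
    define i j where "i = fst (prod_decode m)" and "j = snd (prod_decode m)"
    have "{x \<in> space N. d x (q i) < 1 / Suc j} = mball (q i) (1 / Suc j)"
      unfolding M set_eq_iff mem_Collect_eq in_mball using q[of i] commute[of _ "q i"] by metis
    then have [measurable]: "Measurable.pred N (\<lambda>x. d x (q i) < 1 / Suc j)"
      unfolding pred_def using open_sets[OF openin_mball] by simp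
    show "(\<lambda>x. c x m) \<in> N \<rightarrow>\<^sub>M count_space UNIV"
      unfolding c_def unslice_def i_def[symmetric] j_def[symmetric] by measurable
  qed
  moreover have "inj_on c (space N)"
  proof (rule inj_onI)
    fix x y assume xy: "x \<in> space N" "y \<in> space N" and eq: "c x = c y"
    have "d x y \<le> 0"
    proof (rule field_le_epsilon)
      fix e :: real assume "e > 0"
      then obtain j where j: "inverse (Suc j) < e / 2"
        using reals_Archimedean[of "e / 2"] by auto
      obtain i where i: "d x (q i) < 1 / Suc j" using dense[of x "1 / Suc j"] xy M by auto
      have "slice i (c x) = slice i (c y)" by (simp add: eq)
      then have "(if d x (q i) < 1 / Suc j then 1 else 0 :: nat) = (if d y (q i) < 1 / Suc j then 1 else 0)"
        unfolding c_def slice_unslice by (rule fun_cong)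
      then have "d y (q i) < 1 / Suc j" using i by (simp split: if_splits)
      then have "d x y < 2 * inverse (Suc j)"
        using i triangle[of x "q i" y] xy M q[of i] commute[of y "q i"] by (simp add: inverse_eq_divide)
      then show "d x y \<le> 0 + e" using j by simp
    qed
    then show "x = y" using xy M by (metis mdist_pos_eq not_le)
  qed
  moreover
  \<comment> \<open>Steps bounded by a geometric sequence make the list Cauchy and put its limit
    within \<open>2 * (1 / 2) ^ n\<close> of the \<open>n\<close>-th point.\<close>
  define good where "good w \<longleftrightarrow> (\<forall>n. d (q (w n)) (q (w (Suc n))) \<le> (1 / 2) ^ n)" for w
  have lim: "\<exists>x\<in>M. \<forall>n. d (q (w n)) x \<le> 2 * (1 / 2) ^ n" if w: "good w" for w
  proof -
    have step: "d (q (w n)) (q (w (n + k))) \<le> 2 * (1 / 2) ^ n - 2 * (1 / 2) ^ (n + k)" for n k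
    proof (induction k)
      case (Suc k)
      have "d (q (w n)) (q (w (n + Suc k))) \<le> d (q (w n)) (q (w (n + k))) + (1 / 2) ^ (n + k)"
        using triangle[of "q (w n)" "q (w (n + k))" "q (w (n + Suc k))"] q w[unfolded good_def, rule_format, of "n + k"]
        by simp
      moreover have "(1 / 2 :: real) ^ (n + Suc k) = (1 / 2) ^ (n + k) / 2" by simp
      ultimately show ?case using Suc by linarith
    qed (simp add: q)
    have step': "d (q (w n)) (q (w m)) \<le> 2 * (1 / 2) ^ n" if "n \<le> m" for n m
    proof -
      have "0 \<le> (1 / 2 :: real) ^ (n + (m - n))" by simp
      then have "d (q (w n)) (q (w (n + (m - n)))) \<le> 2 * (1 / 2) ^ n" using step[of n "m - n"] by linarith
      then show ?thesis using that by simp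
    qed
    have "MCauchy (\<lambda>n. q (w n))"
      unfolding MCauchy_def
    proof (intro conjI allI impI)
      fix e :: real assume "e > 0"
      then obtain n where n: "(1 / 2) ^ n < e / 2" using real_arch_pow_inv[of "e / 2" "1 / 2"] by auto
      show "\<exists>N. \<forall>m n. N \<le> m \<longrightarrow> N \<le> n \<longrightarrow> d (q (w m)) (q (w n)) < e"
      proof (intro exI allI impI)
        fix i j assume ij: "n + 1 \<le> i" "n + 1 \<le> j"
        have pow: "(1 / 2 :: real) ^ k \<le> (1 / 2) ^ (n + 1)" if "n + 1 \<le> k" for k
          using that by (intro power_decreasing) auto
        have "d (q (w i)) (q (w j)) \<le> 2 * (1 / 2) ^ (n + 1)"
        proof (cases "i \<le> j")
          case True
          then show ?thesis using step'[of i j] pow[OF ij(1)] by simp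
        next
          case False
          then show ?thesis using step'[of j i] pow[OF ij(2)] commute[of "q (w i)"] by simp
        qed
        also have "\<dots> < e" using n \<open>e > 0\<close> by simp
        finally show "d (q (w i)) (q (w j)) < e" .
      qed
    qed (use q in auto)
    then obtain x where x: "limitin mtopology (\<lambda>n. q (w n)) x sequentially"
      using complete unfolding mcomplete_def by blast
    then have xM: "x \<in> M" and ev: "\<And>e. e > 0 \<Longrightarrow> \<exists>N. \<forall>n\<ge>N. d (q (w n)) x < e"
      unfolding limit_metric_sequentially by metis+
    have "d (q (w n)) x \<le> 2 * (1 / 2) ^ n" for n
    proof (rule field_le_epsilon)
      fix e :: real assume "e > 0"
      then obtain N where N: "\<forall>n\<ge>N. d (q (w n)) x < e" using ev by blast
      have "d (q (w n)) x \<le> d (q (w n)) (q (w (max n N))) + d (q (w (max n N))) x"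
        by (intro triangle q xM)
      moreover have "d (q (w (max n N))) x < e" using N by simp
      moreover have "d (q (w n)) (q (w (max n N))) \<le> 2 * (1 / 2) ^ n" by (rule step') simp
      ultimately show "d (q (w n)) x \<le> 2 * (1 / 2) ^ n + e" by linarith
    qed
    then show ?thesis using xM by blast
  qed
  define g where "g w = (if good w then SOME x. x \<in> M \<and> (\<forall>n. d (q (w n)) x \<le> 2 * (1 / 2) ^ n) else q 0)" for w
  have g: "g w \<in> M" "good w \<Longrightarrow> d (q (w n)) (g w) \<le> 2 * (1 / 2) ^ n" for w n
  proof -
    have "g w \<in> M \<and> (\<forall>n. d (q (w n)) (g w) \<le> 2 * (1 / 2) ^ n)" if "good w"
    proof -
      have "\<exists>x. x \<in> M \<and> (\<forall>n. d (q (w n)) x \<le> 2 * (1 / 2) ^ n)" using lim[OF that] by blast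
      from someI_ex[OF this] show ?thesis using that unfolding g_def by simp
    qed
    then show "g w \<in> M" "good w \<Longrightarrow> d (q (w n)) (g w) \<le> 2 * (1 / 2) ^ n"
      using q[of 0] unfolding g_def by auto
  qed
  have "range g = space N"
  proof (intro set_eqI iffI)
    fix x assume x: "x \<in> space N"
    then have xM: "x \<in> M" by (simp add: M)
    \<comment> \<open>The exponent \<open>n + 2\<close> bounds consecutive distances by
      \<open>(1/4 + 1/8) * (1/2)^n\<close>, which makes the list good.\<close>
    have "\<forall>n. \<exists>k. d x (q k) < (1 / 2) ^ (n + 2)" by (intro allI dense xM) simp
    then obtain w where w: "\<And>n. d x (q (w n)) < (1 / 2) ^ (n + 2)" by metis
    have "good w"
      unfolding good_def
    proof
      fix n
      have "d (q (w n)) (q (w (Suc n))) \<le> (1 / 2) ^ (n + 2) + (1 / 2) ^ (Suc n + 2)"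
        using triangle[OF q[of "w n"] xM q[of "w (Suc n)"]] w[of n] w[of "Suc n"] commute[of x "q (w n)"]
        by linarith
      also have "\<dots> \<le> (1 / 2) ^ n" by (simp add: field_simps)
      finally show "d (q (w n)) (q (w (Suc n))) \<le> (1 / 2) ^ n" .
    qed
    have le: "d x (g w) \<le> 3 * (1 / 2) ^ n" for n
    proof -
      have "d x (g w) \<le> (1 / 2) ^ (n + 2) + 2 * (1 / 2) ^ n"
        using triangle[OF xM q[of "w n"] g(1)[of w]] w[of n] g(2)[OF \<open>good w\<close>, of n] by linarith
      moreover have "(1 / 2 :: real) ^ (n + 2) = (1 / 2) ^ n / 4" "0 \<le> (1 / 2 :: real) ^ n" by simp_all
      ultimately show ?thesis by linarith
    qed
    have "d x (g w) \<le> 0"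
    proof (rule field_le_epsilon)
      fix e :: real assume "e > 0"
      then obtain n where "(1 / 2) ^ n < e / 3" using real_arch_pow_inv[of "e / 3" "1 / 2"] by auto
      then show "d x (g w) \<le> 0 + e" using le[of n] by simp
    qed
    then have "x = g w" using xM g(1) by (metis mdist_pos_eq not_le)
    then show "x \<in> range g" by blast
  qed (use g M in auto)
  moreover have "g \<in> baire \<rightarrow>\<^sub>M N"
  proof (rule measurable_sigma_sets[OF sets_N])
    fix U assume "U \<in> {U. openin T U}"
    then have U: "openin mtopology U" by (simp add: T_eq)
    \<comment> \<open>This turns \<open>g w \<in> U\<close> into a countable condition on
      \<open>w\<close>. The radius \<open>3 * (1 / 2) ^ n\<close> exceeds the error
      \<open>2 * (1 / 2) ^ n\<close>, so the ball contains the limit; the two add up to the factor 5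
      in \<open>r / 5\<close>.\<close>
    have inU: "g w \<in> U \<longleftrightarrow> (\<exists>n. mball (q (w n)) (3 * (1 / 2) ^ n) \<subseteq> U)" if w: "good w" for w
    proof
      assume "g w \<in> U"
      then obtain r where r: "r > 0" "mball (g w) r \<subseteq> U" using U unfolding openin_mtopology by blast
      then obtain n where n: "(1 / 2) ^ n < r / 5" using real_arch_pow_inv[of "r / 5" "1 / 2"] by auto
      have "mball (q (w n)) (3 * (1 / 2) ^ n) \<subseteq> mball (g w) r"
      proof (rule mball_subset)
        show "d (q (w n)) (g w) + 3 * (1 / 2) ^ n \<le> r" using n g(2)[OF w, of n] by linarith
      qed (rule g)
      then show "\<exists>n. mball (q (w n)) (3 * (1 / 2) ^ n) \<subseteq> U" using r by blast
    next
      assume "\<exists>n. mball (q (w n)) (3 * (1 / 2) ^ n) \<subseteq> U"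
      then obtain n where n: "mball (q (w n)) (3 * (1 / 2) ^ n) \<subseteq> U" by blast
      have "d (q (w n)) (g w) < 3 * (1 / 2) ^ n"
      proof -
        have "0 < (1 / 2 :: real) ^ n" by simp
        then show ?thesis using g(2)[OF w, of n] by linarith
      qed
      then show "g w \<in> U" using n g(1) q by (auto simp: in_mball)
    qed
    have good_meas [measurable]: "Measurable.pred baire good"
    proof -
      \<comment> \<open>Naming the values of \<open>w\<close> by quantified numbers displays the set
        as a countable combination of coordinate conditions.\<close>
      have "Measurable.pred baire (\<lambda>w. \<forall>n. \<exists>i j. w n = i \<and> w (Suc n) = j \<and> d (q i) (q j) \<le> (1 / 2) ^ n)"
        by measurable
      then show ?thesis by (simp add: good_def[abs_def])
    qed
    have "Measurable.pred baire (\<lambda>w. if good w then \<exists>n k. w n = k \<and> mball (q k) (3 * (1 / 2) ^ n) \<subseteq> U else q 0 \<in> U)"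
      by measurable
    moreover have "(if good w then \<exists>n k. w n = k \<and> mball (q k) (3 * (1 / 2) ^ n) \<subseteq> U else q 0 \<in> U) \<longleftrightarrow> g w \<in> U" for w
      using inU[of w] by (simp add: g_def)
    ultimately show "g -` U \<inter> space baire \<in> sets baire"
      by (simp add: pred_def vimage_def)
  next
    show "{U. openin T U} \<subseteq> Pow (space N)" using openin_subset T(1) by blast
  qed (use g(1) M in auto)
  ultimately show ?thesis unfolding coded_def by blast
qed

subsection \<open>Lusin separation\<close>

text \<open>Agreement on an initial segment describes the basic neighbourhoods in the product
  topology; \<open>closed2\<close> is closedness for them in the product of two copies of Baire
  space.\<close>

definition agree :: "nat \<Rightarrow> (nat \<Rightarrow> 'b) \<Rightarrow> (nat \<Rightarrow> 'b) \<Rightarrow> bool" where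
  "agree n w v \<longleftrightarrow> (\<forall>i<n. w i = v i)"

lemma agree_mono: "agree n w v \<Longrightarrow> m \<le> n \<Longrightarrow> agree m w v"
  by (auto simp: agree_def)

definition closed2 :: "((nat \<Rightarrow> nat) \<Rightarrow> (nat \<Rightarrow> nat) \<Rightarrow> bool) \<Rightarrow> bool" where
  "closed2 C \<longleftrightarrow> (\<forall>w v. (\<forall>n. \<exists>w' v'. C w' v' \<and> agree n w' w \<and> agree n v' v) \<longrightarrow> C w v)"

definition souslin :: "(nat \<Rightarrow> nat) set \<Rightarrow> bool" where
  "souslin B \<longleftrightarrow> (\<exists>C. closed2 C \<and> B = {w. \<exists>v. C w v})"

text \<open>Continuity of \<open>slice k\<close>: its first \<open>n\<close> values read finitely
  many places, and the sum of the codes bounds them all.\<close>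

lemma slice_agree:
  "\<exists>N. \<forall>v v'. agree N v' v \<longrightarrow> agree n (slice k v') (slice k v)"
proof -
  let ?N = "Suc (\<Sum>i<n. prod_encode (k, i))"
  have "prod_encode (k, i) < ?N" if "i < n" for i
  proof -
    have "prod_encode (k, i) \<le> (\<Sum>i<n. prod_encode (k, i))"
      using that by (intro member_le_sum) auto
    then show ?thesis by simp
  qed
  then show ?thesis
    by (intro exI[of _ ?N]) (auto simp: agree_def slice_def)
qed

lemma souslin_component: "souslin {w. w i \<in> A}"
proof -
  have "closed2 (\<lambda>w v. w i \<in> A)"
    unfolding closed2_def agree_def by (metis lessI)
  then show ?thesis unfolding souslin_def by (intro exI[of _ "\<lambda>w v. w i \<in> A"]) auto
qed

text \<open>The first entry of the witness names a set of the union and the tail is a witness for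
  that set. The relation stays closed because agreement on one place already fixes the
  index.\<close>

lemma souslin_Union:
  assumes "\<And>k::nat. souslin (B k)"
  shows "souslin (\<Union>k. B k)"
proof -
  obtain C where C: "\<And>k. closed2 (C k)" and B: "\<And>k. B k = {w. \<exists>v. C k w v}"
    using assms unfolding souslin_def by metis
  let ?C = "\<lambda>w v. C (v 0) w (\<lambda>n. v (Suc n))"
  have "closed2 ?C"
    unfolding closed2_def
  proof (intro allI impI)
    fix w v assume *: "\<forall>n. \<exists>w' v'. ?C w' v' \<and> agree n w' w \<and> agree n v' v"
    have "\<exists>w' v'. C (v 0) w' v' \<and> agree n w' w \<and> agree n v' (\<lambda>n. v (Suc n))" for n
    proof -
      obtain w' v' where "?C w' v'" "agree (Suc n) w' w" "agree (Suc n) v' v"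
        using *[rule_format, of "Suc n"] by blast
      then show ?thesis
        by (intro exI[of _ w'] exI[of _ "\<lambda>n. v' (Suc n)"]) (auto simp: agree_def)
    qed
    then show "?C w v" using C[of "v 0"] unfolding closed2_def by blast
  qed
  moreover have "(\<Union>k. B k) = {w. \<exists>v. ?C w v}"
  proof (intro set_eqI iffI)
    fix w assume "w \<in> (\<Union>k. B k)"
    then obtain k v where "C k w v" using B by auto
    then have "?C w (case_nat k v)" by simp
    then show "w \<in> {w. \<exists>v. ?C w v}" by blast
  qed (use B in auto)
  ultimately show ?thesis unfolding souslin_def by (intro exI[of _ ?C]) simp
qed

text \<open>One witness holds a witness for every \<open>k\<close> in its slices; closedness
  survives since slicing is continuous.\<close>

lemma souslin_Inter:
  assumes "\<And>k::nat. souslin (B k)"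
  shows "souslin (\<Inter>k. B k)"
proof -
  obtain C where C: "\<And>k. closed2 (C k)" and B: "\<And>k. B k = {w. \<exists>v. C k w v}"
    using assms unfolding souslin_def by metis
  let ?C = "\<lambda>w v. \<forall>k. C k w (slice k v)"
  have "closed2 ?C"
    unfolding closed2_def
  proof (intro allI impI)
    fix w v k assume *: "\<forall>n. \<exists>w' v'. ?C w' v' \<and> agree n w' w \<and> agree n v' v"
    have "\<exists>w' v'. C k w' v' \<and> agree n w' w \<and> agree n v' (slice k v)" for n
    proof -
      obtain N where N: "\<And>v'. agree N v' v \<Longrightarrow> agree n (slice k v') (slice k v)"
        using slice_agree by blast
      obtain w' v' where "?C w' v'" "agree (max n N) w' w" "agree (max n N) v' v"
        using * by blast
      then show ?thesis
        using N[of v'] agree_mono[of "max n N" w' w n] agree_mono[of "max n N" v' v N]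
        by (intro exI[of _ w'] exI[of _ "slice k v'"]) simp
    qed
    then show "C k w (slice k v)" using C[of k] unfolding closed2_def by blast
  qed
  moreover have "(\<Inter>k. B k) = {w. \<exists>v. ?C w v}"
  proof (intro set_eqI iffI)
    fix w assume "w \<in> (\<Inter>k. B k)"
    then have "\<forall>k. \<exists>v. C k w v" using B by auto
    then obtain v where "\<And>k. C k w (v k)" by metis
    then have "?C w (unslice v)" by simp
    then show "w \<in> {w. \<exists>v. ?C w v}" by blast
  qed (use B in auto)
  ultimately show ?thesis unfolding souslin_def by (intro exI[of _ ?C]) simp
qed

text \<open>Souslin sets are not closed under complement, so the induction over the sigma-field
  carries the set and its complement together.\<close>

lemma souslin_sets_baire:
  assumes "B \<in> sets baire"
  shows "souslin B"
proof -
  let ?G = "{{f \<in> Pi\<^sub>E UNIV (\<lambda>_. UNIV). f i \<in> A} |i A. i \<in> (UNIV::nat set) \<and> A \<in> (UNIV :: nat set set)}"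
  have "B \<in> sigma_sets UNIV ?G"
    using assms unfolding baire_def sets_PiM_single by simp
  then have "souslin B \<and> souslin (UNIV - B)"
  proof induction
    case (Basic a)
    then obtain i A where a: "a = {f. f i \<in> A}" by auto
    have "UNIV - a = {f. f i \<in> - A}" unfolding a by auto
    then show ?case unfolding a using souslin_component by metis
  next
    case Empty
    show ?case using souslin_component[of 0 "{}"] souslin_component[of 0 UNIV] by simp
  next
    case (Compl a)
    then show ?case by (simp add: double_diff)
  next
    case (Union a)
    have "UNIV - (\<Union>i. a i) = (\<Inter>i. UNIV - a i)" by auto
    then show ?case using Union souslin_Union[of a] souslin_Inter[of "\<lambda>i. UNIV - a i"] by simp
  qed
  then show ?thesis by blast
qed

definition separable_by :: "'a measure \<Rightarrow> ('a \<Rightarrow> bool) \<Rightarrow> ('a \<Rightarrow> bool) \<Rightarrow> bool" where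
  "separable_by Z P Q \<longleftrightarrow>
     (\<exists>R. Measurable.pred Z R \<and> (\<forall>z\<in>space Z. (P z \<longrightarrow> R z) \<and> (Q z \<longrightarrow> \<not> R z)))"

text \<open>The separators of the pairs combine to the union over \<open>i\<close> of the
  intersections over \<open>j\<close>. Used contrapositively: if the unions cannot be separated,
  then some pair of pieces cannot.\<close>

lemma separable_by_ex:
  fixes P Q :: "nat \<Rightarrow> 'a \<Rightarrow> bool"
  assumes "\<And>i j. separable_by Z (P i) (Q j)"
  shows "separable_by Z (\<lambda>z. \<exists>i. P i z) (\<lambda>z. \<exists>j. Q j z)"
proof -
  obtain R where [measurable]: "\<And>i j. Measurable.pred Z (R i j)"
    and R: "\<And>i j z. z \<in> space Z \<Longrightarrow> (P i z \<longrightarrow> R i j z) \<and> (Q j z \<longrightarrow> \<not> R i j z)"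
    using assms unfolding separable_by_def by metis
  have "Measurable.pred Z (\<lambda>z. \<exists>i. \<forall>j. R i j z)" by measurable
  then show ?thesis
    unfolding separable_by_def using R by (intro exI[of _ "\<lambda>z. \<exists>i. \<forall>j. R i j z"]) blast
qed

text \<open>Suppose the images of \<open>F\<close> and \<open>G\<close> under the continuous map
  \<open>\<theta>\<close> cannot be separated. Refining both sets by one further place at a time,
  while keeping the images of the pieces inseparable, leads to limit points \<open>u\<close> of
  \<open>F\<close> and \<open>v\<close> of \<open>G\<close>. Their images differ in some coordinate,
  and this coordinate separates the images of small pieces around them.\<close>

lemma lusin_separation_closed:
  fixes F G :: "(nat \<Rightarrow> nat) \<Rightarrow> bool" and idx :: "nat \<Rightarrow> nat"
  defines "\<theta> \<equiv> \<lambda>w n. w (idx n)"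
  assumes F: "\<And>w. (\<And>n. \<exists>v. F v \<and> agree n v w) \<Longrightarrow> F w"
    and G: "\<And>w. (\<And>n. \<exists>v. G v \<and> agree n v w) \<Longrightarrow> G w"
    and disj: "\<And>u v. F u \<Longrightarrow> G v \<Longrightarrow> \<theta> u \<noteq> \<theta> v"
  shows "separable_by baire (\<lambda>z. \<exists>u. F u \<and> \<theta> u = z) (\<lambda>z. \<exists>u. G u \<and> \<theta> u = z)"
proof (rule ccontr)
  define X where "X H n s = (\<lambda>z. \<exists>u. H u \<and> agree n u s \<and> \<theta> u = z)"
    for H :: "(nat \<Rightarrow> nat) \<Rightarrow> bool" and n s
  have X_split: "X H n s = (\<lambda>z. \<exists>k. X H (Suc n) (s(n := k)) z)" for H n s
  proof (rule ext, rule iffI)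
    fix z assume "X H n s z"
    then obtain u where u: "H u" "agree n u s" "\<theta> u = z" unfolding X_def by blast
    then have "X H (Suc n) (s(n := u n)) z"
      unfolding X_def by (intro exI[of _ u]) (auto simp: agree_def less_Suc_eq)
    then show "\<exists>k. X H (Suc n) (s(n := k)) z" ..
  next
    fix z assume "\<exists>k. X H (Suc n) (s(n := k)) z"
    then obtain k u where u: "H u" "agree (Suc n) u (s(n := k))" "\<theta> u = z" unfolding X_def by blast
    have "u i = s i" if "i < n" for i
      using u(2) that unfolding agree_def by (metis fun_upd_apply less_SucI nat_neq_iff)
    then show "X H n s z" unfolding X_def using u by (auto simp: agree_def)
  qed
  assume contra: "\<not> separable_by baire (\<lambda>z. \<exists>u. F u \<and> \<theta> u = z) (\<lambda>z. \<exists>u. G u \<and> \<theta> u = z)"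
  have X0: "X H 0 s = (\<lambda>z. \<exists>u. H u \<and> \<theta> u = z)" for H s
    by (simp add: X_def agree_def)
  have "\<exists>f. \<forall>n. (\<not> separable_by baire (X F n (fst (f n))) (X G n (snd (f n)))) \<and>
      (agree n (fst (f (Suc n))) (fst (f n)) \<and> agree n (snd (f (Suc n))) (snd (f n)))"
  proof (rule dependent_nat_choice)
    show "\<exists>x. \<not> separable_by baire (X F 0 (fst x)) (X G 0 (snd x))"
      using contra by (simp add: X0)
  next
    fix x :: "(nat \<Rightarrow> nat) \<times> (nat \<Rightarrow> nat)" and n
    assume "\<not> separable_by baire (X F n (fst x)) (X G n (snd x))"
    then obtain i j where ij: "\<not> separable_by baire (X F (Suc n) ((fst x)(n := i))) (X G (Suc n) ((snd x)(n := j)))"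
      using separable_by_ex[of baire "\<lambda>i. X F (Suc n) ((fst x)(n := i))" "\<lambda>j. X G (Suc n) ((snd x)(n := j))"]
      unfolding X_split[of _ n] by auto
    show "\<exists>y. (\<not> separable_by baire (X F (Suc n) (fst y)) (X G (Suc n) (snd y))) \<and>
        agree n (fst y) (fst x) \<and> agree n (snd y) (snd x)"
      by (rule exI[of _ "((fst x)(n := i), (snd x)(n := j))"])
        (use ij in \<open>simp add: agree_def\<close>)
  qed
  then obtain f where f: "\<And>n. \<not> separable_by baire (X F n (fst (f n))) (X G n (snd (f n)))"
    and f_agree: "\<And>n. agree n (fst (f (Suc n))) (fst (f n))" "\<And>n. agree n (snd (f (Suc n))) (snd (f n))"
    by blast
  define u where "u n = fst (f (Suc n)) n" for n
  define v where "v n = snd (f (Suc n)) n" for n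
  have stable: "fst (f (Suc i + k)) i = u i \<and> snd (f (Suc i + k)) i = v i" for i k
  proof (induction k)
    case (Suc k)
    have "i < Suc i + k" by simp
    then show ?case using Suc f_agree[of "Suc i + k"] unfolding agree_def by simp
  qed (simp add: u_def v_def)
  have agree_u: "agree n (fst (f n)) u" and agree_v: "agree n (snd (f n)) v" for n
    using stable by (auto simp: agree_def) (metis add_Suc less_imp_Suc_add)+
  have nonsep: "\<not> separable_by baire (X F n u) (X G n v)" for n
  proof -
    have "X F n (fst (f n)) = X F n u" "X G n (snd (f n)) = X G n v"
      using agree_u[of n] agree_v[of n] unfolding X_def agree_def by metis+
    then show ?thesis using f[of n] by simp
  qed
  \<comment> \<open>If some neighbourhood of \<open>u\<close> missed \<open>F\<close>, the
    corresponding image would be empty and \<open>False\<close> would separate. The argument for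
    \<open>v\<close> uses \<open>True\<close>.\<close>
  have Fu: "F u"
  proof (rule F)
    fix n
    show "\<exists>v. F v \<and> agree n v u"
    proof (rule ccontr)
      assume "\<not> ?thesis"
      then have "separable_by baire (X F n u) (X G n v)"
        unfolding separable_by_def X_def by (intro exI[of _ "\<lambda>_. False"]) auto
      then show False using nonsep by blast
    qed
  qed
  have Gv: "G v"
  proof (rule G)
    fix n
    show "\<exists>w. G w \<and> agree n w v"
    proof (rule ccontr)
      assume "\<not> ?thesis"
      then have "separable_by baire (X F n u) (X G n v)"
        unfolding separable_by_def X_def by (intro exI[of _ "\<lambda>_. True"]) auto
      then show False using nonsep by blast
    qed
  qed
  from disj[OF Fu Gv] obtain n where n: "u (idx n) \<noteq> v (idx n)"
    unfolding \<theta>_def by auto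
  \<comment> \<open>On points that agree with \<open>u\<close> up to place \<open>idx n\<close>, the
    \<open>n\<close>-th coordinate of \<open>\<theta>\<close> is constant, and likewise for
    \<open>v\<close> with a different constant.\<close>
  have "separable_by baire (X F (Suc (idx n)) u) (X G (Suc (idx n)) v)"
    unfolding separable_by_def
  proof (intro exI[of _ "\<lambda>z. z n = u (idx n)"] conjI ballI)
    show "Measurable.pred baire (\<lambda>z. z n = u (idx n))" by measurable
  qed (use n in \<open>auto simp: X_def agree_def \<theta>_def\<close>)
  then show False using nonsep by blast
qed

text \<open>\<open>P\<close> is the projection of a Borel set, which is itself the projection of a
  closed relation. Both witnesses are packed into \<open>u\<close>, so two slicings recover
  \<open>z\<close>.\<close>

lemma analytic_baire_closed:
  assumes "analytic baire P"
  obtains F where "\<And>w. (\<And>n. \<exists>v. F v \<and> agree n v w) \<Longrightarrow> F w"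
    "\<And>z. P z \<longleftrightarrow> (\<exists>u. F u \<and> slice 0 (slice 0 u) = z)"
proof -
  obtain Q where [measurable]: "Measurable.pred (baire \<Otimes>\<^sub>M baire) Q"
    and Q: "\<And>z. P z \<longleftrightarrow> (\<exists>w. Q (z, w))"
    using analyticE[OF assms] by (metis UNIV_I space_baire)
  have "Measurable.pred baire (\<lambda>w. Q (slice 0 w, slice 1 w))" by measurable
  then have "{w. Q (slice 0 w, slice 1 w)} \<in> sets baire" by (simp add: pred_def)
  then obtain C where C: "closed2 C" and eq: "{w. Q (slice 0 w, slice 1 w)} = {w. \<exists>v. C w v}"
    using souslin_sets_baire unfolding souslin_def by blast
  let ?F = "\<lambda>w. C (slice 0 w) (slice 1 w)"
  show thesis
  proof
    fix w assume *: "\<And>n. \<exists>v. ?F v \<and> agree n v w"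
    have "\<exists>w' v'. C w' v' \<and> agree n w' (slice 0 w) \<and> agree n v' (slice 1 w)" for n
    proof -
      obtain N0 N1 where "\<And>v'. agree N0 v' w \<Longrightarrow> agree n (slice 0 v') (slice 0 w)"
        "\<And>v'. agree N1 v' w \<Longrightarrow> agree n (slice 1 v') (slice 1 w)"
        using slice_agree by metis
      moreover obtain v where "?F v" "agree (max N0 N1) v w" using * by blast
      ultimately show ?thesis
        by (metis agree_mono max.cobounded1 max.cobounded2)
    qed
    then show "?F w" using C unfolding closed2_def by blast
  next
    fix z
    show "P z \<longleftrightarrow> (\<exists>u. ?F u \<and> slice 0 (slice 0 u) = z)"
    proof
      assume "P z"
      then obtain w where w: "Q (z, w)" using Q by blast
      let ?w = "unslice (\<lambda>k. if k = 0 then z else w)"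
      have "?w \<in> {w. Q (slice 0 w, slice 1 w)}" using w by simp
      then obtain v where "C ?w v" unfolding eq by blast
      then show "\<exists>u. ?F u \<and> slice 0 (slice 0 u) = z"
        by (intro exI[of _ "unslice (\<lambda>k. if k = 0 then ?w else v)"]) simp
    next
      assume "\<exists>u. ?F u \<and> slice 0 (slice 0 u) = z"
      then obtain u where u: "?F u" "slice 0 (slice 0 u) = z" by blast
      then have "slice 0 u \<in> {w. Q (slice 0 w, slice 1 w)}" unfolding eq by blast
      then show "P z" using Q u by auto
    qed
  qed
qed

lemma lusin_separation_baire:
  assumes "analytic baire P" "analytic baire Q" "\<And>z. \<not> (P z \<and> Q z)"
  shows "separable_by baire P Q"
proof -
  define idx where "idx n = prod_encode (0, prod_encode (0, n))" for n
  have idx: "(\<lambda>n. u (idx n)) = slice 0 (slice 0 u)" for u :: "nat \<Rightarrow> nat"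
    by (simp add: idx_def slice_def)
  obtain F where F: "\<And>w. (\<And>n. \<exists>v. F v \<and> agree n v w) \<Longrightarrow> F w"
    and P: "\<And>z. P z \<longleftrightarrow> (\<exists>u. F u \<and> (\<lambda>n. u (idx n)) = z)"
    using analytic_baire_closed[OF assms(1)] unfolding idx by metis
  obtain G where G: "\<And>w. (\<And>n. \<exists>v. G v \<and> agree n v w) \<Longrightarrow> G w"
    and Q: "\<And>z. Q z \<longleftrightarrow> (\<exists>u. G u \<and> (\<lambda>n. u (idx n)) = z)"
    using analytic_baire_closed[OF assms(2)] unfolding idx by metis
  have "separable_by baire (\<lambda>z. \<exists>u. F u \<and> (\<lambda>n. u (idx n)) = z) (\<lambda>z. \<exists>u. G u \<and> (\<lambda>n. u (idx n)) = z)"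
    by (rule lusin_separation_closed[OF F G]) (use P Q assms(3) in blast)+
  then show ?thesis unfolding P[abs_def] Q[abs_def] .
qed

text \<open>Everything is moved to Baire space by the injective code \<open>c\<close>. Injectivity
  keeps the images disjoint, the surjection \<open>g\<close> shows that they are analytic, and a
  separator is pulled back along \<open>c\<close>.\<close>

theorem lusin_separation:
  assumes Z: "coded Z" and P: "analytic Z P" and Q: "analytic Z Q"
    and disj: "\<And>z. z \<in> space Z \<Longrightarrow> \<not> (P z \<and> Q z)"
  shows "separable_by Z P Q"
proof -
  obtain c g where c[measurable]: "c \<in> Z \<rightarrow>\<^sub>M baire" and inj: "inj_on c (space Z)"
    and g[measurable]: "g \<in> baire \<rightarrow>\<^sub>M Z" and surj: "range g = space Z"
    using codedE[OF Z] .
  have img: "analytic baire (\<lambda>v. \<exists>w\<in>space baire. v = c (g w) \<and> P' (g w))" if P': "analytic Z P'" for P'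
  proof -
    have P'': "analytic (baire \<Otimes>\<^sub>M baire) (\<lambda>x. P' (g (snd x)))"
      by (rule analytic_compose[OF P']) measurable
    have [measurable]: "(\<lambda>x. fst x n) \<in> baire \<Otimes>\<^sub>M baire \<rightarrow>\<^sub>M count_space UNIV"
      "(\<lambda>x. c (g (snd x)) n) \<in> baire \<Otimes>\<^sub>M baire \<rightarrow>\<^sub>M count_space UNIV" for n
      by (rule measurable_compose[OF _ measurable_baire_component], measurable)+
    have "Measurable.pred (baire \<Otimes>\<^sub>M baire) (\<lambda>x. \<forall>n. \<exists>k. fst x n = k \<and> c (g (snd x)) n = k)"
      by measurable
    moreover have "(\<lambda>x. \<forall>n. \<exists>k. fst x n = k \<and> c (g (snd x)) n = k) = (\<lambda>x. \<forall>n. fst x n = c (g (snd x)) n)"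
      by (auto simp: fun_eq_iff)
    ultimately have "Measurable.pred (baire \<Otimes>\<^sub>M baire) (\<lambda>x. \<forall>n. fst x n = c (g (snd x)) n)"
      by (simp only:)
    then have "analytic (baire \<Otimes>\<^sub>M baire) (\<lambda>x. \<forall>n. fst x n = c (g (snd x)) n)"
      by (rule analytic_measurable)
    from this P'' have "analytic (baire \<Otimes>\<^sub>M baire) (\<lambda>x. (\<forall>n. fst x n = c (g (snd x)) n) \<and> P' (g (snd x)))"
      by (rule analytic_conj)
    from analytic_proj[OF this coded_baire] show ?thesis
      by (simp add: fun_eq_iff)
  qed
  have "separable_by baire (\<lambda>v. \<exists>w\<in>space baire. v = c (g w) \<and> P (g w)) (\<lambda>v. \<exists>w\<in>space baire. v = c (g w) \<and> Q (g w))"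
    by (intro lusin_separation_baire img P Q)
      (use disj inj surj in \<open>metis inj_onD rangeI\<close>)
  then obtain R where [measurable]: "Measurable.pred baire R"
    and R: "\<And>v. (\<exists>w. v = c (g w) \<and> P (g w)) \<Longrightarrow> R v"
      "\<And>v. (\<exists>w. v = c (g w) \<and> Q (g w)) \<Longrightarrow> \<not> R v"
    unfolding separable_by_def space_baire by blast
  have "Measurable.pred Z (\<lambda>z. R (c z))" by measurable
  moreover have "(P z \<longrightarrow> R (c z)) \<and> (Q z \<longrightarrow> \<not> R (c z))" if z: "z \<in> space Z" for z
  proof -
    obtain w where "z = g w" using surj z by auto
    then show ?thesis using R[of "c z"] by blast
  qed
  ultimately show ?thesis unfolding separable_by_def by blast
qed

subsection \<open>Upper semianalytic functions\<close>

text \<open>Upper semianalytic functions. Strict superlevel sets are the right choice because a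
  supremum exceeds \<open>c\<close> iff one of its members does.\<close>

definition usa :: "'a measure \<Rightarrow> ('a \<Rightarrow> ennreal) \<Rightarrow> bool" where
  "usa Z u \<longleftrightarrow> (\<forall>c. analytic Z (\<lambda>z. c < u z))"

lemma usa_measurable:
  assumes [measurable]: "u \<in> borel_measurable Z"
  shows "usa Z u"
  unfolding usa_def by (intro allI analytic_measurable) measurable

lemma usa_compose:
  assumes "usa Z' u" "f \<in> Z \<rightarrow>\<^sub>M Z'"
  shows "usa Z (\<lambda>z. u (f z))"
  using assms analytic_compose[of Z' "\<lambda>z. _ < u z"] unfolding usa_def by blast

lemma usa_max:
  assumes "usa Z u" "usa Z v"
  shows "usa Z (\<lambda>z. max (u z) (v z))"
  using assms unfolding usa_def less_max_iff_disj by (auto intro: analytic_disj)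

text \<open>Reduces superlevel sets of a sum to countably many conditions on the summands. The
  alternative \<open>a = 0\<close> covers \<open>x = 0\<close>, below which there is no rational
  value.\<close>

lemma ennreal_less_add_rat:
  fixes c x y :: ennreal
  assumes "c < x + y"
  shows "\<exists>a b :: rat. (a = 0 \<or> ennreal (real_of_rat a) < x) \<and> (b = 0 \<or> ennreal (real_of_rat b) < y) \<and>
    c < ennreal (real_of_rat a) + ennreal (real_of_rat b)"
proof (cases "c < y")
  case True
  then obtain b :: rat where "c < ennreal (real_of_rat b)" "ennreal (real_of_rat b) < y"
    using ennreal_rat_dense by blast
  then show ?thesis by (intro exI[of _ 0] exI[of _ b]) simp
next
  case False
  have "c \<noteq> \<top>" using assms by auto
  then obtain c' where c': "c = ennreal c'" "0 \<le> c'" by (cases c) auto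
  have "y \<noteq> \<top>" using False \<open>c \<noteq> \<top>\<close> by (auto simp: top.not_eq_extremum)
  then obtain y' where y': "y = ennreal y'" "0 \<le> y'" by (cases y) auto
  have "y' \<le> c'" using False c' y' by (simp add: ennreal_less_iff not_less)
  have "ennreal (c' - y') < x"
  proof (rule ccontr)
    assume "\<not> ennreal (c' - y') < x"
    then have "x + y \<le> ennreal (c' - y') + ennreal y'" by (simp add: add_mono not_less y')
    also have "\<dots> = c" using \<open>y' \<le> c'\<close> y' c' by (simp flip: ennreal_plus)
    finally show False using assms by simp
  qed
  then obtain a :: rat where a: "ennreal (c' - y') < ennreal (real_of_rat a)" "ennreal (real_of_rat a) < x"
    using ennreal_rat_dense by blast
  then have a': "c' - y' < real_of_rat a" using \<open>y' \<le> c'\<close> by (simp add: ennreal_less_iff)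
  have a0: "0 < real_of_rat a" using a' \<open>y' \<le> c'\<close> by linarith
  show ?thesis
  proof (cases "c' < real_of_rat a")
    case True
    then show ?thesis using a c' by (intro exI[of _ a] exI[of _ 0]) (simp add: ennreal_less_iff)
  next
    case False
    have "ennreal (c' - real_of_rat a) < y" using a' False by (simp add: y' ennreal_less_iff)
    then obtain b :: rat where b: "ennreal (c' - real_of_rat a) < ennreal (real_of_rat b)" "ennreal (real_of_rat b) < y"
      using ennreal_rat_dense by blast
    then have b': "c' - real_of_rat a < real_of_rat b" using False by (simp add: ennreal_less_iff)
    then have b0: "0 < real_of_rat b" using False by linarith
    have "c < ennreal (real_of_rat a + real_of_rat b)"
      unfolding c' using c'(2) b' by (simp add: ennreal_less_iff)
    then have "c < ennreal (real_of_rat a) + ennreal (real_of_rat b)"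
      by (subst (asm) ennreal_plus) (use a0 b0 in auto)
    then show ?thesis using a b by blast
  qed
qed

lemma usa_add:
  assumes "usa Z u" "usa Z v"
  shows "usa Z (\<lambda>z. u z + v z)"
  unfolding usa_def
proof
  fix c
  have "analytic Z (\<lambda>z. \<exists>ab :: rat \<times> rat.
      ((fst ab = 0 \<or> ennreal (real_of_rat (fst ab)) < u z) \<and>
       (snd ab = 0 \<or> ennreal (real_of_rat (snd ab)) < v z)) \<and>
      c < ennreal (real_of_rat (fst ab)) + ennreal (real_of_rat (snd ab)))"
    using assms unfolding usa_def
    by (intro analytic_ex_countable analytic_conj analytic_disj) (auto intro: analytic_measurable)
  moreover have "c < u z + v z \<longleftrightarrow> (\<exists>ab :: rat \<times> rat.
      ((fst ab = 0 \<or> ennreal (real_of_rat (fst ab)) < u z) \<and>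
       (snd ab = 0 \<or> ennreal (real_of_rat (snd ab)) < v z)) \<and>
      c < ennreal (real_of_rat (fst ab)) + ennreal (real_of_rat (snd ab)))" for z
  proof
    assume "c < u z + v z"
    from ennreal_less_add_rat[OF this] show "\<exists>ab :: rat \<times> rat.
      ((fst ab = 0 \<or> ennreal (real_of_rat (fst ab)) < u z) \<and>
       (snd ab = 0 \<or> ennreal (real_of_rat (snd ab)) < v z)) \<and>
      c < ennreal (real_of_rat (fst ab)) + ennreal (real_of_rat (snd ab))" by auto
  next
    assume "\<exists>ab :: rat \<times> rat.
      ((fst ab = 0 \<or> ennreal (real_of_rat (fst ab)) < u z) \<and>
       (snd ab = 0 \<or> ennreal (real_of_rat (snd ab)) < v z)) \<and>
      c < ennreal (real_of_rat (fst ab)) + ennreal (real_of_rat (snd ab))"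
    then obtain a b :: rat where ab: "a = 0 \<or> ennreal (real_of_rat a) < u z"
      "b = 0 \<or> ennreal (real_of_rat b) < v z" "c < ennreal (real_of_rat a) + ennreal (real_of_rat b)"
      by auto
    have "ennreal (real_of_rat a) \<le> u z" "ennreal (real_of_rat b) \<le> v z" using ab by auto
    then show "c < u z + v z" using ab(3) by (meson add_mono less_le_trans)
  qed
  ultimately show "analytic Z (\<lambda>z. c < u z + v z)" by simp
qed

text \<open>Multiplication by \<open>p z\<close> commutes with the supremum of the rationals below
  \<open>u z\<close>, so the quantifier over a rational factor is enough, also at the values 0 and
  infinity.\<close>

lemma usa_cmult:
  assumes "usa Z u" and [measurable]: "p \<in> borel_measurable Z"
  shows "usa Z (\<lambda>z. p z * u z)"
  unfolding usa_def
proof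
  fix c :: ennreal
  have "analytic Z (\<lambda>z. \<exists>r :: rat. c < p z * ennreal (real_of_rat r) \<and> ennreal (real_of_rat r) < u z)"
    using assms(1) unfolding usa_def
    by (intro analytic_ex_countable analytic_conj) (auto intro!: analytic_measurable)
  moreover have "c < p z * u z \<longleftrightarrow> (\<exists>r :: rat. c < p z * ennreal (real_of_rat r) \<and> ennreal (real_of_rat r) < u z)" for z
  proof
    assume less: "c < p z * u z"
    have U: "u z = (SUP r\<in>{r :: rat. ennreal (real_of_rat r) < u z}. ennreal (real_of_rat r))"
    proof (rule antisym)
      show "u z \<le> (SUP r\<in>{r :: rat. ennreal (real_of_rat r) < u z}. ennreal (real_of_rat r))"
      proof (rule dense_le)
        fix x assume "x < u z"
        then obtain r :: rat where "x < ennreal (real_of_rat r)" "ennreal (real_of_rat r) < u z"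
          using ennreal_rat_dense by blast
        then show "x \<le> (SUP r\<in>{r :: rat. ennreal (real_of_rat r) < u z}. ennreal (real_of_rat r))"
          by (intro SUP_upper2[of r]) auto
      qed
    qed (auto intro!: SUP_least)
    have "p z * u z = (SUP r\<in>{r :: rat. ennreal (real_of_rat r) < u z}. p z * ennreal (real_of_rat r))"
      by (rule trans[OF arg_cong[where f = "(*) (p z)", OF U] SUP_mult_left_ennreal])
    with less have "c < (SUP r\<in>{r :: rat. ennreal (real_of_rat r) < u z}. p z * ennreal (real_of_rat r))"
      by (simp only:)
    then show "\<exists>r :: rat. c < p z * ennreal (real_of_rat r) \<and> ennreal (real_of_rat r) < u z"
      unfolding less_SUP_iff by blast
  next
    assume "\<exists>r :: rat. c < p z * ennreal (real_of_rat r) \<and> ennreal (real_of_rat r) < u z"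
    then show "c < p z * u z" by (meson less_imp_le less_le_trans mult_left_mono zero_le)
  qed
  ultimately show "analytic Z (\<lambda>z. c < p z * u z)" by simp
qed

lemma usa_sum:
  fixes u :: "nat \<Rightarrow> 'a \<Rightarrow> ennreal"
  assumes "\<And>i. i < n \<Longrightarrow> usa Z (u i)"
  shows "usa Z (\<lambda>z. \<Sum>i<n. u i z)"
  using assms by (induction n) (auto intro: usa_add usa_measurable)

lemma usa_SUP_nat:
  fixes u :: "nat \<Rightarrow> 'a \<Rightarrow> ennreal"
  assumes "\<And>n. usa Z (u n)"
  shows "usa Z (\<lambda>z. SUP n. u n z)"
  using assms analytic_ex_nat[of Z "\<lambda>n z. _ < u n z"] unfolding usa_def less_SUP_iff by simp

text \<open>Exceeding \<open>c\<close> is an existential statement over \<open>Y\<close>, hence a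
  projection. This is the closure property that Borel functions lack and that forces the use of
  analytic sets.\<close>

lemma usa_SUP_proj:
  assumes Y: "coded Y" and u: "usa (Z \<Otimes>\<^sub>M Y) u" and R: "analytic (Z \<Otimes>\<^sub>M Y) R"
  shows "usa Z (\<lambda>z. SUP y\<in>{y\<in>space Y. R (z, y)}. u (z, y))"
  unfolding usa_def
proof
  fix c
  have "analytic (Z \<Otimes>\<^sub>M Y) (\<lambda>x. R x \<and> c < u x)"
    using u R unfolding usa_def by (intro analytic_conj) auto
  from analytic_proj[OF this Y]
  show "analytic Z (\<lambda>z. c < (SUP y\<in>{y\<in>space Y. R (z, y)}. u (z, y)))"
    unfolding less_SUP_iff by (simp add: conj_commute Bex_def conj_ac)
qed

subsection \<open>Measurable selection from coanalytic compact-valued maps\<close>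

text \<open>Bisection by the half-spaces with rational thresholds orthogonal to the coordinate axes,
  enumerated by \<open>h\<close>. At each stage at least one closed half still meets
  \<open>\<Gamma> z\<close> within the current cell, so the two events of missing it are disjoint,
  and a Borel separator chooses a half. Compactness leaves a point in all chosen cells, and the
  record of the choices determines its coordinates.\<close>

theorem compact_selection:
  fixes \<Gamma> :: "'z \<Rightarrow> 'v::euclidean_space set"
  assumes Z: "coded Z"
    and comp: "\<And>z. z \<in> space Z \<Longrightarrow> compact (\<Gamma> z)"
    and ne: "\<And>z. z \<in> space Z \<Longrightarrow> \<Gamma> z \<noteq> {}"
    and an: "\<And>C. closed C \<Longrightarrow> analytic Z (\<lambda>z. \<Gamma> z \<inter> C = {})"
  obtains l where "l \<in> Z \<rightarrow>\<^sub>M borel" "\<And>z. z \<in> space Z \<Longrightarrow> l z \<in> \<Gamma> z"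
proof -
  define h :: "nat \<Rightarrow> 'v \<times> rat" where "h = from_nat_into (Basis \<times> UNIV)"
  have "countable (Basis \<times> UNIV :: ('v \<times> rat) set)"
    by (intro countable_SIGMA) (auto simp: countable_finite)
  then have h_surj: "\<exists>k. h k = (b, q)" if "b \<in> Basis" for b q
    using from_nat_into_surj[of "Basis \<times> UNIV" "(b, q)"] that unfolding h_def by auto
  define H where "H k c = {v :: 'v. if c then v \<bullet> fst (h k) \<ge> real_of_rat (snd (h k))
    else v \<bullet> fst (h k) \<le> real_of_rat (snd (h k))}" for k c
  have H_closed: "closed (H k c)" for k c
    unfolding H_def by (cases c) (auto simp: closed_halfspace_component_ge inner_commute[of _ "fst (h k)"]
        closed_halfspace_ge closed_halfspace_le)
  have H_cover: "v \<in> H k True \<or> v \<in> H k False" for v k unfolding H_def by auto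
  define cell where "cell bs = (\<Inter>j<length bs. H j (bs ! j))" for bs
  have cell_closed: "closed (cell bs)" for bs unfolding cell_def using H_closed by auto
  have cell_snoc: "cell (bs @ [c]) = cell bs \<inter> H (length bs) c" for bs c
    unfolding cell_def by (auto simp: nth_append lessThan_Suc)
  have "\<exists>f. \<forall>n. (f n \<in> Z \<rightarrow>\<^sub>M count_space UNIV \<and>
      (\<forall>z\<in>space Z. length (f n z) = n \<and> \<Gamma> z \<inter> cell (f n z) \<noteq> {})) \<and>
      (\<forall>z. \<exists>c. f (Suc n) z = f n z @ [c])"
  proof (rule dependent_nat_choice)
    show "\<exists>x. x \<in> Z \<rightarrow>\<^sub>M count_space UNIV \<and> (\<forall>z\<in>space Z. length (x z) = 0 \<and> \<Gamma> z \<inter> cell (x z) \<noteq> {})"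
      by (rule exI[of _ "\<lambda>_. []"]) (auto simp: cell_def ne)
  next
    fix f :: "'z \<Rightarrow> bool list" and n
    assume "f \<in> Z \<rightarrow>\<^sub>M count_space UNIV \<and> (\<forall>z\<in>space Z. length (f z) = n \<and> \<Gamma> z \<inter> cell (f z) \<noteq> {})"
    then have f[measurable]: "f \<in> Z \<rightarrow>\<^sub>M count_space UNIV"
      and len: "\<And>z. z \<in> space Z \<Longrightarrow> length (f z) = n"
      and nonempty: "\<And>z. z \<in> space Z \<Longrightarrow> \<Gamma> z \<inter> cell (f z) \<noteq> {}" by auto
    have an': "analytic Z (\<lambda>z. \<Gamma> z \<inter> cell (f z @ [c]) = {})" for c
    proof -
      have "analytic Z (\<lambda>z. \<exists>bs. f z = bs \<and> \<Gamma> z \<inter> cell (bs @ [c]) = {})"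
        by (intro analytic_ex_countable analytic_conj an cell_closed analytic_measurable) measurable
      then show ?thesis by simp
    qed
    have "separable_by Z (\<lambda>z. \<Gamma> z \<inter> cell (f z @ [False]) = {}) (\<lambda>z. \<Gamma> z \<inter> cell (f z @ [True]) = {})"
    proof (rule lusin_separation[OF Z an' an'])
      fix z assume z: "z \<in> space Z"
      obtain v where v: "v \<in> \<Gamma> z" "v \<in> cell (f z)" using nonempty[OF z] by blast
      then have "v \<in> cell (f z @ [True]) \<or> v \<in> cell (f z @ [False])"
        using H_cover[of v n] by (simp add: cell_snoc len[OF z])
      then show "\<not> (\<Gamma> z \<inter> cell (f z @ [False]) = {} \<and> \<Gamma> z \<inter> cell (f z @ [True]) = {})"
        using v by blast
    qed
    \<comment> \<open>\<open>R\<close> holds wherever the lower half is lost and fails wherever the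
      upper half is lost, so appending the truth value of \<open>R z\<close> always keeps a
      non-empty piece.\<close>
    then obtain R where [measurable]: "Measurable.pred Z R"
      and R: "\<And>z. z \<in> space Z \<Longrightarrow> \<Gamma> z \<inter> cell (f z @ [False]) = {} \<Longrightarrow> R z"
        "\<And>z. z \<in> space Z \<Longrightarrow> \<Gamma> z \<inter> cell (f z @ [True]) = {} \<Longrightarrow> \<not> R z"
      unfolding separable_by_def by blast
    have "(\<lambda>z. f z @ [R z]) \<in> Z \<rightarrow>\<^sub>M count_space UNIV" by measurable
    moreover have "\<Gamma> z \<inter> cell (f z @ [R z]) \<noteq> {}" if "z \<in> space Z" for z
      using R[OF that] by (cases "R z") auto
    ultimately show "\<exists>y. (y \<in> Z \<rightarrow>\<^sub>M count_space UNIV \<and>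
        (\<forall>z\<in>space Z. length (y z) = Suc n \<and> \<Gamma> z \<inter> cell (y z) \<noteq> {})) \<and> (\<forall>z. \<exists>c. y z = f z @ [c])"
      using len by (intro exI[of _ "\<lambda>z. f z @ [R z]"]) auto
  qed
  then obtain f where f[measurable]: "\<And>n. f n \<in> Z \<rightarrow>\<^sub>M count_space UNIV"
    and len: "\<And>n z. z \<in> space Z \<Longrightarrow> length (f n z) = n"
    and nonempty: "\<And>n z. z \<in> space Z \<Longrightarrow> \<Gamma> z \<inter> cell (f n z) \<noteq> {}"
    and step: "\<And>n z. \<exists>c. f (Suc n) z = f n z @ [c]" by metis
  have "\<exists>v. v \<in> \<Gamma> z \<and> (\<forall>n. v \<in> cell (f n z))" if z: "z \<in> space Z" for z
  proof -
    have mono: "cell (f n z) \<subseteq> cell (f m z)" if "m \<le> n" for m n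
      using that
    proof (induction rule: dec_induct)
      case (step k)
      obtain c where "f (Suc k) z = f k z @ [c]" using \<open>\<And>n z. \<exists>c. f (Suc n) z = f n z @ [c]\<close> by blast
      then show ?case using step by (auto simp: cell_snoc)
    qed simp
    have "\<Inter> (range (\<lambda>n. \<Gamma> z \<inter> cell (f n z))) \<noteq> {}"
    proof (rule compact_nest)
      show "compact (\<Gamma> z \<inter> cell (f n z))" for n by (intro compact_Int_closed comp z cell_closed)
    qed (use nonempty[OF z] mono in blast)+
    then show ?thesis by auto
  qed
  then obtain l where l: "\<And>z. z \<in> space Z \<Longrightarrow> l z \<in> \<Gamma> z" "\<And>z n. z \<in> space Z \<Longrightarrow> l z \<in> cell (f n z)"
    by metis
  have lH: "l z \<in> H k (f (Suc k) z ! k)" if "z \<in> space Z" for z k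
    using l(2)[OF that, of "Suc k"] len[OF that, of "Suc k"] unfolding cell_def by auto
  have "l \<in> borel_measurable Z"
    unfolding borel_measurable_euclidean_space[where f = l]
  proof
    fix b :: 'v assume b: "b \<in> Basis"
    show "(\<lambda>z. l z \<bullet> b) \<in> borel_measurable Z"
      unfolding borel_measurable_iff_less
    proof
      fix r :: real
      \<comment> \<open>A rational threshold strictly between \<open>l z \<bullet> b\<close> and
        \<open>r\<close> must have led to the lower half; conversely a lower half with threshold
        below \<open>r\<close> bounds the coordinate. Thus the countably many bits determine
        \<open>l\<close> measurably.\<close>
      have "l z \<bullet> b < r \<longleftrightarrow> (\<exists>k. (fst (h k) = b \<and> real_of_rat (snd (h k)) < r) \<and> \<not> f (Suc k) z ! k)"
        if z: "z \<in> space Z" for z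
      proof
        assume "l z \<bullet> b < r"
        then obtain q where q: "l z \<bullet> b < real_of_rat q" "real_of_rat q < r"
          using of_rat_dense by blast
        obtain k where "h k = (b, q)" using h_surj[OF b] by blast
        then show "\<exists>k. (fst (h k) = b \<and> real_of_rat (snd (h k)) < r) \<and> \<not> f (Suc k) z ! k"
          using q lH[OF z, of k] by (intro exI[of _ k]) (auto simp: H_def split: if_splits)
      next
        assume "\<exists>k. (fst (h k) = b \<and> real_of_rat (snd (h k)) < r) \<and> \<not> f (Suc k) z ! k"
        then obtain k where "fst (h k) = b" "real_of_rat (snd (h k)) < r" "\<not> f (Suc k) z ! k" by blast
        then show "l z \<bullet> b < r" using lH[OF z, of k] by (auto simp: H_def)
      qed
      then have eq: "{z \<in> space Z. l z \<bullet> b < r} =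
          {z \<in> space Z. \<exists>k. (fst (h k) = b \<and> real_of_rat (snd (h k)) < r) \<and> \<not> f (Suc k) z ! k}" by auto
      show "{z \<in> space Z. l z \<bullet> b < r} \<in> sets Z"
        unfolding eq by measurable
    qed
  qed
  then show thesis using l(1) that by blast
qed

text \<open>The good bets at \<open>z\<close> form the intersection of \<open>K\<close> with the
  closed sets \<open>F y q\<close> over all rationals \<open>q\<close> whose value lies below
  \<open>u (z, y)\<close>. By the finite intersection property, \<open>\<Gamma> z \<inter> C\<close>
  is empty iff finitely many such constraints are contradictory on \<open>K \<inter> C\<close>. In
  this existential statement \<open>u\<close> occurs only through its superlevel sets, so it is
  analytic and \<open>compact_selection\<close> applies.\<close>

theorem bet_selection:
  fixes \<Phi> :: "'a \<Rightarrow> real ^ 'm" and K T :: "(real ^ 'm) set"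
  assumes Z: "coded Z" and N: "coded N" and \<Phi>[measurable]: "\<Phi> \<in> N \<rightarrow>\<^sub>M borel"
    and K: "compact K" and T: "T \<noteq> {}" and u: "usa (Z \<Otimes>\<^sub>M N) u"
    and ex: "\<And>z. z \<in> space Z \<Longrightarrow>
      \<exists>l\<in>K. \<forall>y\<in>space N. \<forall>s\<in>T. u (z, y) \<le> ennreal (1 + l \<bullet> (\<Phi> y - s))"
    and K_nonneg: "\<And>l y s. l \<in> K \<Longrightarrow> y \<in> space N \<Longrightarrow> s \<in> T \<Longrightarrow> 0 \<le> 1 + l \<bullet> (\<Phi> y - s)"
  obtains l where "l \<in> Z \<rightarrow>\<^sub>M borel" "\<And>z. z \<in> space Z \<Longrightarrow> l z \<in> K"
    "\<And>z y s. z \<in> space Z \<Longrightarrow> y \<in> space N \<Longrightarrow> s \<in> T \<Longrightarrow> u (z, y) \<le> ennreal (1 + l z \<bullet> (\<Phi> y - s))"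
proof -
  define F where "F y q = {l. \<forall>s\<in>T. q \<le> 1 + l \<bullet> (\<Phi> y - s)}" for y q
  have F_closed: "closed (F y q)" for y q
  proof -
    have "F y q = (\<Inter>s\<in>T. {l. q - 1 \<le> (\<Phi> y - s) \<bullet> l})"
      unfolding F_def by (auto simp: inner_commute diff_le_eq add.commute)
    then show ?thesis by (auto intro: closed_halfspace_ge)
  qed
  define \<Gamma> where "\<Gamma> z = {l\<in>K. \<forall>y\<in>space N. \<forall>s\<in>T. u (z, y) \<le> ennreal (1 + l \<bullet> (\<Phi> y - s))}" for z
  define I where "I z = {(y, q). y \<in> space N \<and> ennreal (real_of_rat q) < u (z, y)}" for z
  have \<Gamma>_eq: "\<Gamma> z = K \<inter> (\<Inter>i\<in>I z. F (fst i) (real_of_rat (snd i)))" for z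
  proof (intro set_eqI iffI)
    fix l assume l: "l \<in> \<Gamma> z"
    have "real_of_rat q \<le> 1 + l \<bullet> (\<Phi> y - s)"
      if "y \<in> space N" "ennreal (real_of_rat q) < u (z, y)" "s \<in> T" for y q s
    proof (rule ccontr)
      assume "\<not> ?thesis"
      then have "ennreal (1 + l \<bullet> (\<Phi> y - s)) \<le> ennreal (real_of_rat q)" by (intro ennreal_leI) simp
      moreover have "u (z, y) \<le> ennreal (1 + l \<bullet> (\<Phi> y - s))" using l that unfolding \<Gamma>_def by auto
      ultimately show False using that by simp
    qed
    then show "l \<in> K \<inter> (\<Inter>i\<in>I z. F (fst i) (real_of_rat (snd i)))"
      using l unfolding \<Gamma>_def F_def I_def by auto
  next
    fix l assume l: "l \<in> K \<inter> (\<Inter>i\<in>I z. F (fst i) (real_of_rat (snd i)))"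
    have "u (z, y) \<le> ennreal (1 + l \<bullet> (\<Phi> y - s))" if ys: "y \<in> space N" "s \<in> T" for y s
    proof (rule ccontr)
      assume "\<not> ?thesis"
      then have "ennreal (1 + l \<bullet> (\<Phi> y - s)) < u (z, y)" by simp
      from ennreal_rat_dense[OF this] obtain q where q: "ennreal (1 + l \<bullet> (\<Phi> y - s)) < ennreal (real_of_rat q)"
        "ennreal (real_of_rat q) < u (z, y)" by blast
      then have "(y, q) \<in> I z" using ys unfolding I_def by simp
      then have "l \<in> F (fst (y, q)) (real_of_rat (snd (y, q)))" using l by blast
      then have "real_of_rat q \<le> 1 + l \<bullet> (\<Phi> y - s)" using ys unfolding F_def by simp
      from ennreal_leI[OF this] show False using q(1) by simp
    qed
    then show "l \<in> \<Gamma> z" using l unfolding \<Gamma>_def by auto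
  qed
  define Y where "Y = PiM (UNIV :: nat set) (\<lambda>_. N)"
  have Y: "coded Y" unfolding Y_def by (rule coded_PiM) fact
  have [measurable]: "(\<lambda>y. y i) \<in> Y \<rightarrow>\<^sub>M N" for i
    unfolding Y_def by (rule measurable_component_singleton) simp
  obtain y0 where y0: "y0 \<in> space N" using codedE[OF N] by (metis rangeI)
  have empty_iff: "\<Gamma> z \<inter> C = {} \<longleftrightarrow> (\<exists>qs. \<exists>y\<in>space Y. (\<forall>i<length qs. ennreal (real_of_rat (qs ! i)) < u (z, y i)) \<and>
      \<not> (\<exists>l\<in>K \<inter> C. \<forall>i<length qs. l \<in> F (y i) (real_of_rat (qs ! i))))" (is "_ \<longleftrightarrow> ?R")
    if C: "closed C" for C z
  proof
    assume empty: "\<Gamma> z \<inter> C = {}"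
    have "\<exists>I'. finite I' \<and> I' \<subseteq> I z \<and> K \<inter> C \<inter> (\<Inter>i\<in>I'. F (fst i) (real_of_rat (snd i))) = {}"
    proof (rule ccontr)
      assume no: "\<not> ?thesis"
      have "K \<inter> C \<inter> (\<Inter>i\<in>I z. F (fst i) (real_of_rat (snd i))) \<noteq> {}"
        by (rule compact_imp_fip_image[OF compact_Int_closed[OF K C]]) (use F_closed no in auto)
      then show False using empty unfolding \<Gamma>_eq by auto
    qed
    then obtain I' where I': "finite I'" "I' \<subseteq> I z" "K \<inter> C \<inter> (\<Inter>i\<in>I'. F (fst i) (real_of_rat (snd i))) = {}"
      by (elim exE conjE)
    obtain xs where xs: "set xs = I'" using I'(1) finite_list by blast
    \<comment> \<open>Finite families of points are stored as infinite sequences padded by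
      \<open>y0\<close>; the list of rationals carries the length.\<close>
    let ?y = "\<lambda>i. if i < length xs then fst (xs ! i) else y0"
    have mem: "xs ! i \<in> I z" if "i < length xs" for i using that xs I'(2) nth_mem by blast
    have "?y \<in> space Y" using mem y0 unfolding Y_def I_def by (auto simp: space_PiM split_beta)
    moreover have "\<forall>i<length (map snd xs). ennreal (real_of_rat (map snd xs ! i)) < u (z, ?y i)"
      using mem unfolding I_def by (auto simp: split_beta)
    moreover have "\<not> (\<exists>l\<in>K \<inter> C. \<forall>i<length (map snd xs). l \<in> F (?y i) (real_of_rat (map snd xs ! i)))"
    proof
      assume "\<exists>l\<in>K \<inter> C. \<forall>i<length (map snd xs). l \<in> F (?y i) (real_of_rat (map snd xs ! i))"
      then obtain l where l: "l \<in> K \<inter> C" "\<And>i. i < length xs \<Longrightarrow> l \<in> F (fst (xs ! i)) (real_of_rat (snd (xs ! i)))"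
        by auto
      have "l \<in> F (fst i) (real_of_rat (snd i))" if "i \<in> I'" for i
        using l(2) that xs by (metis in_set_conv_nth)
      then show False using l(1) I'(3) by blast
    qed
    ultimately show ?R by (intro exI[of _ "map snd xs"] bexI[of _ ?y] conjI)
  next
    assume ?R
    then obtain qs y where y: "y \<in> space Y" and q: "\<forall>i<length qs. ennreal (real_of_rat (qs ! i)) < u (z, y i)"
      and no: "\<not> (\<exists>l\<in>K \<inter> C. \<forall>i<length qs. l \<in> F (y i) (real_of_rat (qs ! i)))" by blast
    have "(y i, qs ! i) \<in> I z" if "i < length qs" for i
      using q y that unfolding I_def Y_def by (auto simp: space_PiM)
    then have "l \<in> F (fst (y i, qs ! i)) (real_of_rat (snd (y i, qs ! i)))" if "l \<in> \<Gamma> z" "i < length qs" for l i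
      using that unfolding \<Gamma>_eq by blast
    then have "l \<in> F (y i) (real_of_rat (qs ! i))" if "l \<in> \<Gamma> z" "i < length qs" for l i
      using that by simp
    then show "\<Gamma> z \<inter> C = {}" using no unfolding \<Gamma>_eq by blast
  qed
  \<comment> \<open>The set of statistics that admit a common bet is closed, since bets in a compact
    set have convergent subsequences. Its preimage under \<Phi> is therefore Borel despite the
    quantifiers over \<open>l\<close> and over the arbitrary set \<open>T\<close>.\<close>
  have closed: "closed {\<phi> :: nat \<Rightarrow> real ^ 'm. \<exists>l\<in>K \<inter> C. \<forall>i<n. \<forall>s\<in>T. q i \<le> 1 + l \<bullet> (\<phi> i - s)}"
    if C: "closed C" for C n and q :: "nat \<Rightarrow> real"
    unfolding closed_sequential_limits
  proof (intro allI impI, elim conjE)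
    fix \<phi>s :: "nat \<Rightarrow> nat \<Rightarrow> real ^ 'm" and \<phi>
    assume mem: "\<forall>k. \<phi>s k \<in> {\<phi>. \<exists>l\<in>K \<inter> C. \<forall>i<n. \<forall>s\<in>T. q i \<le> 1 + l \<bullet> (\<phi> i - s)}"
      and lim: "\<phi>s \<longlonglongrightarrow> \<phi>"
    have limc: "(\<lambda>k. \<phi>s k i) \<longlonglongrightarrow> \<phi> i" for i
      by (rule continuous_on_tendsto_compose[OF continuous_on_product_coordinates lim]) auto
    have "\<forall>k. \<exists>l. l \<in> K \<inter> C \<and> (\<forall>i<n. \<forall>s\<in>T. q i \<le> 1 + l \<bullet> (\<phi>s k i - s))" using mem by blast
    from choice[OF this] obtain ls where ls: "\<And>k. ls k \<in> K \<inter> C"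
      "\<And>k i s. i < n \<Longrightarrow> s \<in> T \<Longrightarrow> q i \<le> 1 + ls k \<bullet> (\<phi>s k i - s)" by blast
    obtain l r where l: "l \<in> K \<inter> C" and r: "strict_mono r" and lr: "(ls \<circ> r) \<longlonglongrightarrow> l"
      using seq_compactE[OF compact_Int_closed[OF K C, unfolded compact_eq_seq_compact_metric], of ls] ls(1) by metis
    have "q i \<le> 1 + l \<bullet> (\<phi> i - s)" if "i < n" "s \<in> T" for i s
    proof (rule tendsto_lowerbound)
      have "(\<lambda>k. \<phi>s (r k) i) \<longlonglongrightarrow> \<phi> i" using LIMSEQ_subseq_LIMSEQ[OF limc r] by (simp add: o_def)
      then show "(\<lambda>k. 1 + ls (r k) \<bullet> (\<phi>s (r k) i - s)) \<longlonglongrightarrow> 1 + l \<bullet> (\<phi> i - s)"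
        using lr unfolding o_def by (intro tendsto_intros)
    qed (use ls(2) that in auto)
    then show "\<phi> \<in> {\<phi>. \<exists>l\<in>K \<inter> C. \<forall>i<n. \<forall>s\<in>T. q i \<le> 1 + l \<bullet> (\<phi> i - s)}" using l by blast
  qed
  have an: "analytic Z (\<lambda>z. \<Gamma> z \<inter> C = {})" if C: "closed C" for C
  proof -
    have meas: "Measurable.pred Y (\<lambda>y. \<not> (\<exists>l\<in>K \<inter> C. \<forall>i<length qs. l \<in> F (y i) (real_of_rat (qs ! i))))" for qs
    proof -
      have m: "(\<lambda>y i. \<Phi> (y i)) \<in> Y \<rightarrow>\<^sub>M borel"
        unfolding measurable_cong_sets[OF refl sets_PiM_equal_borel[symmetric]]
        by (rule measurable_PiM_single') (auto simp: space_PiM)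
      have "{\<phi> :: nat \<Rightarrow> real ^ 'm. \<exists>l\<in>K \<inter> C. \<forall>i<length qs. \<forall>s\<in>T. real_of_rat (qs ! i) \<le> 1 + l \<bullet> (\<phi> i - s)} \<in> sets borel"
        by (rule borel_closed[OF closed[OF C]])
      then have [measurable]: "Measurable.pred borel (\<lambda>\<phi> :: nat \<Rightarrow> real ^ 'm. \<exists>l\<in>K \<inter> C. \<forall>i<length qs. \<forall>s\<in>T. real_of_rat (qs ! i) \<le> 1 + l \<bullet> (\<phi> i - s))"
        by (simp add: pred_def)
      show ?thesis
        unfolding F_def mem_Collect_eq
        by (rule pred_intros_logic(2)) (rule measurable_compose[OF m, of _ "count_space UNIV"], measurable)
    qed
    have "analytic (Z \<Otimes>\<^sub>M Y) (\<lambda>x. (\<forall>i<length qs. ennreal (real_of_rat (qs ! i)) < u (fst x, snd x i)) \<and>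
        \<not> (\<exists>l\<in>K \<inter> C. \<forall>i<length qs. l \<in> F (snd x i) (real_of_rat (qs ! i))))" for qs
    proof (rule analytic_conj)
      have "usa (Z \<Otimes>\<^sub>M Y) (\<lambda>x. u (fst x, snd x i))" for i
        by (rule usa_compose[OF u]) measurable
      then show "analytic (Z \<Otimes>\<^sub>M Y) (\<lambda>x. \<forall>i<length qs. ennreal (real_of_rat (qs ! i)) < u (fst x, snd x i))"
        unfolding usa_def by (intro analytic_all_less) blast
      show "analytic (Z \<Otimes>\<^sub>M Y) (\<lambda>x. \<not> (\<exists>l\<in>K \<inter> C. \<forall>i<length qs. l \<in> F (snd x i) (real_of_rat (qs ! i))))"
        by (rule analytic_measurable) (rule measurable_compose[OF measurable_snd meas])
    qed
    from analytic_ex_countable[OF analytic_proj[OF this Y]]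
    show ?thesis unfolding empty_iff[OF C] by simp
  qed
  obtain l where l: "l \<in> Z \<rightarrow>\<^sub>M borel" "\<And>z. z \<in> space Z \<Longrightarrow> l z \<in> \<Gamma> z"
  proof (rule compact_selection[OF Z])
    fix z assume z: "z \<in> space Z"
    show "compact (\<Gamma> z)" unfolding \<Gamma>_eq by (intro compact_Int_closed K closed_INT ballI F_closed)
    show "\<Gamma> z \<noteq> {}" using ex[OF z] unfolding \<Gamma>_def by blast
  qed (use an in auto)
  show thesis
    by (rule that[OF l(1)]) (use l(2) in \<open>auto simp: \<Gamma>_def\<close>)
qed

lemma coded_singleton:
  assumes "coded N" "x \<in> space N"
  shows "{x} \<in> sets N"
proof -
  obtain c where c[measurable]: "c \<in> N \<rightarrow>\<^sub>M baire" and inj: "inj_on c (space N)"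
    using codedE[OF assms(1)] by metis
  have "{y \<in> space N. \<forall>n. c y n = c x n} \<in> sets N" by measurable
  also have "{y \<in> space N. \<forall>n. c y n = c x n} = {x}"
    using inj assms(2) by (auto simp: inj_on_def fun_eq_iff)
  finally show ?thesis .
qed

subsection \<open>Finitely supported distributions\<close>

definition simplex_weights :: "nat \<Rightarrow> (nat \<Rightarrow> real) \<Rightarrow> bool" where
  "simplex_weights n p \<longleftrightarrow> (\<forall>i<n. 0 \<le> p i) \<and> (\<Sum>i<n. p i) = 1"

definition fin_dist :: "'a measure \<Rightarrow> nat \<Rightarrow> (nat \<Rightarrow> real) \<Rightarrow> (nat \<Rightarrow> 'a) \<Rightarrow> 'a measure" where
  "fin_dist M n p y = distr (point_measure {..<n} (\<lambda>i. ennreal (p i))) M y"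

lemma sets_fin_dist [simp, measurable_cong]: "sets (fin_dist M n p y) = sets M"
  by (simp add: fin_dist_def)

lemma space_fin_dist [simp]: "space (fin_dist M n p y) = space M"
  by (simp add: fin_dist_def)

context
  fixes M :: "'a measure" and n p and y :: "nat \<Rightarrow> 'a"
  assumes p: "simplex_weights n p" and y: "\<And>i. i < n \<Longrightarrow> y i \<in> space M"
begin

lemma measurable_fin_dist_map: "y \<in> point_measure {..<n} (\<lambda>i. ennreal (p i)) \<rightarrow>\<^sub>M M"
  using y by (auto simp: point_measure_def)

lemma nn_integral_fin_dist:
  assumes [measurable]: "f \<in> borel_measurable M"
  shows "(\<integral>\<^sup>+x. f x \<partial>fin_dist M n p y) = (\<Sum>i<n. ennreal (p i) * f (y i))"
  unfolding fin_dist_def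
  by (subst nn_integral_distr[OF measurable_fin_dist_map])
    (auto simp: nn_integral_point_measure_finite)

lemma prob_space_fin_dist: "prob_space (fin_dist M n p y)"
proof
  have "emeasure (fin_dist M n p y) (space M) = (\<integral>\<^sup>+x. 1 \<partial>fin_dist M n p y)" by simp
  also have "\<dots> = (\<Sum>i<n. ennreal (p i))" by (subst nn_integral_fin_dist) auto
  also have "\<dots> = ennreal (\<Sum>i<n. p i)" using p by (intro sum_ennreal) (auto simp: simplex_weights_def)
  finally show "emeasure (fin_dist M n p y) (space (fin_dist M n p y)) = 1"
    using p by (simp add: simplex_weights_def)
qed

lemma emeasure_fin_dist_singleton:
  assumes "{x} \<in> sets M" "j < n" "p j > 0" "y j = x"
  shows "emeasure (fin_dist M n p y) {x} > 0"
proof -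
  have "0 < ennreal (p j) * indicator {x} (y j)" using assms by simp
  also have "\<dots> \<le> (\<Sum>i<n. ennreal (p i) * indicator {x} (y i))"
    using assms(2) by (intro member_le_sum) auto
  also have "\<dots> = (\<integral>\<^sup>+z. indicator {x} z \<partial>fin_dist M n p y)"
    by (rule nn_integral_fin_dist[symmetric]) (use assms(1) in measurable)
  also have "\<dots> = emeasure (fin_dist M n p y) {x}"
    using assms(1) by simp
  finally show ?thesis .
qed

lemma integral_fin_dist:
  fixes f :: "'a \<Rightarrow> 'v::{banach, second_countable_topology}"
  assumes f[measurable]: "f \<in> borel_measurable M"
  shows "(\<integral>x. f x \<partial>fin_dist M n p y) = (\<Sum>i<n. p i *\<^sub>R f (y i))"
proof -
  have "(\<integral>x. f x \<partial>fin_dist M n p y) = (\<integral>i. f (y i) \<partial>point_measure {..<n} (\<lambda>i. ennreal (p i)))"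
    unfolding fin_dist_def by (rule integral_distr[OF measurable_fin_dist_map f])
  also have "\<dots> = (\<Sum>i<n. p i *\<^sub>R f (y i))"
    by (rule lebesgue_integral_point_measure_finite) (use p in \<open>auto simp: simplex_weights_def\<close>)
  finally show ?thesis .
qed

end

lemma convex_hull_image_simplex:
  fixes f :: "'a \<Rightarrow> 'v::real_vector"
  assumes "c \<in> convex hull (f ` X)"
  obtains n p y where "simplex_weights n p" "\<And>i. i < n \<Longrightarrow> y i \<in> X" "c = (\<Sum>i<n. p i *\<^sub>R f (y i))"
proof -
  obtain k u x where ux: "\<forall>i\<in>{1::nat..k}. 0 \<le> u i \<and> x i \<in> f ` X" "sum u {1..k} = 1"
    "(\<Sum>i\<in>{1..k}. u i *\<^sub>R x i) = c"
    using assms unfolding convex_hull_indexed by auto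
  have "\<forall>i\<in>{1..k}. \<exists>z. z \<in> X \<and> x i = f z" using ux(1) by (simp add: image_iff Bex_def)
  from bchoice[OF this] obtain y where y: "\<forall>i\<in>{1..k}. y i \<in> X \<and> x i = f (y i)" by (elim exE)
  show thesis
  proof
    have "(\<Sum>i<k. u (Suc i)) = 1" using ux(2) unfolding One_nat_def sum.atLeast1_atMost_eq .
    moreover have "0 \<le> u (Suc i)" if "i < k" for i using ux(1) that by simp
    ultimately show "simplex_weights k (\<lambda>i. u (Suc i))" by (simp add: simplex_weights_def)
    show "y (Suc i) \<in> X" if "i < k" for i using y that by simp
    have "c = (\<Sum>i\<in>{1..k}. u i *\<^sub>R x i)" using ux(3) by simp
    also have "\<dots> = (\<Sum>i\<in>{1..k}. u i *\<^sub>R f (y i))"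
    proof (rule sum.cong)
      fix i assume "i \<in> {1..k}"
      then have "x i = f (y i)" using y by blast
      then show "u i *\<^sub>R x i = u i *\<^sub>R f (y i)" by simp
    qed simp
    also have "\<dots> = (\<Sum>i<k. u (Suc i) *\<^sub>R f (y (Suc i)))" unfolding One_nat_def sum.atLeast1_atMost_eq ..
    finally show "c = (\<Sum>i<k. u (Suc i) *\<^sub>R f (y (Suc i)))" .
  qed
qed

text \<open>A segment from \<open>f x\<close> to a relative interior point \<open>s\<close> can be
  prolonged beyond \<open>s\<close> inside the hull, to the point \<open>(1 - e) f x + e s\<close>
  with \<open>e > 1\<close>. Solving for \<open>s\<close> gives \<open>f x\<close> the positive
  weight \<open>(e - 1) / e\<close>.\<close>

lemma rel_interior_image_simplex:
  fixes f :: "'a \<Rightarrow> 'v::euclidean_space"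
  assumes s: "s \<in> rel_interior (convex hull (f ` X))" and x: "x \<in> X"
  obtains n p y where "simplex_weights n p" "\<And>i. i < n \<Longrightarrow> y i \<in> X" "s = (\<Sum>i<n. p i *\<^sub>R f (y i))"
    "0 < n" "y 0 = x" "0 < p 0"
proof -
  have "f x \<in> convex hull (f ` X)" using x by (simp add: hull_inc)
  then obtain e where e: "e > 1" "(1 - e) *\<^sub>R f x + e *\<^sub>R s \<in> convex hull (f ` X)"
    using s x convex_rel_interior_iff[OF convex_convex_hull, of "f ` X" s] by auto
  obtain n p y where py: "simplex_weights n p" "\<And>i. i < n \<Longrightarrow> y i \<in> X"
    "(1 - e) *\<^sub>R f x + e *\<^sub>R s = (\<Sum>i<n. p i *\<^sub>R f (y i))"
    using convex_hull_image_simplex[OF e(2)] by blast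
  let ?p = "case_nat ((e - 1) / e) (\<lambda>i. p i / e)" and ?y = "case_nat x y"
  show thesis
  proof
    have "(\<Sum>i<n. p i / e) = 1 / e" using py(1) by (simp add: simplex_weights_def flip: sum_divide_distrib)
    then have "(\<Sum>i<Suc n. ?p i) = 1"
      using e(1) by (simp add: sum.lessThan_Suc_shift add_divide_distrib[symmetric] del: sum.lessThan_Suc)
    then show "simplex_weights (Suc n) ?p"
      using py(1) e(1) by (auto simp: simplex_weights_def split: nat.split)
    show "?y i \<in> X" if "i < Suc n" for i using py(2) that x by (auto split: nat.split)
    have "(\<Sum>i<Suc n. ?p i *\<^sub>R f (?y i)) = ((e - 1) / e) *\<^sub>R f x + (1 / e) *\<^sub>R (\<Sum>i<n. p i *\<^sub>R f (y i))"
      by (simp add: sum.lessThan_Suc_shift scaleR_sum_right del: sum.lessThan_Suc)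
    also have "\<dots> = ((e - 1) / e + (1 / e) * (1 - e)) *\<^sub>R f x + s"
      using e(1) by (simp add: py(3)[symmetric] scaleR_add_right scaleR_add_left)
    also have "(e - 1) / e + (1 / e) * (1 - e) = 0" by (simp flip: add_divide_distrib)
    finally show "s = (\<Sum>i<Suc n. ?p i *\<^sub>R f (?y i))" by simp
  qed (use e in auto)
qed

subsection \<open>Conditional means\<close>

locale moment_constraint =
  fixes M :: "'a measure" and \<Phi> :: "'a \<Rightarrow> real ^ 'm" and S :: "(real ^ 'm) set"
  assumes measurable_\<Phi> [measurable]: "\<Phi> \<in> M \<rightarrow>\<^sub>M borel"
    and convex_S: "convex S"
    and singleton_sets: "\<And>x. x \<in> space M \<Longrightarrow> {x} \<in> sets M"
begin

text \<open>
  One observation \<open>Y\<close> with conditional mean \<open>Z\<close> in \<open>S\<close> given \<open>F\<close>. With trivial \<open>F\<close> this describes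
  an element of \<^const>\<open>hyp\<close>, with \<open>F\<close> from the natural filtration one step of an element of
  \<^const>\<open>cond_hyp\<close>.
\<close>

definition cond_sys :: "'w measure \<Rightarrow> 'w measure \<Rightarrow> ('w \<Rightarrow> 'a) \<Rightarrow> ('w \<Rightarrow> real ^ 'm) \<Rightarrow> bool" where
  "cond_sys P F Y Z \<longleftrightarrow> prob_space P \<and> subalgebra P F \<and> Y \<in> P \<rightarrow>\<^sub>M M \<and> integrable P (\<lambda>w. \<Phi> (Y w)) \<and>
     (\<forall>i. AE w in P. Z w $ i = real_cond_exp P F (\<lambda>w. \<Phi> (Y w) $ i) w) \<and> (AE w in P. Z w \<in> S)"

lemma integrable_component:
  fixes f :: "'w \<Rightarrow> real ^ 'm"
  assumes "integrable P f"
  shows "integrable P (\<lambda>w. f w $ i)"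
  by (rule integrable_bounded_linear[OF bounded_linear_vec_nth assms])

lemma cond_sys_subalgebra:
  assumes "cond_sys P F Y Z"
  shows "sigma_finite_subalgebra P F"
proof -
  interpret prob_space P using assms by (simp add: cond_sys_def)
  have "finite_measure_subalgebra P F"
    using assms by unfold_locales (simp add: cond_sys_def)
  then show ?thesis by (rule finite_measure_subalgebra_is_sigma_finite)
qed

lemma cond_sys_inner:
  assumes sys: "cond_sys P F Y Z"
  shows "AE w in P. a \<bullet> Z w = real_cond_exp P F (\<lambda>w. a \<bullet> \<Phi> (Y w)) w"
proof -
  interpret sigma_finite_subalgebra P F by (rule cond_sys_subalgebra) fact
  have int: "integrable P (\<lambda>w. \<Phi> (Y w) $ i)" for i
    using sys integrable_component by (auto simp: cond_sys_def)
  have "AE w in P. \<forall>i\<in>UNIV. Z w $ i = real_cond_exp P F (\<lambda>w. \<Phi> (Y w) $ i) w"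
    using sys by (intro AE_finite_allI) (auto simp: cond_sys_def)
  moreover have "AE w in P. \<forall>i\<in>UNIV. real_cond_exp P F (\<lambda>w. a $ i * \<Phi> (Y w) $ i) w = a $ i * real_cond_exp P F (\<lambda>w. \<Phi> (Y w) $ i) w"
    by (intro AE_finite_allI real_cond_exp_cmult int) simp
  moreover have "AE w in P. real_cond_exp P F (\<lambda>w. \<Sum>i\<in>UNIV. a $ i * \<Phi> (Y w) $ i) w =
      (\<Sum>i\<in>UNIV. real_cond_exp P F (\<lambda>w. a $ i * \<Phi> (Y w) $ i) w)"
    by (rule real_cond_exp_sum) (simp add: int)
  ultimately show ?thesis
    by eventually_elim (simp add: inner_vec_def)
qed

text \<open>In finite dimension an affine hull is cut out by finitely many linear equations.
  Conditional expectation preserves each of them almost surely, and finitely many null sets are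
  discarded.\<close>

lemma cond_sys_affine_hull:
  assumes sys: "cond_sys P F Y Z" and Y: "AE w in P. Y w \<in> X"
  shows "AE w in P. Z w \<in> affine hull (\<Phi> ` X)"
proof -
  interpret sigma_finite_subalgebra P F by (rule cond_sys_subalgebra) fact
  interpret prob_space P using sys by (simp add: cond_sys_def)
  have [measurable]: "Y \<in> P \<rightarrow>\<^sub>M M" using sys by (simp add: cond_sys_def)
  obtain \<F> where \<F>: "finite \<F>" "affine hull (\<Phi> ` X) = \<Inter>\<F>"
    "\<And>h. h \<in> \<F> \<Longrightarrow> \<exists>a b. a \<noteq> 0 \<and> h = {x. a \<bullet> x = b}"
    using affine_hull_finite_intersection_hyperplanes[of "\<Phi> ` X"] by metis
  have "AE w in P. Z w \<in> h" if hF: "h \<in> \<F>" for h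
  proof -
    obtain a b where h: "h = {x. a \<bullet> x = b}" using \<F>(3)[OF hF] by blast
    have "\<Phi> ` X \<subseteq> h" using \<F>(2) hF hull_subset[of "\<Phi> ` X" affine] by blast
    then have b: "a \<bullet> \<Phi> x = b" if "x \<in> X" for x using that by (auto simp: h)
    have "AE w in P. a \<bullet> \<Phi> (Y w) = b" by (rule eventually_mono[OF Y b])
    then have "AE w in P. real_cond_exp P F (\<lambda>w. a \<bullet> \<Phi> (Y w)) w = real_cond_exp P F (\<lambda>w. b) w"
      by (rule real_cond_exp_cong) measurable
    moreover have "AE w in P. real_cond_exp P F (\<lambda>w. b) w = b" by (rule real_cond_exp_F_meas) auto
    ultimately show ?thesis using cond_sys_inner[OF sys, of a]
      by eventually_elim (simp add: h)
  qed
  then have "AE w in P. \<forall>h\<in>\<F>. Z w \<in> h" using \<F>(1) by (intro AE_finite_allI)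
  then show ?thesis unfolding \<F>(2) by eventually_elim auto
qed

text \<open>Taking expectations, the variable \<open>a \<bullet> \<Phi> (Y w) - k\<close> is
  non-negative with integral at most 0, hence vanishes almost surely.\<close>

lemma cond_sys_exposed:
  assumes sys: "cond_sys P F Y Z"
    and ge: "AE w in P. k \<le> a \<bullet> \<Phi> (Y w)" and le: "AE w in P. a \<bullet> Z w \<le> k"
  shows "AE w in P. a \<bullet> \<Phi> (Y w) = k"
proof -
  interpret sigma_finite_subalgebra P F by (rule cond_sys_subalgebra) fact
  interpret prob_space P using sys by (simp add: cond_sys_def)
  have int: "integrable P (\<lambda>w. a \<bullet> \<Phi> (Y w))" using sys by (simp add: cond_sys_def)
  have "(\<integral>w. a \<bullet> \<Phi> (Y w) \<partial>P) = (\<integral>w. real_cond_exp P F (\<lambda>w. a \<bullet> \<Phi> (Y w)) w \<partial>P)"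
    by (rule real_cond_exp_int(2)[symmetric]) fact
  also have "\<dots> \<le> (\<integral>w. k \<partial>P)"
  proof (rule integral_mono_AE)
    show "AE w in P. real_cond_exp P F (\<lambda>w. a \<bullet> \<Phi> (Y w)) w \<le> k"
      using cond_sys_inner[OF sys, of a] le by eventually_elim simp
  qed (auto intro: real_cond_exp_int(1) int)
  finally have "(\<integral>w. a \<bullet> \<Phi> (Y w) - k \<partial>P) \<le> 0" using int by (simp add: prob_space)
  moreover have "0 \<le> (\<integral>w. a \<bullet> \<Phi> (Y w) - k \<partial>P)"
    using ge by (intro integral_nonneg_AE) (auto elim: eventually_mono)
  ultimately have "(\<integral>w. a \<bullet> \<Phi> (Y w) - k \<partial>P) = 0" by simp
  moreover have "AE w in P. 0 \<le> a \<bullet> \<Phi> (Y w) - k" using ge by eventually_elim simp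
  ultimately have "AE w in P. a \<bullet> \<Phi> (Y w) - k = 0"
    using integral_nonneg_eq_0_iff_AE[of P "\<lambda>w. a \<bullet> \<Phi> (Y w) - k"] int by simp
  then show ?thesis by eventually_elim simp
qed

text \<open>
  Facial reduction: as long as \<open>S\<close> misses the relative interior of the convex hull of \<open>\<Phi> ` X\<close>,
  a hyperplane separates them properly, and the observations must lie on it.
\<close>

inductive reach :: "'a set \<Rightarrow> bool" where
  reach_space: "reach (space M)"
| reach_step: "reach X \<Longrightarrow> (\<And>x. x \<in> X \<Longrightarrow> k \<le> a \<bullet> \<Phi> x) \<Longrightarrow>
    (\<And>s. s \<in> S \<inter> affine hull (\<Phi> ` X) \<Longrightarrow> a \<bullet> s \<le> k) \<Longrightarrow> reach {x \<in> X. a \<bullet> \<Phi> x = k}"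

lemma reach_sets: "reach X \<Longrightarrow> X \<in> sets M"
proof (induction rule: reach.induct)
  case (reach_step X k a)
  then have [measurable]: "X \<in> sets M" by simp
  have "{x \<in> space M. x \<in> X \<and> a \<bullet> \<Phi> x = k} \<in> sets M" by measurable
  also have "{x \<in> space M. x \<in> X \<and> a \<bullet> \<Phi> x = k} = {x \<in> X. a \<bullet> \<Phi> x = k}"
    using sets.sets_into_space[of X M] by auto
  finally show ?case .
qed simp

text \<open>Induction over the reductions: if \<open>Y\<close> stays in \<open>X\<close>, then
  \<open>Z\<close> lies in the affine hull of its image, so the hyperplane bounds \<open>Z\<close>
  from above and \<open>\<Phi> Y\<close> from below, and \<open>cond_sys_exposed\<close>
  applies.\<close>

lemma cond_sys_reach:
  assumes sys: "cond_sys P F Y Z" and "reach X"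
  shows "AE w in P. Y w \<in> X"
  using \<open>reach X\<close>
proof (induction rule: reach.induct)
  case reach_space
  show ?case using sys measurable_space[of Y P M] by (auto simp: cond_sys_def)
next
  case (reach_step X k a)
  have "AE w in P. Z w \<in> S \<inter> affine hull (\<Phi> ` X)"
    using cond_sys_affine_hull[OF sys reach_step.IH] sys by (auto simp: cond_sys_def)
  then have "AE w in P. a \<bullet> Z w \<le> k" by eventually_elim (rule reach_step.hyps)
  moreover have "AE w in P. k \<le> a \<bullet> \<Phi> (Y w)"
    using reach_step.IH by eventually_elim (rule reach_step.hyps)
  ultimately have "AE w in P. a \<bullet> \<Phi> (Y w) = k" by (intro cond_sys_exposed[OF sys])
  with reach_step.IH show ?case by eventually_elim simp
qed

text \<open>One reduction step. It makes progress because the separation is proper: the hyperplane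
  cannot contain both sets, so the affine hull of what remains is strictly smaller.\<close>

lemma reach_exposed:
  assumes "reach X" and disj: "S \<inter> rel_interior (convex hull (\<Phi> ` X)) = {}"
    and ne: "S \<inter> affine hull (\<Phi> ` X) \<noteq> {}"
  obtains X' where "reach X'" "aff_dim (\<Phi> ` X') < aff_dim (\<Phi> ` X)"
proof -
  define C where "C = rel_interior (convex hull (\<Phi> ` X))"
  define T where "T = S \<inter> affine hull (\<Phi> ` X)"
  define W where "W = (\<Union>x\<in>C. \<Union>y\<in>T. {x - y})"
  have "X \<noteq> {}" using ne by auto
  then have C_ne: "C \<noteq> {}" unfolding C_def by (simp add: rel_interior_eq_empty)
  have "convex C" unfolding C_def by (intro convex_rel_interior convex_convex_hull)
  have "convex T" unfolding T_def by (intro convex_Int convex_S affine_imp_convex affine_affine_hull)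
  have "convex W" unfolding W_def by (rule convex_differences) fact+
  have "W \<noteq> {}" using C_ne ne unfolding W_def T_def by auto
  have "0 \<notin> W" using disj unfolding W_def C_def T_def by auto
  \<comment> \<open>The normal is taken in the span of the differences \<open>W\<close>. If both
    sets lay in one level set of \<open>a\<close>, then \<open>a\<close> would be orthogonal to
    \<open>W\<close>, hence to itself.\<close>
  from separating_hyperplane_set_0_inspan[OF \<open>convex W\<close> \<open>W \<noteq> {}\<close> \<open>0 \<notin> W\<close>]
  obtain a where a: "a \<in> span W" "a \<noteq> 0" "\<And>x. x \<in> W \<Longrightarrow> 0 \<le> a \<bullet> x" by blast
  have sep: "a \<bullet> t \<le> a \<bullet> c" if "c \<in> C" "t \<in> T" for c t
    using a(3)[of "c - t"] that unfolding W_def by (force simp: inner_diff_right)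
  define k where "k = (SUP t\<in>T. a \<bullet> t)"
  obtain c0 where c0: "c0 \<in> C" using C_ne by auto
  have T_le: "a \<bullet> t \<le> k" if "t \<in> T" for t
    unfolding k_def using that sep[OF c0] by (intro cSUP_upper bdd_aboveI2[of _ _ "a \<bullet> c0"])
  have C_ge: "C \<subseteq> {v. k \<le> a \<bullet> v}"
    unfolding k_def using ne sep by (auto simp: T_def intro!: cSUP_least)
  have "closure C \<subseteq> {v. k \<le> a \<bullet> v}"
    by (rule closure_minimal[OF C_ge closed_halfspace_ge])
  moreover have "\<Phi> ` X \<subseteq> closure C"
    unfolding C_def convex_closure_rel_interior[OF convex_convex_hull]
    using hull_subset[of "\<Phi> ` X" convex] closure_subset by blast
  ultimately have X_ge: "k \<le> a \<bullet> \<Phi> x" if "x \<in> X" for x using that by auto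
  let ?X = "{x \<in> X. a \<bullet> \<Phi> x = k}"
  have "reach ?X" by (rule reach_step) (use assms(1) X_ge T_le T_def in auto)
  moreover have "affine hull (\<Phi> ` ?X) \<noteq> affine hull (\<Phi> ` X)"
  proof
    assume eq: "affine hull (\<Phi> ` ?X) = affine hull (\<Phi> ` X)"
    have "affine hull (\<Phi> ` ?X) \<subseteq> {v. a \<bullet> v = k}"
      by (rule hull_minimal) (auto simp: affine_hyperplane)
    then have H: "affine hull (\<Phi> ` X) \<subseteq> {v. a \<bullet> v = k}" using eq by simp
    have "C \<subseteq> affine hull (\<Phi> ` X)"
      unfolding C_def using rel_interior_subset convex_hull_subset_affine_hull by blast
    then have "a \<bullet> c = k" "a \<bullet> t = k" if "c \<in> C" "t \<in> T" for c t
      using that H unfolding T_def by blast+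
    then have "orthogonal a w" if "w \<in> W" for w
      using that unfolding W_def by (auto simp: orthogonal_def inner_diff_right)
    then have "orthogonal a a" using a(1) by (rule orthogonal_to_span[rotated])
    then show False using a(2) by (simp add: orthogonal_self)
  qed
  then have "affine hull (\<Phi> ` ?X) \<subset> affine hull (\<Phi> ` X)"
    using hull_mono[of "\<Phi> ` ?X" "\<Phi> ` X" affine] by auto
  then have "aff_dim (\<Phi> ` ?X) < aff_dim (\<Phi> ` X)" by (rule aff_dim_psubset)
  ultimately show thesis by (rule that)
qed

text \<open>A reachable set of least affine dimension admits no further reduction by
  \<open>reach_exposed\<close>. The dimension is shifted by 1 because it is -1 for the empty
  set.\<close>

lemma reach_terminal:
  "\<exists>X. reach X \<and> (S \<inter> affine hull (\<Phi> ` X) = {} \<or> S \<inter> rel_interior (convex hull (\<Phi> ` X)) \<noteq> {})"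
proof (rule ccontr)
  assume no: "\<not> ?thesis"
  obtain X where X: "reach X" "\<And>X'. reach X' \<Longrightarrow> nat (aff_dim (\<Phi> ` X) + 1) \<le> nat (aff_dim (\<Phi> ` X') + 1)"
    using ex_has_least_nat[of reach, OF reach_space, of "\<lambda>X. nat (aff_dim (\<Phi> ` X) + 1)"] by auto
  have "S \<inter> rel_interior (convex hull (\<Phi> ` X)) = {}" "S \<inter> affine hull (\<Phi> ` X) \<noteq> {}"
    using no X(1) by auto
  from reach_exposed[OF X(1) this] obtain X' where "reach X'" "aff_dim (\<Phi> ` X') < aff_dim (\<Phi> ` X)" .
  then show False using X(2)[of X'] aff_dim_geq[of "\<Phi> ` X'"] by arith
qed

subsection \<open>The effective domain\<close>

abbreviation D :: "'a set" where "D \<equiv> eff_domain M \<Phi> S"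

definition means :: "(real ^ 'm) set" where
  "means = S \<inter> affine hull (\<Phi> ` D)"

lemma measurable_l1_norm [measurable]: "l1_norm \<in> borel \<rightarrow>\<^sub>M borel"
  unfolding l1_norm_def[abs_def]
  by (intro borel_measurable_continuous_onI continuous_intros)

lemma norm_le_l1_norm: "norm v \<le> l1_norm v"
  unfolding l1_norm_def by (rule norm_le_l1_cart)

lemma integrable_l1:
  fixes f :: "'w \<Rightarrow> real ^ 'm"
  assumes "f \<in> borel_measurable P" "(\<integral>\<^sup>+w. ennreal (l1_norm (f w)) \<partial>P) < \<infinity>"
  shows "integrable P f"
proof (rule integrableI_bounded)
  have "(\<integral>\<^sup>+w. ennreal (norm (f w)) \<partial>P) \<le> (\<integral>\<^sup>+w. ennreal (l1_norm (f w)) \<partial>P)"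
    by (intro nn_integral_mono ennreal_leI norm_le_l1_norm)
  then show "(\<integral>\<^sup>+w. ennreal (norm (f w)) \<partial>P) < \<infinity>" using assms(2) by simp
qed fact

lemma cond_exp_trivial:
  fixes f :: "'w \<Rightarrow> real"
  assumes "prob_space P" "subalgebra P F" "sets F \<subseteq> {{}, space P}" "integrable P f"
  shows "AE w in P. real_cond_exp P F f w = (\<integral>w. f w \<partial>P)"
proof -
  interpret prob_space P by fact
  interpret finite_measure_subalgebra P F by unfold_locales fact
  show ?thesis
  proof (rule real_cond_exp_charact)
    fix A assume "A \<in> sets F"
    then have "A = {} \<or> A = space P" using assms(3) by auto
    then show "(\<integral>w\<in>A. f w \<partial>P) = (\<integral>w\<in>A. (\<integral>w. f w \<partial>P) \<partial>P)"
      using assms(4) by (auto simp: set_integral_space prob_space set_lebesgue_integral_def[of _ "{}"])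
  qed (use assms in auto)
qed

lemma cond_sys_hyp:
  assumes P: "P \<in> hyp M \<Phi> S"
  shows "cond_sys P (sigma (space P) {}) (\<lambda>x. x) (\<lambda>_. \<integral>x. \<Phi> x \<partial>P)"
proof -
  have prob: "prob_space P" and sets[measurable_cong]: "sets P = sets M"
    using P by (auto simp: hyp_def space_prob_algebra)
  have meas: "\<Phi> \<in> borel_measurable P" by measurable
  then have int: "integrable P \<Phi>" using P by (intro integrable_l1) (auto simp: hyp_def)
  have sub: "subalgebra P (sigma (space P) {})"
    by (auto simp: subalgebra_def sigma_sets_empty_eq)
  have "AE x in P. (\<integral>x. \<Phi> x \<partial>P) $ i = real_cond_exp P (sigma (space P) {}) (\<lambda>x. \<Phi> x $ i) x" for i
  proof -
    have "(\<integral>x. \<Phi> x \<partial>P) $ i = (\<integral>x. \<Phi> x $ i \<partial>P)"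
      by (rule integral_bounded_linear[OF bounded_linear_vec_nth int, symmetric])
    moreover have "AE x in P. real_cond_exp P (sigma (space P) {}) (\<lambda>x. \<Phi> x $ i) x = (\<integral>x. \<Phi> x $ i \<partial>P)"
      by (rule cond_exp_trivial[OF prob sub _ integrable_component[OF int]]) (auto simp: sigma_sets_empty_eq)
    ultimately show ?thesis by auto
  qed
  then show ?thesis
    using prob sub int P measurable_ident_sets[OF sets] unfolding cond_sys_def by (auto simp: hyp_def)
qed

lemma fin_dist_hyp:
  assumes "simplex_weights n p" "\<And>i. i < n \<Longrightarrow> y i \<in> space M" "(\<Sum>i<n. p i *\<^sub>R \<Phi> (y i)) \<in> S"
  shows "fin_dist M n p y \<in> hyp M \<Phi> S"
proof -
  have "(\<integral>\<^sup>+x. ennreal (l1_norm (\<Phi> x)) \<partial>fin_dist M n p y) = (\<Sum>i<n. ennreal (p i) * ennreal (l1_norm (\<Phi> (y i))))"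
    by (rule nn_integral_fin_dist[OF assms(1,2)]) auto
  also have "\<dots> < \<infinity>" by (auto simp: ennreal_mult_less_top)
  finally show ?thesis
    using assms prob_space_fin_dist[OF assms(1,2)]
    by (simp add: hyp_def space_prob_algebra integral_fin_dist[OF assms(1,2)])
qed

text \<open>No single-step law has an atom outside \<open>X\<close>, as it is carried by
  \<open>X\<close>. Conversely, a relative interior point \<open>s\<close> of the hull is the mean
  of a finite distribution on \<open>X\<close> that charges any prescribed \<open>x\<close>.\<close>

lemma eff_domain_terminal:
  assumes X: "reach X" and s: "s \<in> S" "s \<in> rel_interior (convex hull (\<Phi> ` X))"
  shows "D = X"
proof (intro set_eqI iffI)
  fix x assume "x \<in> D"
  then obtain P where P: "P \<in> hyp M \<Phi> S" "emeasure P {x} > 0" and x: "x \<in> space M"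
    by (auto simp: eff_domain_def)
  have "AE y in P. y \<in> X" by (rule cond_sys_reach[OF cond_sys_hyp[OF P(1)] X])
  moreover have sets: "sets P = sets M" using P(1) by (auto simp: hyp_def space_prob_algebra)
  then have sp: "space P = space M" by (rule sets_eq_imp_space_eq)
  have "{y \<in> space P. y \<notin> X} = space M - X" using sp by auto
  then have N: "{y \<in> space P. y \<notin> X} \<in> sets P" using reach_sets[OF X] sets by auto
  ultimately have "emeasure P {y \<in> space P. y \<notin> X} = 0"
    using AE_iff_measurable[OF N refl] by simp
  moreover have "emeasure P {x} \<le> emeasure P {y \<in> space P. y \<notin> X}" if "x \<notin> X"
    by (rule emeasure_mono[OF _ N]) (use that x sp in auto)
  ultimately show "x \<in> X" using P(2) by fastforce
next
  fix x assume x: "x \<in> X"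
  have XM: "X \<subseteq> space M" using reach_sets[OF X] by (rule sets.sets_into_space)
  obtain n p y where py: "simplex_weights n p" "\<And>i. i < n \<Longrightarrow> y i \<in> X" "s = (\<Sum>i<n. p i *\<^sub>R \<Phi> (y i))"
    "0 < n" "y 0 = x" "0 < p 0"
    using rel_interior_image_simplex[OF s(2) x] by blast
  have y: "\<And>i. i < n \<Longrightarrow> y i \<in> space M" using py(2) XM by blast
  have "fin_dist M n p y \<in> hyp M \<Phi> S"
    by (rule fin_dist_hyp[OF py(1) y]) (use py(3) s(1) in auto)
  moreover have "emeasure (fin_dist M n p y) {x} > 0"
    by (rule emeasure_fin_dist_singleton[OF py(1) y]) (use py x XM singleton_sets in auto)
  ultimately show "x \<in> D" using x XM by (auto simp: eff_domain_def)
qed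

text \<open>The existence of one system rules out the first alternative of
  \<open>reach_terminal\<close>, since its conditional mean lies almost surely in \<open>S\<close>
  and in the affine hull. The terminal set is then the effective domain.\<close>

lemma reach_D:
  assumes "cond_sys P F Y Z"
  shows "reach D" "\<exists>s. s \<in> S \<and> s \<in> rel_interior (convex hull (\<Phi> ` D))"
proof -
  obtain X where X: "reach X" "S \<inter> affine hull (\<Phi> ` X) = {} \<or> S \<inter> rel_interior (convex hull (\<Phi> ` X)) \<noteq> {}"
    using reach_terminal by (elim exE conjE)
  interpret prob_space P using assms by (simp add: cond_sys_def)
  have ae: "AE w in P. Z w \<in> S \<inter> affine hull (\<Phi> ` X)"
    using cond_sys_affine_hull[OF assms cond_sys_reach[OF assms X(1)]] assms by (auto simp: cond_sys_def)
  have "S \<inter> affine hull (\<Phi> ` X) \<noteq> {}"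
  proof
    assume "S \<inter> affine hull (\<Phi> ` X) = {}"
    then have "AE w in P. False" using ae by simp
    then show False by simp
  qed
  then obtain s where s: "s \<in> S" "s \<in> rel_interior (convex hull (\<Phi> ` X))" using X(2) by auto
  have "D = X" by (rule eff_domain_terminal[OF X(1) s])
  then show "reach D" "\<exists>s. s \<in> S \<and> s \<in> rel_interior (convex hull (\<Phi> ` D))" using X(1) s by auto
qed

lemma cond_sys_D:
  assumes "cond_sys P F Y Z"
  shows "AE w in P. Y w \<in> D" "AE w in P. Z w \<in> means"
proof -
  show *: "AE w in P. Y w \<in> D" by (rule cond_sys_reach[OF assms reach_D(1)[OF assms]])
  show "AE w in P. Z w \<in> means"
    using cond_sys_affine_hull[OF assms *] assms by (auto simp: cond_sys_def means_def)
qed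

lemma D_nonempty:
  assumes "D \<noteq> {}"
  shows "D \<in> sets M" "\<exists>s. s \<in> S \<and> s \<in> rel_interior (convex hull (\<Phi> ` D))"
proof -
  obtain P where "P \<in> hyp M \<Phi> S" using assms by (auto simp: eff_domain_def)
  from cond_sys_hyp[OF this] show "D \<in> sets M" "\<exists>s. s \<in> S \<and> s \<in> rel_interior (convex hull (\<Phi> ` D))"
    using reach_D reach_sets by blast+
qed

end

subsection \<open>Duality for one observation\<close>

context moment_constraint
begin

lemma convex_means: "convex means"
  unfolding means_def by (intro convex_Int convex_S affine_imp_convex affine_affine_hull)

text \<open>From a point \<open>s\<close> of \<open>S\<close> in the relative interior of the hull,
  a short move towards a relative interior point \<open>s1\<close> of \<open>means\<close> enters
  the latter's relative interior without leaving the former.\<close>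

lemma common_rel_interior:
  assumes "D \<noteq> {}"
  obtains s where "s \<in> rel_interior means" "s \<in> rel_interior (convex hull (\<Phi> ` D))"
proof -
  let ?C = "convex hull (\<Phi> ` D)" and ?A = "affine hull (\<Phi> ` D)"
  obtain s where s: "s \<in> S" "s \<in> rel_interior ?C" using D_nonempty(2)[OF assms] by blast
  have sA: "s \<in> ?A" using s(2) rel_interior_subset convex_hull_subset_affine_hull by blast
  have sm: "s \<in> means" using s(1) sA by (simp add: means_def)
  then have "rel_interior means \<noteq> {}" using rel_interior_eq_empty[OF convex_means] by auto
  then obtain s1 where s1: "s1 \<in> rel_interior means" by auto
  have s1A: "s1 \<in> ?A" using s1 rel_interior_subset unfolding means_def by blast
  have "openin (top_of_set ?A) (rel_interior ?C)"
    using openin_rel_interior[of ?C] by (simp add: affine_hull_convex_hull)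
  then obtain r where r: "r > 0" "ball s r \<inter> ?A \<subseteq> rel_interior ?C"
    using s(2) unfolding openin_contains_ball by blast
  \<comment> \<open>Small enough that the displacement is shorter than \<open>r\<close>; the summand
    1 protects against \<open>s = s1\<close>.\<close>
  define e where "e = min 1 (r / (2 * (norm (s - s1) + 1)))"
  have e: "0 < e" "e \<le> 1" using r(1) by (auto simp: e_def add_nonneg_pos)
  have "e * norm (s - s1) \<le> r / (2 * (norm (s - s1) + 1)) * norm (s - s1)"
    by (intro mult_right_mono) (auto simp: e_def)
  also have "\<dots> < r"
    using r(1) norm_ge_zero[of "s - s1"] by (simp add: divide_simps add_nonneg_pos)
  finally have small: "e * norm (s - s1) < r" .
  let ?s = "s - e *\<^sub>R (s - s1)"
  have "?s \<in> rel_interior means"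
    by (rule rel_interior_convex_shrink[OF convex_means s1 sm e])
  moreover have "?s \<in> ball s r" using small e by (simp add: dist_norm)
  moreover have "?s = (1 - e) *\<^sub>R s + e *\<^sub>R s1" by (simp add: algebra_simps)
  then have "?s \<in> ?A" using mem_affine[OF affine_affine_hull sA s1A, of "1 - e" e] by simp
  ultimately show thesis using r(2) by (intro that[of ?s]) auto
qed

definition center :: "real ^ 'm" where
  "center = (SOME s. s \<in> rel_interior means \<and> s \<in> rel_interior (convex hull (\<Phi> ` D)))"

lemma center:
  assumes "D \<noteq> {}"
  shows "center \<in> rel_interior means" "center \<in> rel_interior (convex hull (\<Phi> ` D))"
proof -
  have "\<exists>s. s \<in> rel_interior means \<and> s \<in> rel_interior (convex hull (\<Phi> ` D))"
    using common_rel_interior[OF assms] by metis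
  from someI_ex[OF this] show "center \<in> rel_interior means" "center \<in> rel_interior (convex hull (\<Phi> ` D))"
    unfolding center_def by auto
qed

lemma center_affine: "D \<noteq> {} \<Longrightarrow> center \<in> affine hull (\<Phi> ` D)"
  using center(2) rel_interior_subset convex_hull_subset_affine_hull by blast

definition finite_strategies :: "(nat \<times> (nat \<Rightarrow> real) \<times> (nat \<Rightarrow> 'a)) set" where
  "finite_strategies = {(n, p, y). simplex_weights n p \<and> (\<forall>i<n. y i \<in> D) \<and>
     (\<Sum>i<n. p i *\<^sub>R \<Phi> (y i)) \<in> rel_interior means}"

lemma finite_strategy_through:
  assumes "x \<in> D"
  obtains n p y where "(n, p, y) \<in> finite_strategies" "0 < n" "y 0 = x" "0 < p 0"
proof -
  have D: "D \<noteq> {}" using assms by auto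
  obtain n p y where py: "simplex_weights n p" "\<And>i. i < n \<Longrightarrow> y i \<in> D" "center = (\<Sum>i<n. p i *\<^sub>R \<Phi> (y i))"
    "0 < n" "y 0 = x" "0 < p 0"
    using rel_interior_image_simplex[OF center(2)[OF D] assms] by blast
  show thesis
    by (rule that[of n p y]) (use py center(1)[OF D] in \<open>auto simp: finite_strategies_def\<close>)
qed

definition directions :: "(real ^ 'm) set" where
  "directions = {v. center + v \<in> affine hull (\<Phi> ` D)}"

lemma subspace_directions:
  assumes "D \<noteq> {}"
  shows "subspace directions"
proof -
  have "subspace ((\<lambda>x. - center + x) ` (affine hull (\<Phi> ` D)))"
    by (rule affine_diffs_subspace[OF affine_affine_hull center_affine[OF assms]])
  moreover have "(\<lambda>x. - center + x) ` (affine hull (\<Phi> ` D)) = directions"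
  proof (intro set_eqI iffI)
    fix v assume "v \<in> directions"
    then show "v \<in> (\<lambda>x. - center + x) ` (affine hull (\<Phi> ` D))"
      unfolding directions_def by (intro image_eqI[of _ _ "center + v"]) auto
  qed (auto simp: directions_def)
  ultimately show ?thesis by simp
qed

text \<open>
  Only directions parallel to the affine hull of \<open>\<Phi> ` D\<close> are allowed: orthogonal components do not
  change the payoff, and without them the set of bets is compact.
\<close>

definition bets :: "(real ^ 'm) set" where
  "bets = {l \<in> directions. \<forall>x\<in>D. \<forall>s\<in>means. 0 \<le> 1 + l \<bullet> (\<Phi> x - s)}"

lemma rel_interior_ball:
  assumes "D \<noteq> {}"
  obtains e where "e > 0" "ball center e \<inter> affine hull (\<Phi> ` D) \<subseteq> convex hull (\<Phi> ` D)"
  using center(2)[OF assms] unfolding mem_rel_interior_ball affine_hull_convex_hull by blast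

lemma compact_bets:
  assumes D: "D \<noteq> {}"
  shows "compact bets"
  unfolding compact_eq_bounded_closed
proof
  obtain e where e: "e > 0" "ball center e \<inter> affine hull (\<Phi> ` D) \<subseteq> convex hull (\<Phi> ` D)"
    using rel_interior_ball[OF D] .
  have cm: "center \<in> means" using center(1)[OF D] rel_interior_subset by blast
  have "norm l \<le> 2 / e" if l: "l \<in> bets" for l
  proof (cases "l = 0")
    case False
    let ?c = "center + (- (e / 2 / norm l)) *\<^sub>R l"
    have "(- (e / 2 / norm l)) *\<^sub>R l \<in> directions"
      using l subspace_scale[OF subspace_directions[OF D]] unfolding bets_def by blast
    then have "?c \<in> affine hull (\<Phi> ` D)" by (simp add: directions_def)
    moreover have "?c \<in> ball center e" using e(1) False by (simp add: dist_norm)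
    ultimately have c: "?c \<in> convex hull (\<Phi> ` D)" using e(2) by blast
    have "convex hull (\<Phi> ` D) \<subseteq> {v. l \<bullet> center - 1 \<le> l \<bullet> v}"
    proof (rule hull_minimal)
      show "\<Phi> ` D \<subseteq> {v. l \<bullet> center - 1 \<le> l \<bullet> v}"
        using l cm unfolding bets_def by (force simp: inner_diff_right)
    qed (rule convex_halfspace_ge)
    with c have "l \<bullet> center - 1 \<le> l \<bullet> ?c" by blast
    then have "e / 2 / norm l * (l \<bullet> l) \<le> 1" by (simp add: inner_add_right inner_diff_right)
    then have "e / 2 * norm l \<le> 1" using False by (simp add: power2_norm_eq_inner[symmetric] power2_eq_square)
    then show ?thesis using e(1) by (simp add: field_simps)
  qed (use e(1) in simp)
  then show "bounded bets" unfolding bounded_iff by blast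
  have "closed directions" by (rule closed_subspace[OF subspace_directions[OF D]])
  moreover have "closed {l. 0 \<le> 1 + l \<bullet> (\<Phi> x - s)}" for x s
  proof -
    have "{l. 0 \<le> 1 + l \<bullet> (\<Phi> x - s)} = {l. - 1 \<le> (\<Phi> x - s) \<bullet> l}" by (auto simp: inner_commute)
    then show ?thesis using closed_halfspace_ge by metis
  qed
  moreover have "bets = directions \<inter> (\<Inter>x\<in>D. \<Inter>s\<in>means. {l. 0 \<le> 1 + l \<bullet> (\<Phi> x - s)})"
    unfolding bets_def by auto
  ultimately show "closed bets" by (simp only:) (intro closed_Int closed_INT ballI)
qed

text \<open>Convex separation in the product with the real line: \<open>Q\<close> is the hull of the
  graph of the payoff over the statistic, \<open>R\<close> consists of admissible means with a
  payoff above 1. A common point would be a finite strategy violating the hypothesis. A separating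
  normal \<open>(a, b)\<close> has \<open>b > 0\<close>, and dividing by \<open>b\<close> yields the
  bet.\<close>

theorem one_step_duality:
  assumes D: "D \<noteq> {}"
    and le: "\<And>n p y. (n, p, y) \<in> finite_strategies \<Longrightarrow> (\<Sum>i<n. ennreal (p i) * f (y i)) \<le> 1"
  shows "\<exists>l\<in>bets. \<forall>x\<in>D. \<forall>s\<in>means. f x \<le> ennreal (1 + l \<bullet> (\<Phi> x - s))"
proof -
  \<comment> \<open>Every point of \<open>D\<close> carries positive weight in some strategy, so an
    infinite payoff would violate the bound.\<close>
  have fin: "f x < \<top>" if x: "x \<in> D" for x
  proof -
    obtain n p y where py: "(n, p, y) \<in> finite_strategies" "0 < n" "y 0 = x" "0 < p 0"
      using finite_strategy_through[OF x] .
    have "ennreal (p 0) * f (y 0) \<le> (\<Sum>i<n. ennreal (p i) * f (y i))"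
      using py(2) by (intro member_le_sum) auto
    also have "\<dots> \<le> 1" by (rule le) fact
    finally have "ennreal (p 0) * f x < \<top>" using py(3) by (metis ennreal_one_less_top le_less_trans)
    then show ?thesis using py(4) by (auto simp: ennreal_mult_less_top)
  qed
  define g where "g x = enn2real (f x)" for x
  have fg: "f x = ennreal (g x)" if "x \<in> D" for x using fin[OF that] by (simp add: g_def)
  have g0: "0 \<le> g x" for x by (simp add: g_def)
  define Q where "Q = convex hull ((\<lambda>x. (\<Phi> x, g x)) ` D)"
  define R where "R = rel_interior means \<times> {1 :: real <..}"
  define W where "W = (\<Union>r\<in>R. \<Union>q\<in>Q. {r - q})"
  have "convex Q" unfolding Q_def by (rule convex_convex_hull)
  have "convex R" unfolding R_def
    by (intro convex_Times convex_rel_interior convex_means convex_real_interval)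
  have "convex W" unfolding W_def by (rule convex_differences) fact+
  have "W \<noteq> {}"
  proof -
    obtain x where "x \<in> D" using D by auto
    then have "(\<Phi> x, g x) \<in> Q" unfolding Q_def by (auto intro: hull_inc)
    moreover have "(center, 2) \<in> R" using center(1)[OF D] by (simp add: R_def)
    ultimately show ?thesis unfolding W_def by blast
  qed
  have "0 \<notin> W"
  proof
    assume "0 \<in> W"
    then obtain s r where sr: "(s, r) \<in> Q" "(s, r) \<in> R" unfolding W_def by auto
    obtain n p y where py: "simplex_weights n p" "\<And>i. i < n \<Longrightarrow> y i \<in> D"
      "(s, r) = (\<Sum>i<n. p i *\<^sub>R (\<Phi> (y i), g (y i)))"
      using convex_hull_image_simplex[OF sr(1)[unfolded Q_def]] by blast
    have "fst (s, r) = (\<Sum>i<n. p i *\<^sub>R \<Phi> (y i))" "snd (s, r) = (\<Sum>i<n. p i *\<^sub>R g (y i))"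
      unfolding py(3) by (simp_all add: fst_sum snd_sum)
    then have s: "s = (\<Sum>i<n. p i *\<^sub>R \<Phi> (y i))" and r: "r = (\<Sum>i<n. p i * g (y i))" by simp_all
    have "(n, p, y) \<in> finite_strategies"
      using py sr(2) s by (auto simp: finite_strategies_def R_def)
    then have "(\<Sum>i<n. ennreal (p i) * f (y i)) \<le> 1" by (rule le)
    also have "(\<Sum>i<n. ennreal (p i) * f (y i)) = (\<Sum>i<n. ennreal (p i * g (y i)))"
      using py(1,2) by (intro sum.cong) (auto simp: fg ennreal_mult g0 simplex_weights_def)
    also have "\<dots> = ennreal r"
      unfolding r using py(1) by (intro sum_ennreal) (auto simp: g0 simplex_weights_def)
    finally have "r \<le> 1" by simp
    then show False using sr(2) by (simp add: R_def)
  qed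
  \<comment> \<open>Taking the normal in the span of \<open>W\<close> makes \<open>a\<close>
    parallel to the affine hull. This is used both for membership of the bet in
    \<open>directions\<close> and to exclude \<open>b = 0\<close>.\<close>
  from separating_hyperplane_set_0_inspan[OF \<open>convex W\<close> \<open>W \<noteq> {}\<close> this]
  obtain z where z: "z \<in> span W" "z \<noteq> 0" "\<And>w. w \<in> W \<Longrightarrow> 0 \<le> z \<bullet> w" by blast
  obtain a b where ab: "z = (a, b)" by (cases z)
  have ge: "0 \<le> a \<bullet> (s - \<phi>) + b * (r - \<rho>)"
    if "s \<in> rel_interior means" "r > 1" "(\<phi>, \<rho>) \<in> Q" for s r \<phi> \<rho>
  proof -
    have "(s, r) - (\<phi>, \<rho>) \<in> W" using that unfolding W_def R_def by blast
    from z(3)[OF this] show ?thesis by (simp add: ab)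
  qed
  have Q_hull: "\<phi> \<in> convex hull (\<Phi> ` D)" if "(\<phi>, \<rho>) \<in> Q" for \<phi> \<rho>
  proof -
    have "Q \<subseteq> (convex hull (\<Phi> ` D)) \<times> UNIV"
      unfolding Q_def by (rule hull_minimal) (auto intro: hull_inc convex_Times)
    then have "(\<phi>, \<rho>) \<in> (convex hull (\<Phi> ` D)) \<times> UNIV" using that by (rule subsetD)
    then show ?thesis by simp
  qed
  have hull_Q: "\<exists>\<rho>. (\<phi>, \<rho>) \<in> Q" if "\<phi> \<in> convex hull (\<Phi> ` D)" for \<phi>
  proof -
    have "\<Phi> ` D = fst ` (\<lambda>x. (\<Phi> x, g x)) ` D" by (simp add: image_image)
    then have "convex hull (\<Phi> ` D) = fst ` Q"
      unfolding Q_def by (simp add: convex_hull_linear_image[OF linear_fst])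
    then show ?thesis using that by force
  qed
  have a_dir: "a \<in> directions"
  proof -
    have "W \<subseteq> directions \<times> UNIV"
    proof
      fix w assume "w \<in> W"
      then obtain s r \<phi> \<rho> where w: "w = (s - \<phi>, r - \<rho>)" and s: "s \<in> rel_interior means" and q: "(\<phi>, \<rho>) \<in> Q"
        unfolding W_def R_def by auto
      have "s \<in> affine hull (\<Phi> ` D)" using s rel_interior_subset unfolding means_def by blast
      moreover have "\<phi> \<in> affine hull (\<Phi> ` D)" using Q_hull[OF q] convex_hull_subset_affine_hull by blast
      ultimately have "1 *\<^sub>R center + 1 *\<^sub>R s + (- 1) *\<^sub>R \<phi> \<in> affine hull (\<Phi> ` D)"
        by (intro mem_affine_3 affine_affine_hull center_affine D) auto
      then show "w \<in> directions \<times> UNIV" by (simp add: w directions_def algebra_simps)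
    qed
    then have "span W \<subseteq> directions \<times> UNIV"
      by (rule span_minimal) (intro subspace_Times subspace_directions D subspace_UNIV)
    then show ?thesis using z(1) ab by auto
  qed
  obtain x0 where x0: "x0 \<in> D" using D by auto
  have inQ: "(\<Phi> x, g x) \<in> Q" if "x \<in> D" for x using that unfolding Q_def by (auto intro: hull_inc)
  have "0 \<le> b"
  proof (rule ccontr)
    assume b: "\<not> 0 \<le> b"
    define c where "c = a \<bullet> (center - \<Phi> x0) - b * g x0"
    have "0 \<le> c + b * r" if "r > 1" for r
      using ge[OF center(1)[OF D] that inQ[OF x0]] by (simp add: c_def algebra_simps)
    \<comment> \<open>If \<open>b\<close> is negative, then \<open>r = c / - b + 1\<close> gives
      \<open>c + b * r = b\<close>; the maximum with 2 secures \<open>r > 1\<close>.\<close>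
    from this[of "max 2 (c / - b + 1)"] have "0 \<le> c + b * max 2 (c / - b + 1)" by simp
    also have "\<dots> \<le> c + b * (c / - b + 1)" using b by (intro add_left_mono mult_left_mono_neg) auto
    also have "\<dots> = b" using b by (simp add: field_simps)
    finally show False using b by simp
  qed
  \<comment> \<open>A vertical hyperplane is excluded because the hull contains a ball of the affine
    hull around \<open>center\<close>: moving from there in direction \<open>a\<close> contradicts
    the separation.\<close>
  moreover have "b \<noteq> 0"
  proof
    assume b: "b = 0"
    then have "a \<noteq> 0" using z(2) ab by (auto simp: zero_prod_def)
    obtain e where e: "e > 0" "ball center e \<inter> affine hull (\<Phi> ` D) \<subseteq> convex hull (\<Phi> ` D)"
      using rel_interior_ball[OF D] .
    let ?c = "center + (e / 2 / norm a) *\<^sub>R a"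
    have "(e / 2 / norm a) *\<^sub>R a \<in> directions"
      by (rule subspace_scale[OF subspace_directions[OF D] a_dir])
    then have "?c \<in> affine hull (\<Phi> ` D)" by (simp add: directions_def)
    moreover have "?c \<in> ball center e" using e(1) \<open>a \<noteq> 0\<close> by (simp add: dist_norm)
    ultimately have "?c \<in> convex hull (\<Phi> ` D)" using e(2) by blast
    then obtain \<rho> where "(?c, \<rho>) \<in> Q" using hull_Q by blast
    from ge[OF center(1)[OF D] _ this, of 2] b have "e / 2 / norm a * (a \<bullet> a) \<le> 0" by simp
    moreover have "0 < e / 2 / norm a * (a \<bullet> a)" using e(1) \<open>a \<noteq> 0\<close> by simp
    ultimately show False by simp
  qed
  ultimately have b: "0 < b" by simp
  define l where "l = (- 1 / b) *\<^sub>R a"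
  have ri: "g x \<le> 1 + l \<bullet> (\<Phi> x - s)" if x: "x \<in> D" and s: "s \<in> rel_interior means" for x s
  proof (rule field_le_epsilon)
    fix e :: real assume "e > 0"
    have "0 \<le> a \<bullet> (s - \<Phi> x) + b * ((1 + e) - g x)"
      by (rule ge[OF s _ inQ[OF x]]) (use \<open>e > 0\<close> in simp)
    then have "0 \<le> (a \<bullet> (s - \<Phi> x) + b * ((1 + e) - g x)) / b" using b by simp
    also have "\<dots> = 1 + l \<bullet> (\<Phi> x - s) + e - g x"
      using b by (simp add: l_def inner_diff_right field_simps)
    finally show "g x \<le> 1 + l \<bullet> (\<Phi> x - s) + e" by simp
  qed
  \<comment> \<open>The inequality is closed and affine in \<open>s\<close>, so it extends from the
    relative interior to all of \<open>means\<close>.\<close>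
  have all: "g x \<le> 1 + l \<bullet> (\<Phi> x - s)" if x: "x \<in> D" and s: "s \<in> means" for x s
  proof -
    have "closure (rel_interior means) \<subseteq> {v. l \<bullet> v \<le> 1 + l \<bullet> \<Phi> x - g x}"
      using ri[OF x] by (intro closure_minimal closed_halfspace_le) (auto simp: inner_diff_right algebra_simps)
    moreover have "s \<in> closure (rel_interior means)"
      using s closure_subset by (auto simp: convex_closure_rel_interior[OF convex_means])
    ultimately show ?thesis by (auto simp: inner_diff_right)
  qed
  have "l \<in> directions" unfolding l_def by (rule subspace_scale[OF subspace_directions[OF D] a_dir])
  then have "l \<in> bets" unfolding bets_def using all g0 order_trans by blast
  then show ?thesis using all fg by (intro bexI[of _ l]) (auto intro: ennreal_leI)
qed

subsection \<open>The bets of the effective domain\<close>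

lemma means_nonempty: "D \<noteq> {} \<Longrightarrow> means \<noteq> {}"
  using center(1) rel_interior_subset by blast

lemma Lambda_iff: "l \<in> Lambda M \<Phi> S \<longleftrightarrow> (\<forall>x\<in>D. \<forall>s\<in>means. 0 \<le> 1 + l \<bullet> (\<Phi> x - s))"
proof -
  have "l \<bullet> s \<le> 1 + l \<bullet> \<Phi> x \<longleftrightarrow> 0 \<le> 1 + l \<bullet> (\<Phi> x - s)" for x s
    by (auto simp: inner_diff_right)
  then show ?thesis
    unfolding Lambda_def support_fun_def means_def mem_Collect_eq SUP_le_iff by simp
qed

lemma bets_subset_Lambda: "bets \<subseteq> Lambda M \<Phi> S"
  by (auto simp: bets_def Lambda_iff)

lemma support_fun_real:
  assumes "l \<in> Lambda M \<Phi> S" "D \<noteq> {}"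
  obtains r where "support_fun M \<Phi> S l = ereal r"
proof -
  obtain x where x: "x \<in> D" using assms(2) by auto
  obtain s where s: "s \<in> means" using means_nonempty[OF assms(2)] by auto
  have "ereal (l \<bullet> s) \<le> support_fun M \<Phi> S l"
    unfolding support_fun_def using s by (intro SUP_upper) (simp add: means_def)
  moreover have "support_fun M \<Phi> S l \<le> ereal (1 + l \<bullet> \<Phi> x)" using assms(1) x by (simp add: Lambda_def)
  ultimately show thesis by (cases "support_fun M \<Phi> S l") (auto intro: that)
qed

text \<open>\<open>e_var\<close> is the infimum of the affine payoffs over \<open>s\<close> in
  \<open>means\<close>; this lemma and \<open>e_var_ge\<close> are the two halves of that
  fact.\<close>

lemma e_var_le:
  assumes l: "l \<in> Lambda M \<Phi> S" and x: "x \<in> D" and s: "s \<in> means"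
  shows "e_var M \<Phi> S l x \<le> ennreal (1 + l \<bullet> (\<Phi> x - s))"
proof -
  obtain r where r: "support_fun M \<Phi> S l = ereal r" using support_fun_real[OF l] x by blast
  have "ereal (l \<bullet> s) \<le> ereal r"
    unfolding r[symmetric] support_fun_def using s by (intro SUP_upper) (simp add: means_def)
  then show ?thesis using x by (simp add: e_var_def r e2ennreal_ereal inner_diff_right ennreal_leI)
qed

lemma e_var_ge:
  assumes l: "l \<in> Lambda M \<Phi> S" and x: "x \<in> D"
    and v: "\<And>s. s \<in> means \<Longrightarrow> v \<le> ennreal (1 + l \<bullet> (\<Phi> x - s))"
  shows "v \<le> e_var M \<Phi> S l x"
proof -
  obtain r where r: "support_fun M \<Phi> S l = ereal r" using support_fun_real[OF l] x by blast
  obtain s0 where s0: "s0 \<in> means" using means_nonempty x by blast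
  have "v < \<top>" using v[OF s0] by (metis ennreal_less_top le_less_trans)
  then obtain v' where v': "v = ennreal v'" "0 \<le> v'" by (cases v) auto
  have "ereal r \<le> ereal (1 + l \<bullet> \<Phi> x - v')"
    unfolding r[symmetric] support_fun_def
  proof (rule SUP_least)
    fix s assume "s \<in> S \<inter> affine hull (\<Phi> ` D)"
    then have s: "s \<in> means" by (simp add: means_def)
    have "0 \<le> 1 + l \<bullet> (\<Phi> x - s)" using l x s by (simp add: Lambda_iff)
    then have "v' \<le> 1 + l \<bullet> (\<Phi> x - s)" using v[OF s] v' by simp
    then show "ereal (l \<bullet> s) \<le> ereal (1 + l \<bullet> \<Phi> x - v')" by (simp add: inner_diff_right)
  qed
  then show ?thesis using x by (simp add: e_var_def r e2ennreal_ereal v' ennreal_leI)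
qed

lemma e_var_less_top:
  assumes "l \<in> Lambda M \<Phi> S" "x \<in> D"
  shows "e_var M \<Phi> S l x < \<top>"
proof -
  obtain s0 where "s0 \<in> means" using means_nonempty assms(2) by blast
  from e_var_le[OF assms this] show ?thesis by (metis ennreal_less_top le_less_trans)
qed

text \<open>Although \<open>means\<close> may be uncountable and not Borel, a supremum of continuous
  functions is lower semicontinuous: its superlevel sets are unions of open half-spaces.\<close>

lemma measurable_support_fun [measurable]: "support_fun M \<Phi> S \<in> borel_measurable borel"
proof -
  have "{l \<in> space borel. a < support_fun M \<Phi> S l} \<in> sets borel" for a
  proof -
    have "{l \<in> space borel. a < support_fun M \<Phi> S l} = (\<Union>s\<in>means. {l. a < ereal (l \<bullet> s)})"
      unfolding support_fun_def means_def by (auto simp: less_SUP_iff)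
    moreover have "open {l. a < ereal (l \<bullet> s)}" for s
      by (intro open_Collect_less continuous_intros)
    ultimately show ?thesis by (simp only:) (intro borel_open open_UN ballI)
  qed
  then show ?thesis by (rule borel_measurableI_greater)
qed

lemma measurable_e_var:
  assumes D: "D \<in> sets M" and [measurable]: "l \<in> Z \<rightarrow>\<^sub>M borel" "f \<in> Z \<rightarrow>\<^sub>M M"
  shows "(\<lambda>z. e_var M \<Phi> S (l z) (f z)) \<in> borel_measurable Z"
  unfolding e_var_def using D by measurable

end

subsection \<open>Histories\<close>

lemma restrict_hist_space:
  "\<omega> \<in> space (path_space M) \<Longrightarrow> restrict \<omega> {0..<t} \<in> space (hist_space M t)"
  by (auto simp: path_space_def hist_space_def space_PiM)

lemma measurable_path_component [measurable]: "(\<lambda>\<omega>. \<omega> t) \<in> path_space M \<rightarrow>\<^sub>M M"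
  unfolding path_space_def by (rule measurable_component_singleton) simp

lemma measurable_hist_component: "i < t \<Longrightarrow> (\<lambda>h. h i) \<in> hist_space M t \<rightarrow>\<^sub>M M"
  unfolding hist_space_def by (rule measurable_component_singleton) simp

lemma measurable_path_restrict:
  "(\<lambda>\<omega>. restrict \<omega> {0..<t}) \<in> path_space M \<rightarrow>\<^sub>M hist_space M t"
  unfolding path_space_def hist_space_def by (rule measurable_restrict_subset) simp

lemma measurable_hist_restrict:
  "s \<le> t \<Longrightarrow> (\<lambda>h. restrict h {0..<s}) \<in> hist_space M t \<rightarrow>\<^sub>M hist_space M s"
  unfolding hist_space_def by (rule measurable_restrict_subset) auto

lemma measurable_hist_upd:
  "(\<lambda>(h, x). h(t := x)) \<in> hist_space M t \<Otimes>\<^sub>M M \<rightarrow>\<^sub>M hist_space M (Suc t)"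
proof -
  have "(\<lambda>(h, x). h(t := x)) \<in> PiM {0..<t} (\<lambda>_. M) \<Otimes>\<^sub>M M \<rightarrow>\<^sub>M PiM (insert t {0..<t}) (\<lambda>_. M)"
    by (rule measurable_add_dim)
  then show ?thesis by (simp add: hist_space_def atLeastLessThanSuc)
qed

lemma space_nat_filtration [simp]: "space (nat_filtration M t) = space (path_space M)"
  by (simp add: nat_filtration_def)

lemma measurable_nat_filtration_restrict:
  "(\<lambda>\<omega>. restrict \<omega> {0..<t}) \<in> nat_filtration M t \<rightarrow>\<^sub>M hist_space M t"
  unfolding nat_filtration_def by (rule measurable_vimage_algebra1) (auto intro: restrict_hist_space)

lemma sets_nat_filtration:
  "A \<in> sets (nat_filtration M t) \<longleftrightarrow>
     (\<exists>B\<in>sets (hist_space M t). A = {\<omega> \<in> space (path_space M). restrict \<omega> {0..<t} \<in> B})"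
proof -
  have "sets (nat_filtration M t) =
      {(\<lambda>\<omega>. restrict \<omega> {0..<t}) -` B \<inter> space (path_space M) |B. B \<in> sets (hist_space M t)}"
    unfolding nat_filtration_def
    by (rule sets_vimage_algebra2) (auto intro: restrict_hist_space)
  then show ?thesis by (auto simp: vimage_def Int_def conj_commute)
qed

lemma sets_nat_filtration_subset: "sets (nat_filtration M t) \<subseteq> sets (path_space M)"
proof
  fix A assume "A \<in> sets (nat_filtration M t)"
  then obtain B where B: "B \<in> sets (hist_space M t)"
    and A: "A = {\<omega> \<in> space (path_space M). restrict \<omega> {0..<t} \<in> B}"
    unfolding sets_nat_filtration by blast
  have eq: "A = (\<lambda>\<omega>. restrict \<omega> {0..<t}) -` B \<inter> space (path_space M)" unfolding A by auto
  show "A \<in> sets (path_space M)"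
    unfolding eq by (rule measurable_sets[OF measurable_path_restrict B])
qed

lemma subalgebra_nat_filtration:
  "sets P = sets (path_space M) \<Longrightarrow> subalgebra P (nat_filtration M t)"
  using sets_nat_filtration_subset sets_eq_imp_space_eq[of P "path_space M"]
  by (auto simp: subalgebra_def)

lemma sets_nat_filtration_0: "sets (nat_filtration M 0) \<subseteq> {{}, space (path_space M)}"
proof
  fix A assume "A \<in> sets (nat_filtration M 0)"
  then obtain B where A: "A = {\<omega> \<in> space (path_space M). restrict \<omega> {0..<0} \<in> B}"
    unfolding sets_nat_filtration by blast
  have "restrict \<omega> {0..<0} = (\<lambda>_. undefined)" for \<omega> :: "nat \<Rightarrow> 'a" by (simp add: restrict_def)
  then show "A \<in> {{}, space (path_space M)}" unfolding A by (cases "(\<lambda>_. undefined) \<in> B") auto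
qed

lemma measurable_mult_top:
  assumes f: "f \<in> borel_measurable Z" and g: "g \<in> borel_measurable Z"
  shows "(\<lambda>z. mult_top (f z) (g z)) \<in> borel_measurable Z"
  unfolding mult_top_def
proof (rule measurable_If)
  have "{z \<in> space Z. f z = \<infinity>} \<union> {z \<in> space Z. g z = \<infinity>} \<in> sets Z"
    by (intro sets.Un borel_measurable_eq f g borel_measurable_const)
  then show "{z \<in> space Z. f z = \<infinity> \<or> g z = \<infinity>} \<in> sets Z"
    by (simp only: Collect_disj_eq[symmetric] conj_disj_distribL[symmetric])
qed (intro borel_measurable_const borel_measurable_times_ennreal f g)+

lemma mult_top_finite: "a < \<top> \<Longrightarrow> b < \<top> \<Longrightarrow> mult_top a b = a * b"
  by (auto simp: mult_top_def)

lemma mult_top_less_top: "a < \<top> \<Longrightarrow> b < \<top> \<Longrightarrow> mult_top a b < \<top>"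
  by (simp add: mult_top_finite ennreal_mult_less_top)

context moment_constraint
begin

lemma cond_hyp_sys:
  assumes P: "P \<in> cond_hyp M \<Phi> S"
  shows "cond_sys P (nat_filtration M t) (\<lambda>\<omega>. \<omega> t) (cond_mean M \<Phi> P t)"
proof -
  have prob: "prob_space P" and sets: "sets P = sets (path_space M)"
    using P by (auto simp: cond_hyp_def space_prob_algebra)
  have sp: "space P = space (path_space M)" by (rule sets_eq_imp_space_eq) fact
  have comp: "(\<lambda>\<omega>. \<omega> t) \<in> P \<rightarrow>\<^sub>M M"
    unfolding measurable_cong_sets[OF sets refl] by (rule measurable_path_component)
  have int: "integrable P (\<lambda>\<omega>. \<Phi> (\<omega> t))"
  proof (rule integrable_l1)
    show "(\<lambda>\<omega>. \<Phi> (\<omega> t)) \<in> borel_measurable P" by (rule measurable_compose[OF comp measurable_\<Phi>])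
    show "(\<integral>\<^sup>+\<omega>. ennreal (l1_norm (\<Phi> (\<omega> t))) \<partial>P) < \<infinity>" using P by (simp add: cond_hyp_def)
  qed
  have 1: "AE \<omega> in P. cond_mean M \<Phi> P t \<omega> $ i = real_cond_exp P (nat_filtration M t) (\<lambda>\<omega>. \<Phi> (\<omega> t) $ i) \<omega>" for i
  proof (cases "t = 0")
    case True
    have "(\<integral>\<omega>. \<Phi> (\<omega> t) \<partial>P) $ i = (\<integral>\<omega>. \<Phi> (\<omega> t) $ i \<partial>P)"
      by (rule integral_bounded_linear[OF bounded_linear_vec_nth int, symmetric])
    moreover have "AE \<omega> in P. real_cond_exp P (nat_filtration M t) (\<lambda>\<omega>. \<Phi> (\<omega> t) $ i) \<omega> = (\<integral>\<omega>. \<Phi> (\<omega> t) $ i \<partial>P)"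
      by (rule cond_exp_trivial[OF prob subalgebra_nat_filtration[OF sets] _ integrable_component[OF int]])
        (use sets_nat_filtration_0 sp True in auto)
    ultimately show ?thesis using True by (auto simp: cond_mean_def)
  qed (simp add: cond_mean_def)
  have 2: "AE \<omega> in P. cond_mean M \<Phi> P t \<omega> \<in> S"
    using P by (simp add: cond_hyp_def AE_all_countable)
  show ?thesis
    unfolding cond_sys_def
    by (intro conjI allI prob subalgebra_nat_filtration[OF sets] comp int 1 2)
qed

abbreviation N :: "'a measure" where "N \<equiv> restrict_space M D"

lemma D_subset: "D \<subseteq> space M"
  by (auto simp: eff_domain_def)

lemma space_N: "space N = D"
  unfolding space_restrict_space using D_subset by blast

lemma space_hist_N: "space (hist_space N t) = {0..<t} \<rightarrow>\<^sub>E D"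
  by (simp add: hist_space_def space_PiM space_N)

lemma hist_N_pred:
  assumes D: "D \<in> sets M"
  shows "Measurable.pred (hist_space M t) (\<lambda>h. h \<in> {0..<t} \<rightarrow>\<^sub>E D)"
proof -
  have "{0..<t} \<rightarrow>\<^sub>E D \<in> sets (hist_space M t)"
    unfolding hist_space_def by (rule sets_PiM_I_finite[OF finite_atLeastLessThan D])
  moreover from sets.sets_into_space[OF this]
  have "{h \<in> space (hist_space M t). h \<in> {0..<t} \<rightarrow>\<^sub>E D} = {0..<t} \<rightarrow>\<^sub>E D" by blast
  ultimately show ?thesis unfolding pred_def by (simp only:)
qed

text \<open>Histories are retracted coordinatewise to \<open>D\<close>, which carries measurability
  from histories in \<open>D\<close> to all histories.\<close>

lemma measurable_hist_extend:
  assumes D: "D \<in> sets M" and f: "f \<in> hist_space N t \<rightarrow>\<^sub>M K" and c: "c \<in> space K"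
  shows "(\<lambda>h. if h \<in> {0..<t} \<rightarrow>\<^sub>E D then f h else c) \<in> hist_space M t \<rightarrow>\<^sub>M K"
\<comment> \<open>If \<open>D\<close> is empty there is no point to retract to, but then only the
  empty history lies in \<open>D\<close>.\<close>
proof (cases "D = {} \<and> t > 0")
  case True
  then have empty: "{0..<t} \<rightarrow>\<^sub>E D = {}" by (auto simp: PiE_eq_empty_iff)
  show ?thesis unfolding empty empty_iff if_False by (rule measurable_const[OF c])
next
  case False
  define r where "r h = (\<lambda>i\<in>{0..<t}. if h i \<in> D then h i else SOME d. d \<in> D)" for h
  have r: "r \<in> hist_space M t \<rightarrow>\<^sub>M hist_space N t"
    unfolding hist_space_def[of N] r_def
  proof (rule measurable_restrict)
    fix i assume i: "i \<in> {0..<t}"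
    then have d: "(SOME d. d \<in> D) \<in> D" using False by (auto simp: some_in_eq)
    then have dM: "(SOME d. d \<in> D) \<in> space M" using D_subset by blast
    have comp: "(\<lambda>h. h i) \<in> hist_space M t \<rightarrow>\<^sub>M M" using i by (intro measurable_hist_component) simp
    have p: "{h \<in> space (hist_space M t). h i \<in> D} \<in> sets (hist_space M t)"
      using pred_sets2[OF D comp] unfolding pred_def .
    show "(\<lambda>h. if h i \<in> D then h i else SOME d. d \<in> D) \<in> hist_space M t \<rightarrow>\<^sub>M N"
    proof (rule measurable_restrict_space2)
      show "(\<lambda>h. if h i \<in> D then h i else SOME d. d \<in> D) \<in> space (hist_space M t) \<rightarrow> D"
        using d by simp
      show "(\<lambda>h. if h i \<in> D then h i else SOME d. d \<in> D) \<in> hist_space M t \<rightarrow>\<^sub>M M"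
        by (rule measurable_If[OF comp measurable_const[OF dM] p])
    qed
  qed
  have P: "{h \<in> space (hist_space M t). h \<in> {0..<t} \<rightarrow>\<^sub>E D} \<in> sets (hist_space M t)"
    using hist_N_pred[OF D] unfolding pred_def .
  have r_id: "r h = h" if h: "h \<in> {0..<t} \<rightarrow>\<^sub>E D" for h
  proof
    fix i
    show "r h i = h i"
    proof (cases "i \<in> {0..<t}")
      case True
      then show ?thesis using PiE_mem[OF h True] by (simp add: r_def)
    next
      case False
      then have "r h i = undefined" unfolding r_def by (rule restrict_apply[THEN trans, OF if_not_P])
      then show ?thesis using PiE_arb[OF h False] by simp
    qed
  qed
  have "(\<lambda>h. f (r h)) \<in> hist_space M t \<rightarrow>\<^sub>M K" by (rule measurable_compose[OF r f])
  then have meas: "(\<lambda>h. if h \<in> {0..<t} \<rightarrow>\<^sub>E D then f (r h) else c) \<in> hist_space M t \<rightarrow>\<^sub>M K"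
    by (rule measurable_If[OF _ measurable_const[OF c] P])
  have eq: "(\<lambda>h. if h \<in> {0..<t} \<rightarrow>\<^sub>E D then f (r h) else c) = (\<lambda>h. if h \<in> {0..<t} \<rightarrow>\<^sub>E D then f h else c)"
    by (rule ext, rule if_cong[OF refl _ refl], drule r_id, erule arg_cong)
  show ?thesis using meas unfolding eq .
qed

subsection \<open>Predictable products are test supermartingales\<close>

lemma Lambda_seq_mem:
  assumes "l \<in> Lambda_seq M \<Phi> S" "h \<in> {0..<t} \<rightarrow>\<^sub>E D"
  shows "l t h \<in> Lambda M \<Phi> S"
proof -
  have "l t \<in> hist_space N t \<rightarrow>\<^sub>M restrict_space borel (Lambda M \<Phi> S)"
    using assms(1) unfolding Lambda_seq_def by blast
  then show ?thesis
    unfolding measurable_restrict_space2_iff space_hist_N using assms(2) by blast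
qed

lemma Lambda_seq_extend:
  assumes "l \<in> Lambda_seq M \<Phi> S" "D \<in> sets M"
  shows "(\<lambda>h. if h \<in> {0..<t} \<rightarrow>\<^sub>E D then l t h else 0) \<in> hist_space M t \<rightarrow>\<^sub>M borel"
proof (rule measurable_hist_extend[OF assms(2)])
  have "l t \<in> hist_space N t \<rightarrow>\<^sub>M restrict_space borel (Lambda M \<Phi> S)"
    using assms(1) unfolding Lambda_seq_def by blast
  then show "l t \<in> hist_space N t \<rightarrow>\<^sub>M borel" unfolding measurable_restrict_space2_iff by blast
qed simp

lemma pred_product_Suc:
  "pred_product M \<Phi> S l (Suc t) x =
     (if restrict x {0..<t} \<in> {0..<t} \<rightarrow>\<^sub>E D
      then mult_top (pred_product M \<Phi> S l t (restrict x {0..<t})) (e_var M \<Phi> S (l t (restrict x {0..<t})) (x t))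
      else \<infinity>)"
  using pred_product.simps(2)[of M \<Phi> S l t, THEN fun_cong, of x] unfolding Let_def .

lemma measurable_pred_product:
  assumes l: "l \<in> Lambda_seq M \<Phi> S" and D: "D \<in> sets M"
  shows "pred_product M \<Phi> S l t \<in> borel_measurable (hist_space M t)"
proof (induction t)
  case (Suc t)
  let ?l = "\<lambda>h. if h \<in> {0..<t} \<rightarrow>\<^sub>E D then l t h else 0"
  have r: "(\<lambda>h. restrict h {0..<t}) \<in> hist_space M (Suc t) \<rightarrow>\<^sub>M hist_space M t"
    by (rule measurable_hist_restrict) simp
  have pp: "(\<lambda>x. pred_product M \<Phi> S l t (restrict x {0..<t})) \<in> borel_measurable (hist_space M (Suc t))"
    by (rule measurable_compose[OF r Suc])
  have pr: "Measurable.pred (hist_space M (Suc t)) (\<lambda>x. restrict x {0..<t} \<in> {0..<t} \<rightarrow>\<^sub>E D)"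
    by (rule measurable_compose[OF r hist_N_pred[OF D]])
  have "(\<lambda>x. ?l (restrict x {0..<t})) \<in> hist_space M (Suc t) \<rightarrow>\<^sub>M borel"
    by (rule measurable_compose[OF r Lambda_seq_extend[OF l D]])
  then have ev: "(\<lambda>x. e_var M \<Phi> S (?l (restrict x {0..<t})) (x t)) \<in> borel_measurable (hist_space M (Suc t))"
    by (rule measurable_e_var[OF D]) (rule measurable_hist_component, simp)
  have "pred_product M \<Phi> S l (Suc t) = (\<lambda>x. if restrict x {0..<t} \<in> {0..<t} \<rightarrow>\<^sub>E D
      then mult_top (pred_product M \<Phi> S l t (restrict x {0..<t})) (e_var M \<Phi> S (?l (restrict x {0..<t})) (x t))
      else \<infinity>)"
  proof
    fix x
    show "pred_product M \<Phi> S l (Suc t) x = (if restrict x {0..<t} \<in> {0..<t} \<rightarrow>\<^sub>E D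
      then mult_top (pred_product M \<Phi> S l t (restrict x {0..<t})) (e_var M \<Phi> S (?l (restrict x {0..<t})) (x t))
      else \<infinity>)"
      by (cases "restrict x {0..<t} \<in> {0..<t} \<rightarrow>\<^sub>E D") (simp_all only: pred_product_Suc if_True if_False)
  qed
  with measurable_If[OF measurable_mult_top[OF pp ev] borel_measurable_const pr[unfolded pred_def]]
  show ?case by (simp only:)
qed simp

text \<open>Within the effective domain all factors are finite, so the convention for
  \<open>0 * \<infinity>\<close> never acts and the product is an ordinary one.\<close>

lemma pred_product_less_top:
  assumes l: "l \<in> Lambda_seq M \<Phi> S" and h: "h \<in> {0..<t} \<rightarrow>\<^sub>E D"
  shows "pred_product M \<Phi> S l t h < \<top>"
  using h
proof (induction t arbitrary: h)
  case (Suc t)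
  have h': "restrict h {0..<t} \<in> {0..<t} \<rightarrow>\<^sub>E D" using Suc.prems by auto
  have "h t \<in> D" using Suc.prems by auto
  then have "e_var M \<Phi> S (l t (restrict h {0..<t})) (h t) < \<top>"
    by (intro e_var_less_top Lambda_seq_mem[OF l h'])
  then have "mult_top (pred_product M \<Phi> S l t (restrict h {0..<t})) (e_var M \<Phi> S (l t (restrict h {0..<t})) (h t)) < \<top>"
    using Suc.IH[OF h'] by (intro mult_top_less_top)
  then show ?case unfolding pred_product_Suc using h' by (simp only: if_True)
qed simp

lemma pred_product_Suc_D:
  assumes l: "l \<in> Lambda_seq M \<Phi> S" and h: "h \<in> {0..<t} \<rightarrow>\<^sub>E D" and y: "y \<in> D"
  shows "pred_product M \<Phi> S l (Suc t) (h(t := y)) = pred_product M \<Phi> S l t h * e_var M \<Phi> S (l t h) y"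
proof -
  have r: "restrict (h(t := y)) {0..<t} = h"
    using h by (intro extensionalityI[of _ "{0..<t}"]) (auto simp: PiE_iff)
  have "pred_product M \<Phi> S l t h < \<top>" by (rule pred_product_less_top[OF l h])
  moreover have "e_var M \<Phi> S (l t h) y < \<top>" by (rule e_var_less_top[OF Lambda_seq_mem[OF l h] y])
  ultimately show ?thesis using h unfolding pred_product_Suc r by (simp add: mult_top_finite)
qed

context
  fixes P l
  assumes P: "P \<in> cond_hyp M \<Phi> S" and l: "l \<in> Lambda_seq M \<Phi> S" and D: "D \<in> sets M"
begin

lemma prob_P: "prob_space P" and sets_P: "sets P = sets (path_space M)"
  using P by (auto simp: cond_hyp_def space_prob_algebra)

lemma space_P: "space P = space (path_space M)"
  by (rule sets_eq_imp_space_eq[OF sets_P])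

definition wealth :: "nat \<Rightarrow> (nat \<Rightarrow> 'a) \<Rightarrow> ennreal" where
  "wealth t \<omega> = pred_product M \<Phi> S l t (restrict \<omega> {0..<t})"

definition bet :: "nat \<Rightarrow> (nat \<Rightarrow> 'a) \<Rightarrow> real ^ 'm" where
  "bet t \<omega> = (if restrict \<omega> {0..<t} \<in> {0..<t} \<rightarrow>\<^sub>E D then l t (restrict \<omega> {0..<t}) else 0)"

lemma measurable_wealth: "wealth t \<in> borel_measurable (nat_filtration M t)"
  unfolding wealth_def
  by (rule measurable_compose[OF measurable_nat_filtration_restrict measurable_pred_product[OF l D]])

lemma measurable_bet: "bet t \<in> nat_filtration M t \<rightarrow>\<^sub>M borel"
  unfolding bet_def
  by (rule measurable_compose[OF measurable_nat_filtration_restrict Lambda_seq_extend[OF l D]])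

lemma AE_domain: "AE \<omega> in P. \<forall>t. \<omega> t \<in> D"
  unfolding AE_all_countable by (intro allI cond_sys_D(1)[OF cond_hyp_sys[OF P]])

text \<open>A version of the conditional mean given by a conditional expectation at every time,
  including 0; almost surely it agrees with \<open>cond_mean\<close>.\<close>

definition pmean :: "nat \<Rightarrow> (nat \<Rightarrow> 'a) \<Rightarrow> real ^ 'm" where
  "pmean t \<omega> = (\<chi> i. real_cond_exp P (nat_filtration M t) (\<lambda>\<omega>. \<Phi> (\<omega> t) $ i) \<omega>)"

lemma AE_pmean: "AE \<omega> in P. pmean t \<omega> \<in> means"
proof -
  note sys = cond_hyp_sys[OF P, of t]
  have "AE \<omega> in P. \<forall>i\<in>UNIV. cond_mean M \<Phi> P t \<omega> $ i = pmean t \<omega> $ i"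
  proof (rule AE_finite_allI)
    fix i
    show "AE \<omega> in P. cond_mean M \<Phi> P t \<omega> $ i = pmean t \<omega> $ i"
      using sys unfolding cond_sys_def pmean_def vec_lambda_beta by blast
  qed simp
  with cond_sys_D(2)[OF sys] show ?thesis
  proof eventually_elim
    case (elim \<omega>)
    then have "cond_mean M \<Phi> P t \<omega> = pmean t \<omega>" by (simp add: vec_eq_iff)
    then show ?case using elim(1) by simp
  qed
qed

text \<open>The conditional mean lies almost surely in \<open>means\<close>, so it may serve as the
  point \<open>s\<close> in \<open>e_var_le\<close>. For this random \<open>s\<close> the affine
  factor formally has conditional expectation 1.\<close>

lemma wealth_Suc_le:
  "AE \<omega> in P. wealth (Suc t) \<omega> \<le> wealth t \<omega> * ennreal (1 + bet t \<omega> \<bullet> (\<Phi> (\<omega> t) - pmean t \<omega>)) \<and>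
     0 \<le> 1 + bet t \<omega> \<bullet> (\<Phi> (\<omega> t) - pmean t \<omega>) \<and> wealth t \<omega> < \<top>"
  using AE_domain AE_pmean[of t]
proof eventually_elim
  case (elim \<omega>)
  have h: "restrict \<omega> {0..<t} \<in> {0..<t} \<rightarrow>\<^sub>E D" using elim(1) by (simp add: restrict_PiE_iff)
  have y: "\<omega> t \<in> D" using elim(1) by blast
  have b: "bet t \<omega> = l t (restrict \<omega> {0..<t})" unfolding bet_def using h by (rule if_P)
  have lL: "bet t \<omega> \<in> Lambda M \<Phi> S" unfolding b by (rule Lambda_seq_mem[OF l h])
  have "restrict \<omega> {0..<Suc t} = (restrict \<omega> {0..<t})(t := \<omega> t)"
    by (auto simp: restrict_def fun_eq_iff)
  then have "wealth (Suc t) \<omega> = wealth t \<omega> * e_var M \<Phi> S (bet t \<omega>) (\<omega> t)"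
    unfolding wealth_def b using pred_product_Suc_D[OF l h y] by (simp only:)
  also have "\<dots> \<le> wealth t \<omega> * ennreal (1 + bet t \<omega> \<bullet> (\<Phi> (\<omega> t) - pmean t \<omega>))"
    by (intro mult_left_mono e_var_le lL y elim(2)) simp
  finally show ?case
    using lL y elim(2) pred_product_less_top[OF l h] unfolding Lambda_iff wealth_def by blast
qed

text \<open>Where wealth and bet are bounded, their products with the coordinates of \<Phi> are
  integrable, so the predictable factors can be moved through the conditional expectation and the
  centred terms cancel.\<close>

lemma wealth_step_bounded:
  assumes B: "B \<in> sets (nat_filtration M t)"
    and bound: "\<And>\<omega>. \<omega> \<in> B \<Longrightarrow> wealth t \<omega> \<le> ennreal k \<and> norm (bet t \<omega>) \<le> k"
  shows "(\<integral>\<^sup>+\<omega>. indicator B \<omega> * wealth (Suc t) \<omega> \<partial>P) \<le> (\<integral>\<^sup>+\<omega>. indicator B \<omega> * wealth t \<omega> \<partial>P)"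
proof -
  interpret prob_space P by (rule prob_P)
  let ?F = "nat_filtration M t"
  note sys = cond_hyp_sys[OF P, of t]
  interpret sigma_finite_subalgebra P ?F by (rule cond_sys_subalgebra[OF sys])
  note measurable_from_subalg[OF subalg, measurable_dest]
  have int_i: "integrable P (\<lambda>\<omega>. \<Phi> (\<omega> t) $ i)" for i
    by (rule integrable_component) (use sys in \<open>unfold cond_sys_def, blast\<close>)
  then have int_pm: "integrable P (\<lambda>\<omega>. pmean t \<omega> $ i)" for i
    unfolding pmean_def vec_lambda_beta by (rule real_cond_exp_int(1))
  define c where "c \<omega> = indicator B \<omega> * enn2real (wealth t \<omega>)" for \<omega>
  have c_F: "c \<in> borel_measurable ?F"
    unfolding c_def
    by (rule borel_measurable_times[OF borel_measurable_indicator[OF B] borel_measurable_enn2real[OF measurable_wealth]])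
  have c_nonneg: "0 \<le> c \<omega>" for \<omega> by (simp add: c_def)
  have k: "c \<omega> \<le> \<bar>k\<bar>" for \<omega>
  proof (cases "\<omega> \<in> B")
    case True
    then have "wealth t \<omega> \<le> ennreal \<bar>k\<bar>" using bound[OF True] by (metis abs_ge_self ennreal_leI order_trans)
    then show ?thesis using True by (simp add: c_def enn2real_leI)
  qed (simp add: c_def)
  have c_int: "integrable P c"
  proof (rule integrable_const_bound)
    show "AE \<omega> in P. norm (c \<omega>) \<le> \<bar>k\<bar>"
      using k c_nonneg by (intro AE_I2) simp
  qed (rule measurable_from_subalg[OF subalg c_F])
  have bet_F: "(\<lambda>\<omega>. bet t \<omega> $ i) \<in> borel_measurable ?F" for i
    by (rule measurable_compose[OF measurable_bet]) (intro borel_measurable_continuous_onI continuous_intros)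
  define f where "f i \<omega> = c \<omega> * bet t \<omega> $ i" for i \<omega>
  have f_F: "f i \<in> borel_measurable ?F" for i
    unfolding f_def using c_F bet_F[of i] by (rule borel_measurable_times)
  have f_bound: "\<bar>f i \<omega>\<bar> \<le> \<bar>k\<bar> * \<bar>k\<bar>" for i \<omega>
  proof (cases "\<omega> \<in> B")
    case True
    have "\<bar>bet t \<omega> $ i\<bar> \<le> \<bar>k\<bar>" using bound[OF True] component_le_norm_cart[of "bet t \<omega>" i] by linarith
    then show ?thesis unfolding f_def abs_mult using k[of \<omega>] c_nonneg[of \<omega>] by (intro mult_mono) auto
  qed (simp add: f_def c_def)
  have f_int: "integrable P (\<lambda>\<omega>. f i \<omega> * g \<omega>)" if g: "integrable P g" for i g
  proof (rule Bochner_Integration.integrable_bound)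
    show "integrable P (\<lambda>\<omega>. \<bar>k\<bar> * \<bar>k\<bar> * g \<omega>)" using g by simp
    show "(\<lambda>\<omega>. f i \<omega> * g \<omega>) \<in> borel_measurable P"
      by (rule borel_measurable_times[OF measurable_from_subalg[OF subalg f_F] borel_measurable_integrable[OF g]])
    show "AE \<omega> in P. norm (f i \<omega> * g \<omega>) \<le> norm (\<bar>k\<bar> * \<bar>k\<bar> * g \<omega>)"
    proof (rule AE_I2)
      fix \<omega>
      have "\<bar>f i \<omega>\<bar> * \<bar>g \<omega>\<bar> \<le> \<bar>k\<bar> * \<bar>k\<bar> * \<bar>g \<omega>\<bar>" by (rule mult_right_mono[OF f_bound]) simp
      then show "norm (f i \<omega> * g \<omega>) \<le> norm (\<bar>k\<bar> * \<bar>k\<bar> * g \<omega>)" by (simp only: real_norm_def abs_mult abs_abs)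
    qed
  qed
  have zero: "(\<integral>\<omega>. f i \<omega> * \<Phi> (\<omega> t) $ i \<partial>P) = (\<integral>\<omega>. f i \<omega> * pmean t \<omega> $ i \<partial>P)" for i
    unfolding pmean_def vec_lambda_beta
    by (rule real_cond_exp_intg(2)[symmetric, OF f_int[OF int_i] f_F borel_measurable_integrable[OF int_i]])
  define g where "g \<omega> = c \<omega> * (1 + bet t \<omega> \<bullet> (\<Phi> (\<omega> t) - pmean t \<omega>))" for \<omega>
  have g_eq: "g = (\<lambda>\<omega>. c \<omega> + (\<Sum>i\<in>UNIV. f i \<omega> * \<Phi> (\<omega> t) $ i - f i \<omega> * pmean t \<omega> $ i))"
  proof
    fix \<omega>
    have "g \<omega> = c \<omega> + c \<omega> * (\<Sum>i\<in>UNIV. bet t \<omega> $ i * (\<Phi> (\<omega> t) $ i - pmean t \<omega> $ i))"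
      unfolding g_def inner_vec_def by (simp add: distrib_left)
    also have "\<dots> = c \<omega> + (\<Sum>i\<in>UNIV. f i \<omega> * \<Phi> (\<omega> t) $ i - f i \<omega> * pmean t \<omega> $ i)"
      unfolding f_def sum_distrib_left by (simp add: right_diff_distrib mult.assoc)
    finally show "g \<omega> = c \<omega> + (\<Sum>i\<in>UNIV. f i \<omega> * \<Phi> (\<omega> t) $ i - f i \<omega> * pmean t \<omega> $ i)" .
  qed
  have g_int: "integrable P g"
    unfolding g_eq by (intro Bochner_Integration.integrable_add Bochner_Integration.integrable_sum
        Bochner_Integration.integrable_diff c_int f_int int_i int_pm)
  have d_int: "integrable P (\<lambda>\<omega>. f i \<omega> * \<Phi> (\<omega> t) $ i - f i \<omega> * pmean t \<omega> $ i)" for i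
    by (intro Bochner_Integration.integrable_diff f_int int_i int_pm)
  have d_zero: "(\<integral>\<omega>. f i \<omega> * \<Phi> (\<omega> t) $ i - f i \<omega> * pmean t \<omega> $ i \<partial>P) = 0" for i
    unfolding Bochner_Integration.integral_diff[OF f_int[OF int_i] f_int[OF int_pm]] zero by (rule diff_self)
  have "(\<integral>\<omega>. (\<Sum>i\<in>UNIV. f i \<omega> * \<Phi> (\<omega> t) $ i - f i \<omega> * pmean t \<omega> $ i) \<partial>P) =
      (\<Sum>i\<in>UNIV. \<integral>\<omega>. f i \<omega> * \<Phi> (\<omega> t) $ i - f i \<omega> * pmean t \<omega> $ i \<partial>P)"
    by (rule Bochner_Integration.integral_sum) (rule d_int)
  also have "\<dots> = 0" unfolding d_zero by simp
  finally have sum0: "(\<integral>\<omega>. (\<Sum>i\<in>UNIV. f i \<omega> * \<Phi> (\<omega> t) $ i - f i \<omega> * pmean t \<omega> $ i) \<partial>P) = 0" .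
  have "(\<integral>\<omega>. g \<omega> \<partial>P) = (\<integral>\<omega>. c \<omega> \<partial>P) + (\<integral>\<omega>. (\<Sum>i\<in>UNIV. f i \<omega> * \<Phi> (\<omega> t) $ i - f i \<omega> * pmean t \<omega> $ i) \<partial>P)"
    unfolding g_eq
    by (rule Bochner_Integration.integral_add) (intro c_int Bochner_Integration.integrable_sum d_int)+
  then have gc: "(\<integral>\<omega>. g \<omega> \<partial>P) = (\<integral>\<omega>. c \<omega> \<partial>P)" unfolding sum0 by simp
  have "(\<integral>\<^sup>+\<omega>. indicator B \<omega> * wealth (Suc t) \<omega> \<partial>P) \<le> (\<integral>\<^sup>+\<omega>. ennreal (g \<omega>) \<partial>P)"
  proof (rule nn_integral_mono_AE)
    show "AE \<omega> in P. indicator B \<omega> * wealth (Suc t) \<omega> \<le> ennreal (g \<omega>)"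
      using wealth_Suc_le[of t]
    proof eventually_elim
      case (elim \<omega>)
      show ?case
      proof (cases "\<omega> \<in> B")
        case True
        have "ennreal (g \<omega>) = ennreal (enn2real (wealth t \<omega>)) * ennreal (1 + bet t \<omega> \<bullet> (\<Phi> (\<omega> t) - pmean t \<omega>))"
          using True elim by (simp add: g_def c_def ennreal_mult)
        also have "ennreal (enn2real (wealth t \<omega>)) = wealth t \<omega>" using elim by simp
        finally show ?thesis using True elim by simp
      qed simp
    qed
  qed
  also have "\<dots> = ennreal (\<integral>\<omega>. g \<omega> \<partial>P)"
  proof (rule nn_integral_eq_integral[OF g_int])
    show "AE \<omega> in P. 0 \<le> g \<omega>"
      using wealth_Suc_le[of t] by eventually_elim (simp add: g_def c_nonneg)
  qed
  also have "\<dots> = (\<integral>\<^sup>+\<omega>. ennreal (c \<omega>) \<partial>P)"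
    unfolding gc
    by (rule nn_integral_eq_integral[symmetric, OF c_int]) (simp add: c_nonneg)
  also have "\<dots> = (\<integral>\<^sup>+\<omega>. indicator B \<omega> * wealth t \<omega> \<partial>P)"
  proof (rule nn_integral_cong_AE)
    show "AE \<omega> in P. ennreal (c \<omega>) = indicator B \<omega> * wealth t \<omega>"
      using wealth_Suc_le[of t] by eventually_elim (auto simp: c_def split: split_indicator)
  qed
  finally show ?thesis .
qed

text \<open>Localisation: wealth and bet need not be integrable, but the sets \<open>B k\<close>
  where both are at most \<open>k\<close> belong to the filtration and exhaust \<open>A\<close>
  almost surely. Monotone convergence finishes.\<close>

lemma wealth_step:
  assumes A: "A \<in> sets (nat_filtration M t)"
  shows "(\<integral>\<^sup>+\<omega>. indicator A \<omega> * wealth (Suc t) \<omega> \<partial>P) \<le> (\<integral>\<^sup>+\<omega>. indicator A \<omega> * wealth t \<omega> \<partial>P)"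
proof -
  let ?F = "nat_filtration M t"
  have sub: "subalgebra P (nat_filtration M s)" for s by (rule subalgebra_nat_filtration[OF sets_P])
  have wP: "wealth s \<in> borel_measurable P" for s
    by (rule measurable_from_subalg[OF sub measurable_wealth])
  define B where "B k = {\<omega> \<in> space ?F. \<omega> \<in> A \<and> wealth t \<omega> \<le> ennreal (real k) \<and> norm (bet t \<omega>) \<le> real k}" for k :: nat
  have B_F: "B k \<in> sets ?F" for k
  proof -
    have "A \<inter> {\<omega> \<in> space ?F. wealth t \<omega> \<le> ennreal (real k)} \<inter> {\<omega> \<in> space ?F. norm (bet t \<omega>) \<le> real k} \<in> sets ?F"
      by (intro sets.Int A borel_measurable_le measurable_compose[OF measurable_bet borel_measurable_norm]
          borel_measurable_const measurable_wealth)
    also have "A \<inter> {\<omega> \<in> space ?F. wealth t \<omega> \<le> ennreal (real k)} \<inter> {\<omega> \<in> space ?F. norm (bet t \<omega>) \<le> real k} = B k"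
      unfolding B_def by (intro set_eqI) (simp only: Int_iff mem_Collect_eq, blast)
    finally show ?thesis .
  qed
  have B_P: "B k \<in> sets P" for k using B_F[of k] sub[of t] unfolding subalgebra_def by blast
  have A_P: "A \<in> sets P" using A sub[of t] unfolding subalgebra_def by blast
  have mono: "incseq (\<lambda>k \<omega>. indicator (B k) \<omega> * wealth (Suc t) \<omega>)"
  proof (intro incseq_SucI le_funI mult_right_mono)
    fix k \<omega>
    have "B k \<subseteq> B (Suc k)"
    proof
      fix x assume x: "x \<in> B k"
      have "ennreal (real k) \<le> ennreal (real (Suc k))" by (rule ennreal_leI) simp
      with x have "wealth t x \<le> ennreal (real (Suc k))" unfolding B_def by (blast intro: order_trans)
      moreover have "norm (bet t x) \<le> real (Suc k)" using x unfolding B_def by simp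
      ultimately show "x \<in> B (Suc k)" using x unfolding B_def by blast
    qed
    from subsetD[OF this, of \<omega>] show "indicator (B k) \<omega> \<le> (indicator (B (Suc k)) \<omega> :: ennreal)"
      by (cases "\<omega> \<in> B k") simp_all
  qed simp
  have "(\<integral>\<^sup>+\<omega>. indicator A \<omega> * wealth (Suc t) \<omega> \<partial>P) = (\<integral>\<^sup>+\<omega>. (SUP k. indicator (B k) \<omega> * wealth (Suc t) \<omega>) \<partial>P)"
  proof (rule nn_integral_cong_AE)
    show "AE \<omega> in P. indicator A \<omega> * wealth (Suc t) \<omega> = (SUP k. indicator (B k) \<omega> * wealth (Suc t) \<omega>)"
      using wealth_Suc_le[of t] AE_space
    proof eventually_elim
      case (elim \<omega>)
      show ?case
      proof (cases "\<omega> \<in> A")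
        case True
        obtain k :: nat where k: "max (enn2real (wealth t \<omega>)) (norm (bet t \<omega>)) \<le> real k"
          using real_arch_simple by blast
        have "wealth t \<omega> = ennreal (enn2real (wealth t \<omega>))" using elim by simp
        also have "\<dots> \<le> ennreal (real k)" using k by (intro ennreal_leI) simp
        finally have "\<omega> \<in> B k" using True elim k by (simp add: B_def space_P)
        then have "wealth (Suc t) \<omega> \<le> (SUP k. indicator (B k) \<omega> * wealth (Suc t) \<omega>)"
          by (intro SUP_upper2[of k]) simp_all
        moreover have "(SUP k. indicator (B k) \<omega> * wealth (Suc t) \<omega>) \<le> wealth (Suc t) \<omega>"
        proof (rule SUP_least)
          fix k
          show "indicator (B k) \<omega> * wealth (Suc t) \<omega> \<le> wealth (Suc t) \<omega>" by (cases "\<omega> \<in> B k") simp_all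
        qed
        ultimately show ?thesis using True by simp
      next
        case False
        then have "\<omega> \<notin> B k" for k by (simp add: B_def)
        then show ?thesis using False by simp
      qed
    qed
  qed
  also have "\<dots> = (SUP k. \<integral>\<^sup>+\<omega>. indicator (B k) \<omega> * wealth (Suc t) \<omega> \<partial>P)"
    by (rule nn_integral_monotone_convergence_SUP[OF mono])
      (intro borel_measurable_times_ennreal borel_measurable_indicator B_P wP)
  also have "\<dots> \<le> (\<integral>\<^sup>+\<omega>. indicator A \<omega> * wealth t \<omega> \<partial>P)"
  proof (rule SUP_least)
    fix k
    have "(\<integral>\<^sup>+\<omega>. indicator (B k) \<omega> * wealth (Suc t) \<omega> \<partial>P) \<le> (\<integral>\<^sup>+\<omega>. indicator (B k) \<omega> * wealth t \<omega> \<partial>P)"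
      by (rule wealth_step_bounded[OF B_F, of _ "real k"]) (simp add: B_def)
    also have "\<dots> \<le> (\<integral>\<^sup>+\<omega>. indicator A \<omega> * wealth t \<omega> \<partial>P)"
      by (intro nn_integral_mono mult_right_mono) (simp_all add: B_def indicator_def)
    finally show "(\<integral>\<^sup>+\<omega>. indicator (B k) \<omega> * wealth (Suc t) \<omega> \<partial>P) \<le> (\<integral>\<^sup>+\<omega>. indicator A \<omega> * wealth t \<omega> \<partial>P)" .
  qed
  finally show ?thesis .
qed

text \<open>Optional stopping by induction on the cap \<open>n\<close>: the stopped process changes
  only where \<open>\<tau>\<close> exceeds \<open>n\<close>, an event known at time
  \<open>n\<close>, and there \<open>wealth_step\<close> applies.\<close>

lemma wealth_stopped_le:
  assumes \<tau>: "stopping_time (nat_filtration M) \<tau>"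
  shows "(\<lambda>\<omega>. wealth (min (\<tau> \<omega>) n) \<omega>) \<in> borel_measurable P \<and> (\<integral>\<^sup>+\<omega>. wealth (min (\<tau> \<omega>) n) \<omega> \<partial>P) \<le> 1"
proof (induction n)
  case 0
  have "wealth 0 = (\<lambda>_. 1)" by (simp add: wealth_def fun_eq_iff)
  then show ?case using prob_space.emeasure_space_1[OF prob_P] by simp
next
  case (Suc n)
  let ?X = "\<lambda>\<omega>. wealth (min (\<tau> \<omega>) n) \<omega>"
  let ?A = "{\<omega> \<in> space P. \<not> \<tau> \<omega> \<le> n}"
  have sub: "subalgebra P (nat_filtration M s)" for s by (rule subalgebra_nat_filtration[OF sets_P])
  have "Measurable.pred (nat_filtration M n) (\<lambda>\<omega>. \<not> \<tau> \<omega> \<le> n)"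
    by (rule pred_intros_logic(2)) (use \<tau> in \<open>unfold stopping_time_def, blast\<close>)
  then have A: "?A \<in> sets (nat_filtration M n)" by (simp only: pred_def space_nat_filtration space_P)
  then have AP: "?A \<in> sets P" using sub[of n] unfolding subalgebra_def by blast
  have wP: "wealth s \<in> borel_measurable P" for s
    by (rule measurable_from_subalg[OF sub measurable_wealth])
  have X: "?X \<in> borel_measurable P" using Suc by blast
  have AcP: "space P - ?A \<in> sets P" using AP by (rule sets.compl_sets)
  have eq: "wealth (min (\<tau> \<omega>) (Suc n)) \<omega> = indicator (space P - ?A) \<omega> * ?X \<omega> + indicator ?A \<omega> * wealth (Suc n) \<omega>"
    "?X \<omega> = indicator (space P - ?A) \<omega> * ?X \<omega> + indicator ?A \<omega> * wealth n \<omega>" if "\<omega> \<in> space P" for \<omega>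
    using that by (cases "\<tau> \<omega> \<le> n"; simp add: min_def le_Suc_eq)+
  have m1: "(\<lambda>\<omega>. indicator (space P - ?A) \<omega> * ?X \<omega>) \<in> borel_measurable P"
    by (intro borel_measurable_times_ennreal borel_measurable_indicator AcP X)
  have m2: "(\<lambda>\<omega>. indicator ?A \<omega> * wealth s \<omega>) \<in> borel_measurable P" for s
    by (intro borel_measurable_times_ennreal borel_measurable_indicator AP wP)
  have "(\<integral>\<^sup>+\<omega>. wealth (min (\<tau> \<omega>) (Suc n)) \<omega> \<partial>P) =
      (\<integral>\<^sup>+\<omega>. indicator (space P - ?A) \<omega> * ?X \<omega> + indicator ?A \<omega> * wealth (Suc n) \<omega> \<partial>P)"
    by (intro nn_integral_cong eq(1))
  also have "\<dots> = (\<integral>\<^sup>+\<omega>. indicator (space P - ?A) \<omega> * ?X \<omega> \<partial>P) + (\<integral>\<^sup>+\<omega>. indicator ?A \<omega> * wealth (Suc n) \<omega> \<partial>P)"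
    by (rule nn_integral_add[OF m1 m2])
  also have "\<dots> \<le> (\<integral>\<^sup>+\<omega>. indicator (space P - ?A) \<omega> * ?X \<omega> \<partial>P) + (\<integral>\<^sup>+\<omega>. indicator ?A \<omega> * wealth n \<omega> \<partial>P)"
    by (intro add_left_mono wealth_step A)
  also have "\<dots> = (\<integral>\<^sup>+\<omega>. indicator (space P - ?A) \<omega> * ?X \<omega> + indicator ?A \<omega> * wealth n \<omega> \<partial>P)"
    by (rule nn_integral_add[symmetric, OF m1 m2])
  also have "\<dots> = (\<integral>\<^sup>+\<omega>. ?X \<omega> \<partial>P)" by (intro nn_integral_cong eq(2)[symmetric])
  also have "\<dots> \<le> 1" using Suc by blast
  finally have le: "(\<integral>\<^sup>+\<omega>. wealth (min (\<tau> \<omega>) (Suc n)) \<omega> \<partial>P) \<le> 1" .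
  have "(\<lambda>\<omega>. wealth (min (\<tau> \<omega>) (Suc n)) \<omega>) \<in> borel_measurable P \<longleftrightarrow>
      (\<lambda>\<omega>. indicator (space P - ?A) \<omega> * ?X \<omega> + indicator ?A \<omega> * wealth (Suc n) \<omega>) \<in> borel_measurable P"
    by (rule measurable_cong) (rule eq(1))
  moreover have "\<dots>" by (intro borel_measurable_add m1 m2)
  ultimately show ?case using le by blast
qed

end

theorem pred_product_e_process:
  assumes l: "l \<in> Lambda_seq M \<Phi> S" and E: "nonneg_process M E"
    and le: "\<And>t x. x \<in> space (hist_space M t) \<Longrightarrow> E t x \<le> pred_product M \<Phi> S l t x"
  shows "e_process M (cond_hyp M \<Phi> S) E"
  unfolding e_process_def
proof (intro conjI ballI E)
  fix x assume "x \<in> space (hist_space M 0)"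
  from le[OF this] show "E 0 x \<le> 1" by simp
next
  fix \<tau> P assume \<tau>: "\<tau> \<in> bounded_stopping_times M" and P: "P \<in> cond_hyp M \<Phi> S"
  obtain T where T: "\<And>\<omega>. \<omega> \<in> space (path_space M) \<Longrightarrow> \<tau> \<omega> \<le> T"
    and st: "stopping_time (nat_filtration M) \<tau>" using \<tau> by (auto simp: bounded_stopping_times_def)
  \<comment> \<open>Measurability of the domain comes from the law \<open>P\<close> at hand, through
    facial reduction.\<close>
  have D: "D \<in> sets M" by (rule reach_sets[OF reach_D(1)[OF cond_hyp_sys[OF P]]])
  note wealth = wealth_def[OF P l D]
  have "(\<integral>\<^sup>+\<omega>. stopped E \<tau> \<omega> \<partial>P) \<le> (\<integral>\<^sup>+\<omega>. wealth l (min (\<tau> \<omega>) T) \<omega> \<partial>P)"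
  proof (rule nn_integral_mono)
    fix \<omega> assume "\<omega> \<in> space P"
    then have \<omega>: "\<omega> \<in> space (path_space M)" by (simp add: space_P[OF P l D])
    show "stopped E \<tau> \<omega> \<le> wealth l (min (\<tau> \<omega>) T) \<omega>"
      unfolding stopped_def wealth min_absorb1[OF T[OF \<omega>]]
      by (rule le[OF restrict_hist_space[OF \<omega>]])
  qed
  also have "\<dots> \<le> 1" using wealth_stopped_le[OF P l D st] by blast
  finally show "(\<integral>\<^sup>+\<omega>. stopped E \<tau> \<omega> \<partial>P) \<le> 1" .
qed

end

subsection \<open>Finite strategies\<close>

lemma ennreal_inverse_mult_self:
  fixes x :: ennreal
  assumes "x \<noteq> 0" "x < \<top>"
  shows "inverse x * x = 1"
proof -
  obtain r where r: "x = ennreal r" "0 \<le> r" using assms(2) by (cases x) auto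
  then have "0 < r" using assms(1) by (cases "r = 0") auto
  have "inverse x * x = ennreal (inverse r) * ennreal r" unfolding r(1) inverse_ennreal[OF \<open>0 < r\<close>] ..
  also have "\<dots> = ennreal (inverse r * r)" using \<open>0 < r\<close> by (intro ennreal_mult[symmetric]) simp_all
  finally show ?thesis using \<open>0 < r\<close> by simp
qed

lemma coded_pair:
  assumes "coded A" "coded B"
  shows "coded (A \<Otimes>\<^sub>M B)"
proof -
  obtain c g where c[measurable]: "c \<in> A \<rightarrow>\<^sub>M baire" and inj_c: "inj_on c (space A)"
    and g[measurable]: "g \<in> baire \<rightarrow>\<^sub>M A" and surj_g: "range g = space A"
    using codedE[OF assms(1)] .
  obtain d h where d[measurable]: "d \<in> B \<rightarrow>\<^sub>M baire" and inj_d: "inj_on d (space B)"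
    and h[measurable]: "h \<in> baire \<rightarrow>\<^sub>M B" and surj_h: "range h = space B"
    using codedE[OF assms(2)] .
  let ?c = "\<lambda>x. unslice (\<lambda>i. if i = 0 then c (fst x) else d (snd x))"
  let ?g = "\<lambda>w. (g (slice 0 w), h (slice 1 w))"
  have "?c \<in> A \<Otimes>\<^sub>M B \<rightarrow>\<^sub>M baire"
  proof (rule measurable_baireI)
    fix m
    have comp: "(\<lambda>x. c (fst x) n) \<in> A \<Otimes>\<^sub>M B \<rightarrow>\<^sub>M count_space UNIV"
      "(\<lambda>x. d (snd x) n) \<in> A \<Otimes>\<^sub>M B \<rightarrow>\<^sub>M count_space UNIV" for n
      by (rule measurable_compose[OF measurable_compose[OF measurable_fst c] measurable_baire_component]
          measurable_compose[OF measurable_compose[OF measurable_snd d] measurable_baire_component])+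
    show "(\<lambda>x. ?c x m) \<in> A \<Otimes>\<^sub>M B \<rightarrow>\<^sub>M count_space UNIV"
      by (cases "fst (prod_decode m) = 0") (simp_all add: unslice_def comp)
  qed
  moreover have "inj_on ?c (space (A \<Otimes>\<^sub>M B))"
  proof (rule inj_onI)
    fix x y assume xy: "x \<in> space (A \<Otimes>\<^sub>M B)" "y \<in> space (A \<Otimes>\<^sub>M B)" and eq: "?c x = ?c y"
    have "slice i (?c x) = slice i (?c y)" for i by (simp only: eq)
    from this[of 0] this[of 1] have "c (fst x) = c (fst y)" "d (snd x) = d (snd y)" by simp_all
    moreover have "fst x \<in> space A" "fst y \<in> space A" "snd x \<in> space B" "snd y \<in> space B"
      using xy unfolding space_pair_measure mem_Times_iff by blast+
    ultimately have "fst x = fst y" "snd x = snd y"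
      using inj_onD[OF inj_c] inj_onD[OF inj_d] by blast+
    then show "x = y" by (rule prod_eqI)
  qed
  moreover have "?g \<in> baire \<rightarrow>\<^sub>M A \<Otimes>\<^sub>M B"
    by (rule measurable_Pair[OF measurable_compose[OF measurable_slice g] measurable_compose[OF measurable_slice h]])
  moreover have "range ?g = space (A \<Otimes>\<^sub>M B)"
  proof (intro set_eqI iffI)
    fix x assume "x \<in> space (A \<Otimes>\<^sub>M B)"
    then have x: "fst x \<in> space A" "snd x \<in> space B" by (simp_all add: space_pair_measure mem_Times_iff)
    have "\<exists>v. fst x = g v" using x(1) unfolding surj_g[symmetric] by (rule rangeE) (rule exI)
    moreover have "\<exists>w. snd x = h w" using x(2) unfolding surj_h[symmetric] by (rule rangeE) (rule exI)
    ultimately obtain v w where vw: "fst x = g v" "snd x = h w" by (elim exE)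
    have "x = ?g (unslice (\<lambda>i. if i = 0 then v else w))" using vw by (simp add: prod_eq_iff)
    then show "x \<in> range ?g" by blast
  next
    fix x assume "x \<in> range ?g"
    then obtain w where "x = ?g w" by blast
    moreover have "g (slice 0 w) \<in> space A" unfolding surj_g[symmetric] by (rule rangeI)
    moreover have "h (slice 1 w) \<in> space B" unfolding surj_h[symmetric] by (rule rangeI)
    ultimately show "x \<in> space (A \<Otimes>\<^sub>M B)" unfolding space_pair_measure by simp
  qed
  ultimately show ?thesis unfolding coded_def by blast
qed

lemma coded_borel_real: "coded (borel :: real measure)"
proof (rule coded_standard_borel)
  obtain D :: "real set" where D: "countable D" "\<And>X. open X \<Longrightarrow> X \<noteq> {} \<Longrightarrow> \<exists>d\<in>D. d \<in> X"
    by (metis countable_dense_setE)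
  have "closure D = UNIV"
  proof (rule ccontr)
    assume "closure D \<noteq> UNIV"
    then have "- closure D \<noteq> {}" by auto
    from D(2)[OF open_Compl[OF closed_closure] this] obtain d where "d \<in> D" "d \<in> - closure D" by (elim bexE)
    then show False using closure_subset[of D] by auto
  qed
  then have "separable_space (euclidean :: real topology)"
    unfolding separable_space_def using D(1) by (intro exI[of _ D] conjI) (simp_all add: euclidean_closure_of)
  then show "standard_borel (borel :: real measure)"
    unfolding standard_borel_def
    by (intro exI[of _ euclidean] conjI completely_metrizable_space_euclidean) (simp_all add: sets_borel)
qed simp

context moment_constraint
begin

lemma measurable_hist_N:
  assumes f: "f \<in> hist_space M t \<rightarrow>\<^sub>M K"
  shows "f \<in> hist_space N t \<rightarrow>\<^sub>M K"
proof -
  have id: "(\<lambda>h. h) \<in> hist_space N t \<rightarrow>\<^sub>M hist_space M t"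
    unfolding hist_space_def[of M]
  proof (rule measurable_PiM_single')
    fix i assume "i \<in> {0..<t}"
    then have "(\<lambda>h. h i) \<in> hist_space N t \<rightarrow>\<^sub>M N" by (intro measurable_hist_component) simp
    from measurable_compose[OF this measurable_restrict_space1[OF measurable_ident_sets[OF refl]]]
    show "(\<lambda>h. h i) \<in> hist_space N t \<rightarrow>\<^sub>M M" .
  next
    show "(\<lambda>h. h) \<in> space (hist_space N t) \<rightarrow> {0..<t} \<rightarrow>\<^sub>E space M"
      by (rule Pi_I) (unfold space_hist_N, erule subsetD[OF PiE_mono[OF D_subset]])
  qed
  from measurable_compose[OF this f] show ?thesis .
qed

text \<open>
  Finite strategies as points of a single measurable space: of the two sequences only the first \<open>n\<close>
  members count, \<open>n\<close> being recorded separately.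
\<close>

definition params :: "((nat \<Rightarrow> real) \<times> (nat \<Rightarrow> 'a)) measure" where
  "params = PiM UNIV (\<lambda>_. borel) \<Otimes>\<^sub>M PiM UNIV (\<lambda>_. N)"

lemma space_params: "space params = UNIV \<times> (UNIV \<rightarrow> D)"
  unfolding params_def space_pair_measure space_PiM space_N space_borel PiE_UNIV_domain Pi_UNIV ..

lemma measurable_params_weight: "(\<lambda>q. fst q i) \<in> borel_measurable params"
  unfolding params_def by (rule measurable_compose[OF measurable_fst measurable_component_singleton[OF UNIV_I]])

lemma measurable_params_point: "(\<lambda>q. snd q i) \<in> params \<rightarrow>\<^sub>M N"
  unfolding params_def by (rule measurable_compose[OF measurable_snd measurable_component_singleton[OF UNIV_I]])

definition feasible :: "nat \<Rightarrow> (nat \<Rightarrow> real) \<times> (nat \<Rightarrow> 'a) \<Rightarrow> bool" where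
  "feasible n q \<longleftrightarrow> simplex_weights n (fst q) \<and> (\<Sum>i<n. fst q i *\<^sub>R \<Phi> (snd q i)) \<in> rel_interior means"

text \<open>A relative interior is open relative to an affine hull, which is closed. Thus
  feasibility is a Borel condition although \<open>means\<close> need not be Borel.\<close>

lemma rel_interior_borel: "rel_interior (X :: (real ^ 'm) set) \<in> sets borel"
proof -
  obtain U where "open U" "rel_interior X = affine hull X \<inter> U"
    using openin_rel_interior[of X] unfolding openin_open by blast
  then show ?thesis by (metis borel_closed borel_open closed_affine_hull sets.Int)
qed

lemma measurable_feasible: "Measurable.pred params (feasible n)"
proof -
  have \<Phi>N: "\<Phi> \<in> N \<rightarrow>\<^sub>M borel" by (rule measurable_restrict_space1[OF measurable_\<Phi>])
  have m: "(\<lambda>q. \<Sum>i<n. fst q i *\<^sub>R \<Phi> (snd q i)) \<in> params \<rightarrow>\<^sub>M borel"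
    by (intro borel_measurable_sum borel_measurable_scaleR measurable_params_weight
        measurable_compose[OF measurable_params_point \<Phi>N])
  have "{q \<in> space params. (\<Sum>i<n. fst q i *\<^sub>R \<Phi> (snd q i)) \<in> rel_interior means} \<in> sets params"
    using pred_sets2[OF rel_interior_borel m] unfolding pred_def .
  moreover have "{q \<in> space params. \<forall>i\<in>{..<n}. 0 \<le> fst q i} \<in> sets params"
    by (intro sets.sets_Collect_finite_All borel_measurable_le borel_measurable_const measurable_params_weight) simp
  moreover have "{q \<in> space params. (\<Sum>i<n. fst q i) = 1} \<in> sets params"
    by (intro borel_measurable_eq borel_measurable_sum borel_measurable_const measurable_params_weight)
  moreover have "{q \<in> space params. feasible n q} =
      {q \<in> space params. \<forall>i\<in>{..<n}. 0 \<le> fst q i} \<inter> {q \<in> space params. (\<Sum>i<n. fst q i) = 1} \<inter>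
      {q \<in> space params. (\<Sum>i<n. fst q i *\<^sub>R \<Phi> (snd q i)) \<in> rel_interior means}"
    unfolding feasible_def simplex_weights_def by blast
  ultimately show ?thesis unfolding pred_def by (simp only: sets.Int)
qed

definition gamble :: "nat \<Rightarrow> (nat \<Rightarrow> real) \<times> (nat \<Rightarrow> 'a) \<Rightarrow> ('a \<Rightarrow> ennreal) \<Rightarrow> ennreal" where
  "gamble n q f = (\<Sum>i<n. ennreal (fst q i) * f (snd q i))"

lemma params_mem: "q \<in> space params \<Longrightarrow> snd q i \<in> D"
  unfolding space_params mem_Times_iff by blast

lemma gamble_mono: "(\<And>y. y \<in> D \<Longrightarrow> f y \<le> g y) \<Longrightarrow> q \<in> space params \<Longrightarrow> gamble n q f \<le> gamble n q g"
  unfolding gamble_def by (intro sum_mono mult_left_mono) (simp_all add: params_mem)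

lemma gamble_const:
  assumes "feasible n q"
  shows "gamble n q (\<lambda>_. c) = c"
proof -
  have "gamble n q (\<lambda>_. c) = (\<Sum>i<n. ennreal (fst q i)) * c"
    unfolding gamble_def by (rule sum_distrib_right[symmetric])
  also have "(\<Sum>i<n. ennreal (fst q i)) = ennreal (\<Sum>i<n. fst q i)"
    using assms unfolding feasible_def simplex_weights_def by (intro sum_ennreal) auto
  finally show ?thesis using assms unfolding feasible_def simplex_weights_def by simp
qed

lemma feasible_through:
  assumes "y \<in> D"
  obtains n q where "q \<in> space params" "feasible n q" "0 < n" "snd q 0 = y" "0 < fst q 0"
proof -
  obtain n p z where z: "(n, p, z) \<in> finite_strategies" "0 < n" "z 0 = y" "0 < p 0"
    using finite_strategy_through[OF assms] .
  define z' where "z' i = (if i < n then z i else y)" for i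
  have "(p, z') \<in> space params"
    unfolding space_params using z(1) assms by (auto simp: finite_strategies_def z'_def)
  moreover have "feasible n (p, z')"
    using z(1) unfolding feasible_def finite_strategies_def by (simp add: z'_def)
  ultimately show thesis by (rule that) (use z in \<open>simp_all add: z'_def\<close>)
qed

lemma duality_params:
  assumes D: "D \<noteq> {}"
    and le: "\<And>n q. q \<in> space params \<Longrightarrow> feasible n q \<Longrightarrow> gamble n q f \<le> 1"
  shows "\<exists>l\<in>bets. \<forall>x\<in>D. \<forall>s\<in>means. f x \<le> ennreal (1 + l \<bullet> (\<Phi> x - s))"
proof (rule one_step_duality[OF D])
  fix n p z assume z: "(n, p, z) \<in> finite_strategies"
  obtain y where y: "y \<in> D" using D by auto
  \<comment> \<open>Places from \<open>n\<close> on are filled with an arbitrary point of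
    \<open>D\<close>, to obtain an element of \<open>params\<close>.\<close>
  define z' where "z' i = (if i < n then z i else y)" for i
  have "(p, z') \<in> space params"
    unfolding space_params using z y by (auto simp: finite_strategies_def z'_def)
  moreover have "feasible n (p, z')"
    using z unfolding feasible_def finite_strategies_def by (simp add: z'_def)
  ultimately have "gamble n (p, z') f \<le> 1" by (rule le)
  then show "(\<Sum>i<n. ennreal (p i) * f (z i)) \<le> 1" unfolding gamble_def by (simp add: z'_def)
qed

subsection \<open>The truncated Snell envelope\<close>

text \<open>
  \<open>env c E k t h\<close> is the value of stopping \<open>min E c\<close> optimally within the next \<open>k\<close> observations
  after the history \<open>h\<close> when nature chooses the most favourable finite strategy. Truncation at \<open>c\<close> makes
  almost optimal strategies available.
\<close>

primrec env :: "ennreal \<Rightarrow> (nat \<Rightarrow> (nat \<Rightarrow> 'a) \<Rightarrow> ennreal) \<Rightarrow> nat \<Rightarrow> nat \<Rightarrow> (nat \<Rightarrow> 'a) \<Rightarrow> ennreal" where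
  "env c E 0 = (\<lambda>t h. min (E t h) c)"
| "env c E (Suc k) = (\<lambda>t h. max (min (E t h) c)
     (SUP n. SUP q\<in>{q \<in> space params. feasible n q}. gamble n q (\<lambda>y. env c E k (Suc t) (h(t := y)))))"

lemma hist_upd_N:
  "h \<in> {0..<t} \<rightarrow>\<^sub>E D \<Longrightarrow> y \<in> D \<Longrightarrow> h(t := y) \<in> {0..<Suc t} \<rightarrow>\<^sub>E D"
  using PiE_fun_upd[of y "\<lambda>_. D" t h "{0..<t}"] by (simp only: atLeastLessThanSuc le0 if_True)

lemma hist_Suc_N:
  assumes "x \<in> {0..<Suc t} \<rightarrow>\<^sub>E D"
  shows "restrict x {0..<t} \<in> {0..<t} \<rightarrow>\<^sub>E D" "x t \<in> D" "(restrict x {0..<t})(t := x t) = x"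
proof -
  show "restrict x {0..<t} \<in> {0..<t} \<rightarrow>\<^sub>E D" using assms by (auto simp: PiE_iff)
  show "x t \<in> D" using assms by (auto simp: PiE_iff)
  show "(restrict x {0..<t})(t := x t) = x"
  proof
    fix i
    show "((restrict x {0..<t})(t := x t)) i = x i"
    proof (cases "i < Suc t")
      case True
      then show ?thesis by (cases "i = t") simp_all
    next
      case False
      then have "x i = undefined" by (intro PiE_arb[OF assms]) simp
      then show ?thesis using False by simp
    qed
  qed
qed

lemma env_Suc:
  "env c E (Suc k) t h = max (min (E t h) c)
     (SUP n. SUP q\<in>{q \<in> space params. feasible n q}. gamble n q (\<lambda>y. env c E k (Suc t) (h(t := y))))"
  by (simp only: env.simps)

lemma env_le:
  "env c E k t h \<le> c"
proof (induction k arbitrary: t h)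
  case (Suc k)
  have "gamble n q (\<lambda>y. env c E k (Suc t) (h(t := y))) \<le> c" if "q \<in> space params" "feasible n q" for n q
    using gamble_mono[OF Suc.IH that(1), of n] gamble_const[OF that(2), of c] by simp
  then show ?case by (simp only: env.simps) (intro max.boundedI SUP_least min.cobounded2, blast)
qed simp

lemma env_ge_gamble:
  assumes "q \<in> space params" "feasible n q"
  shows "gamble n q (\<lambda>y. env c E k (Suc t) (h(t := y))) \<le> env c E (Suc k) t h"
proof -
  have "gamble n q (\<lambda>y. env c E k (Suc t) (h(t := y))) \<le>
      (SUP n. SUP q\<in>{q \<in> space params. feasible n q}. gamble n q (\<lambda>y. env c E k (Suc t) (h(t := y))))"
    using assms by (intro SUP_upper2[of n] SUP_upper2[of q] order_refl) auto
  also have "\<dots> \<le> env c E (Suc k) t h" unfolding env.simps by (rule max.cobounded2)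
  finally show ?thesis .
qed

lemma env_mono_cap: "c \<le> c' \<Longrightarrow> env c E k t h \<le> env c' E k t h"
proof (induction k arbitrary: t h)
  case 0
  then show ?case unfolding env.simps by (intro min.mono order_refl)
next
  case (Suc k)
  show ?case
    unfolding env_Suc
    by (intro max.mono min.mono order_refl Suc.prems SUP_mono' SUP_subset_mono[OF subset_refl] gamble_mono Suc.IH) blast
qed

lemma env_mono_horizon: "env c E k t h \<le> env c E (Suc k) t h"
proof (induction k arbitrary: t h)
  case 0
  then show ?case unfolding env.simps by (rule max.cobounded1)
next
  case (Suc k)
  show ?case
    unfolding env_Suc[of c E k t h] env_Suc[of c E "Suc k" t h]
    by (intro max.mono order_refl SUP_mono' SUP_subset_mono[OF subset_refl] gamble_mono Suc.IH) blast
qed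

text \<open>Cap and horizon grow together, so a single increasing sequence reaches the unbounded
  value.\<close>

definition envelope :: "(nat \<Rightarrow> (nat \<Rightarrow> 'a) \<Rightarrow> ennreal) \<Rightarrow> nat \<Rightarrow> (nat \<Rightarrow> 'a) \<Rightarrow> ennreal" where
  "envelope E t h = (SUP n. env (of_nat n) E n t h)"

lemma envelope_ge: "E t h \<le> envelope E t h"
proof -
  have "E t h = (SUP n. min (E t h) (of_nat n))"
    by (simp add: inf_SUP[symmetric] inf_min[symmetric] ennreal_SUP_of_nat_eq_top flip: inf_min)
  also have "\<dots> \<le> envelope E t h"
    unfolding envelope_def
  proof (rule SUP_mono')
    fix n
    show "min (E t h) (of_nat n) \<le> env (of_nat n) E n t h" by (cases n) simp_all
  qed
  finally show ?thesis .
qed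

lemma env_diag_mono: "incseq (\<lambda>n. env (of_nat n) E n t h)"
proof (rule incseq_SucI)
  fix n
  have "env (of_nat n) E n t h \<le> env (of_nat (Suc n)) E n t h" by (rule env_mono_cap) simp
  also have "\<dots> \<le> env (of_nat (Suc n)) E (Suc n) t h" by (rule env_mono_horizon)
  finally show "env (of_nat n) E n t h \<le> env (of_nat (Suc n)) E (Suc n) t h" .
qed

text \<open>The supermartingale property against all strategies of nature. The diagonal is
  increasing, so its supremum commutes with the finite sum; one observation followed by horizon
  \<open>k\<close> is covered by horizon \<open>k + 1\<close>.\<close>

lemma envelope_gamble:
  assumes "q \<in> space params" "feasible n q"
  shows "gamble n q (\<lambda>y. envelope E (Suc t) (h(t := y))) \<le> envelope E t h"
proof -
  have "gamble n q (\<lambda>y. envelope E (Suc t) (h(t := y))) =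
      (\<Sum>i<n. SUP k. ennreal (fst q i) * env (of_nat k) E k (Suc t) (h(t := snd q i)))"
    unfolding gamble_def envelope_def by (simp only: SUP_mult_left_ennreal)
  also have "\<dots> = (SUP k. \<Sum>i<n. ennreal (fst q i) * env (of_nat k) E k (Suc t) (h(t := snd q i)))"
  proof (rule ennreal_SUP_sum[symmetric])
    fix i
    show "incseq (\<lambda>k. ennreal (fst q i) * env (of_nat k) E k (Suc t) (h(t := snd q i)))"
      by (intro incseq_SucI mult_left_mono incseq_SucD[OF env_diag_mono]) simp
  qed
  also have "\<dots> \<le> envelope E t h"
  proof (rule SUP_least)
    fix k
    have "(\<Sum>i<n. ennreal (fst q i) * env (of_nat k) E k (Suc t) (h(t := snd q i))) \<le> env (of_nat k) E (Suc k) t h"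
      using env_ge_gamble[OF assms, of "of_nat k" E k t h] unfolding gamble_def .
    also have "\<dots> \<le> env (of_nat (Suc k)) E (Suc k) t h" by (rule env_mono_cap) simp
    also have "\<dots> \<le> envelope E t h" unfolding envelope_def by (rule SUP_upper) simp
    finally show "(\<Sum>i<n. ennreal (fst q i) * env (of_nat k) E k (Suc t) (h(t := snd q i))) \<le> envelope E t h" .
  qed
  finally show ?thesis .
qed

lemma coded_N: "coded M \<Longrightarrow> D \<noteq> {} \<Longrightarrow> coded N"
  by (rule coded_restrict_space[OF _ D_nonempty(1)])

lemma coded_params:
  assumes "coded M" "D \<noteq> {}"
  shows "coded params"
  unfolding params_def by (intro coded_pair coded_PiM coded_borel_real coded_N assms)

text \<open>Each further step of the horizon takes a supremum over the coded space
  \<open>params\<close> under a Borel constraint, which keeps the value upper semianalytic.\<close>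

lemma usa_env:
  assumes M: "coded M" and D: "D \<noteq> {}" and E: "nonneg_process M E"
  shows "usa (hist_space N t) (env c E k t)"
proof -
  have Em: "(\<lambda>h. min (E t h) c) \<in> borel_measurable (hist_space N t)" for t
  proof (rule borel_measurable_min)
    show "E t \<in> borel_measurable (hist_space N t)"
      by (rule measurable_hist_N) (use E in \<open>unfold nonneg_process_def, blast\<close>)
  qed (rule borel_measurable_const)
  show ?thesis
  proof (induction k arbitrary: t)
    case 0
    show ?case unfolding env.simps by (rule usa_measurable[OF Em])
  next
    case (Suc k)
    let ?Z = "hist_space N t"
    have "usa (?Z \<Otimes>\<^sub>M params) (\<lambda>x. gamble n (snd x) (\<lambda>y. env c E k (Suc t) ((fst x)(t := y))))" for n
      unfolding gamble_def
    proof (intro usa_sum usa_cmult)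
      fix i
      have "(\<lambda>x. (\<lambda>(h, y). h(t := y)) (fst x, snd (snd x) i)) \<in> ?Z \<Otimes>\<^sub>M params \<rightarrow>\<^sub>M hist_space N (Suc t)"
        by (rule measurable_compose[OF measurable_Pair[OF measurable_fst
              measurable_compose[OF measurable_snd measurable_params_point]] measurable_hist_upd])
      then have "(\<lambda>x. (fst x)(t := snd (snd x) i)) \<in> ?Z \<Otimes>\<^sub>M params \<rightarrow>\<^sub>M hist_space N (Suc t)"
        by (simp only: split_conv)
      from usa_compose[OF Suc.IH this]
      show "usa (?Z \<Otimes>\<^sub>M params) (\<lambda>x. env c E k (Suc t) ((fst x)(t := snd (snd x) i)))" .
      show "(\<lambda>x. ennreal (fst (snd x) i)) \<in> borel_measurable (?Z \<Otimes>\<^sub>M params)"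
        by (intro measurable_compose[OF _ measurable_ennreal] measurable_compose[OF measurable_snd measurable_params_weight])
    qed
    moreover have "analytic (?Z \<Otimes>\<^sub>M params) (\<lambda>x. feasible n (snd x))" for n
      by (rule analytic_measurable) (rule measurable_compose[OF measurable_snd measurable_feasible])
    ultimately have "usa ?Z (\<lambda>h. SUP q\<in>{q \<in> space params. feasible n (snd (h, q))}.
        gamble n (snd (h, q)) (\<lambda>y. env c E k (Suc t) ((fst (h, q))(t := y))))" for n
      by (rule usa_SUP_proj[OF coded_params[OF M D]])
    then have "usa ?Z (\<lambda>h. SUP n. SUP q\<in>{q \<in> space params. feasible n q}.
        gamble n q (\<lambda>y. env c E k (Suc t) (h(t := y))))"
      unfolding fst_conv snd_conv by (rule usa_SUP_nat)
    then show ?case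
      unfolding env.simps by (rule usa_max[OF usa_measurable[OF Em]])
  qed
qed

lemma usa_envelope:
  assumes "coded M" "D \<noteq> {}" "nonneg_process M E"
  shows "usa (hist_space N t) (envelope E t)"
  unfolding envelope_def[abs_def] by (intro usa_SUP_nat usa_env assms)

text \<open>The bet is chosen relative to a Borel majorant \<open>G\<close> of the envelope. Divided
  by \<open>G h\<close>, the envelope after the next observation has value at most 1 under every
  strategy; duality gives a good bet for each history and \<open>bet_selection\<close> makes the
  choice Borel.\<close>

lemma envelope_selection:
  assumes M: "coded M" and D: "D \<noteq> {}" and E: "nonneg_process M E"
    and G: "G \<in> borel_measurable (hist_space N t)"
    and le: "\<And>h. h \<in> {0..<t} \<rightarrow>\<^sub>E D \<Longrightarrow> envelope E t h \<le> G h"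
    and fin: "\<And>h. h \<in> {0..<t} \<rightarrow>\<^sub>E D \<Longrightarrow> G h < \<top>"
  obtains l where "l \<in> hist_space N t \<rightarrow>\<^sub>M borel" "\<And>h. h \<in> {0..<t} \<rightarrow>\<^sub>E D \<Longrightarrow> l h \<in> bets"
    "\<And>h y. h \<in> {0..<t} \<rightarrow>\<^sub>E D \<Longrightarrow> y \<in> D \<Longrightarrow> envelope E (Suc t) (h(t := y)) \<le> G h * e_var M \<Phi> S (l h) y"
proof -
  let ?Z = "hist_space N t"
  \<comment> \<open>The value 0 at \<open>G h = 0\<close> avoids an infinite inverse; such histories
    then put no constraint beyond membership in \<open>bets\<close> and are treated separately
    below.\<close>
  define r where "r h = (if G h = 0 then 0 else inverse (G h))" for h
  define u where "u x = r (fst x) * envelope E (Suc t) ((fst x)(t := snd x))" for x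
  have r: "r \<in> borel_measurable ?Z"
    unfolding r_def
    by (rule measurable_If[OF borel_measurable_const borel_measurable_inverse_ennreal[OF G]
          borel_measurable_eq[OF G borel_measurable_const]])
  have r_le: "r h * G h \<le> 1" if "h \<in> {0..<t} \<rightarrow>\<^sub>E D" for h
    unfolding r_def by (cases "G h = 0") (simp_all add: ennreal_inverse_mult_self[OF _ fin[OF that]])
  have upd: "(\<lambda>x. (fst x)(t := snd x)) \<in> ?Z \<Otimes>\<^sub>M N \<rightarrow>\<^sub>M hist_space N (Suc t)"
    using measurable_hist_upd[of t N] unfolding case_prod_beta' .
  have u1: "usa (?Z \<Otimes>\<^sub>M N) (\<lambda>x. envelope E (Suc t) ((fst x)(t := snd x)))"
    by (rule usa_compose[OF usa_envelope[OF M D E] upd])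
  have u: "usa (?Z \<Otimes>\<^sub>M N) u"
    unfolding u_def[abs_def] by (rule usa_cmult[OF u1 measurable_compose[OF measurable_fst r]])
  have gamble_u: "gamble n q (\<lambda>y. u (h, y)) \<le> 1"
    if h: "h \<in> {0..<t} \<rightarrow>\<^sub>E D" and q: "q \<in> space params" "feasible n q" for h n q
  proof -
    have "gamble n q (\<lambda>y. u (h, y)) = r h * gamble n q (\<lambda>y. envelope E (Suc t) (h(t := y)))"
        unfolding gamble_def u_def sum_distrib_left fst_conv snd_conv
      by (rule sum.cong[OF refl], rule mult.left_commute)
    also have "\<dots> \<le> r h * G h"
      by (intro mult_left_mono order_trans[OF envelope_gamble[OF q] le[OF h]]) simp
    also have "\<dots> \<le> 1" by (rule r_le[OF h])
    finally show ?thesis .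
  qed
  obtain l where l: "l \<in> ?Z \<rightarrow>\<^sub>M borel" "\<And>h. h \<in> space ?Z \<Longrightarrow> l h \<in> bets"
    "\<And>h y s. h \<in> space ?Z \<Longrightarrow> y \<in> space N \<Longrightarrow> s \<in> means \<Longrightarrow> u (h, y) \<le> ennreal (1 + l h \<bullet> (\<Phi> y - s))"
  proof (rule bet_selection[of ?Z N \<Phi> bets means u])
    show "coded ?Z" unfolding hist_space_def by (rule coded_PiM[OF coded_N[OF M D]])
    show "coded N" by (rule coded_N[OF M D])
    show "\<Phi> \<in> N \<rightarrow>\<^sub>M borel" by (rule measurable_restrict_space1[OF measurable_\<Phi>])
    show "compact bets" by (rule compact_bets[OF D])
    show "means \<noteq> {}" by (rule means_nonempty[OF D])
    show "usa (?Z \<Otimes>\<^sub>M N) u" by (rule u)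
    show "\<exists>l\<in>bets. \<forall>y\<in>space N. \<forall>s\<in>means. u (h, y) \<le> ennreal (1 + l \<bullet> (\<Phi> y - s))"
      if hZ: "h \<in> space ?Z" for h
    proof -
      have h: "h \<in> {0..<t} \<rightarrow>\<^sub>E D" using hZ by (simp only: space_hist_N)
      show ?thesis unfolding space_N by (rule duality_params[OF D gamble_u[OF h]])
    qed
    show "0 \<le> 1 + l \<bullet> (\<Phi> y - s)" if "l \<in> bets" "y \<in> space N" "s \<in> means" for l y s
      using that unfolding bets_def space_N by blast
  qed (rule that; assumption)
  show thesis
  proof (rule that[OF l(1)])
    fix h assume h: "h \<in> {0..<t} \<rightarrow>\<^sub>E D"
    then have hZ: "h \<in> space ?Z" by (simp only: space_hist_N)
    show lb: "l h \<in> bets" by (rule l(2)[OF hZ])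
    fix y assume y: "y \<in> D"
    let ?v = "envelope E (Suc t) (h(t := y))"
    show "?v \<le> G h * e_var M \<Phi> S (l h) y"
    proof (cases "G h = 0")
      case True
      \<comment> \<open>If \<open>G h = 0\<close>, no strategy earns anything, and since some
        strategy gives \<open>y\<close> positive weight, the envelope after \<open>y\<close>
        vanishes.\<close>
      obtain n q where q: "q \<in> space params" "feasible n q" "0 < n" "snd q 0 = y" "0 < fst q 0"
        using feasible_through[OF y] .
      have "ennreal (fst q 0) * envelope E (Suc t) (h(t := snd q 0)) \<le> gamble n q (\<lambda>y. envelope E (Suc t) (h(t := y)))"
        unfolding gamble_def using q(3) by (intro member_le_sum) simp_all
      also have "\<dots> \<le> G h" using envelope_gamble[OF q(1,2)] le[OF h] by (rule order_trans)
      finally have "ennreal (fst q 0) * ?v = 0" using True q(4) by simp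
      then have "?v = 0" using q(5) by simp
      then show ?thesis by simp
    next
      case False
      have "u (h, y) \<le> e_var M \<Phi> S (l h) y"
        by (rule e_var_ge[OF subsetD[OF bets_subset_Lambda lb] y], rule l(3)[OF hZ])
          (simp_all only: space_N y)
      then have "G h * (inverse (G h) * ?v) \<le> G h * e_var M \<Phi> S (l h) y"
        using False unfolding u_def r_def by (intro mult_left_mono) simp_all
      moreover have "G h * (inverse (G h) * ?v) = ?v"
        using ennreal_inverse_mult_self[OF False fin[OF h]]
        by (simp only: mult.assoc[symmetric] mult.commute[of "G h"] mult_1)
      ultimately show ?thesis by simp
    qed
  qed
qed

end

subsection \<open>Laws generated by finite strategies\<close>

definition cut :: "nat \<Rightarrow> (nat \<Rightarrow> 'a) \<Rightarrow> nat \<Rightarrow> 'a" where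
  "cut t \<omega> = restrict \<omega> {0..<t}"

lemma cut_cut: "s \<le> t \<Longrightarrow> cut s (cut t \<omega>) = cut s \<omega>"
  by (auto simp: cut_def restrict_def fun_eq_iff)

lemma cut_upd: "s \<le> t \<Longrightarrow> cut s (h(t := y)) = cut s h"
  by (auto simp: cut_def restrict_def fun_eq_iff)

lemma cut_0: "cut 0 \<omega> = (\<lambda>_. undefined)"
  by (simp add: cut_def restrict_def)

lemma cut_apply: "s < t \<Longrightarrow> cut t \<omega> s = \<omega> s"
  by (simp add: cut_def)

lemma measurable_path_cut: "cut t \<in> path_space M \<rightarrow>\<^sub>M hist_space M t"
  unfolding cut_def[abs_def] by (rule measurable_path_restrict)

lemma measurable_hist_cut: "s \<le> t \<Longrightarrow> cut s \<in> hist_space M t \<rightarrow>\<^sub>M hist_space M s"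
  unfolding cut_def[abs_def] by (rule measurable_hist_restrict)

lemma measurable_filtration_cut: "cut t \<in> nat_filtration M t \<rightarrow>\<^sub>M hist_space M t"
  unfolding cut_def[abs_def] by (rule measurable_nat_filtration_restrict)

lemma measurable_hist_upd_point:
  assumes "h \<in> space (hist_space M t)"
  shows "(\<lambda>y. h(t := y)) \<in> M \<rightarrow>\<^sub>M hist_space M (Suc t)"
  using measurable_compose[OF measurable_Pair[OF measurable_const[OF assms] measurable_ident_sets[OF refl]] measurable_hist_upd[of t M]]
  unfolding case_prod_beta' fst_conv snd_conv .

text \<open>Only finitely many values of \<open>g\<close> enter, so arbitrary choices on a finite
  set of histories are measurable.\<close>

lemma measurable_finite_modification:
  assumes fin: "finite A" and single: "\<And>a. a \<in> A \<Longrightarrow> {a} \<in> sets Z"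
    and g: "\<And>a. a \<in> A \<Longrightarrow> g a \<in> space K" and c: "c \<in> space K"
  shows "(\<lambda>z. if z \<in> A then g z else c) \<in> Z \<rightarrow>\<^sub>M K"
  using fin single g
proof (induction A)
  case empty
  show ?case unfolding empty_iff if_False by (rule measurable_const[OF c])
next
  case (insert a A)
  have eq: "(\<lambda>z. if z \<in> insert a A then g z else c) = (\<lambda>z. if z \<in> {a} then g a else if z \<in> A then g z else c)"
    by (rule ext) (metis insert_iff singletonD)
  have a: "{z \<in> space Z. z \<in> {a}} \<in> sets Z"
  proof -
    have "{z \<in> space Z. z \<in> {a}} = {a}"
      using sets.sets_into_space[OF insert.prems(1)[OF insertI1]] by (intro set_eqI) (metis (mono_tags) mem_Collect_eq singletonI subsetD singletonD)
    then show "{z \<in> space Z. z \<in> {a}} \<in> sets Z" using insert.prems(1)[OF insertI1] by (rule ssubst)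
  qed
  show ?case
    unfolding eq
  proof (rule measurable_If[OF _ _ a])
    show "(\<lambda>_. g a) \<in> Z \<rightarrow>\<^sub>M K" by (rule measurable_const[OF insert.prems(2)[OF insertI1]])
    show "(\<lambda>z. if z \<in> A then g z else c) \<in> Z \<rightarrow>\<^sub>M K"
      by (rule insert.IH) (rule insert.prems(1) insert.prems(2), erule insertI2)+
  qed
qed

text \<open>Extracts the one-step recursion from the projective limit: the law of the first
  \<open>t + 1\<close> observations is the law of the first \<open>t\<close> composed with the
  kernel at time \<open>t\<close>.\<close>

lemma Ionescu_Tulcea_path:
  assumes \<kappa>: "\<And>t. \<kappa> t \<in> hist_space M t \<rightarrow>\<^sub>M subprob_algebra M"
    and prob: "\<And>t h. h \<in> space (hist_space M t) \<Longrightarrow> prob_space (\<kappa> t h)"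
  obtains Q where "Q \<in> space (prob_algebra (path_space M))"
    "\<And>t f. f \<in> borel_measurable (hist_space M (Suc t)) \<Longrightarrow>
      (\<integral>\<^sup>+\<omega>. f (cut (Suc t) \<omega>) \<partial>Q) = (\<integral>\<^sup>+\<omega>. (\<integral>\<^sup>+y. f ((cut t \<omega>)(t := y)) \<partial>\<kappa> t (cut t \<omega>)) \<partial>Q)"
proof -
  interpret IT: Ionescu_Tulcea \<kappa> "\<lambda>_. M"
    by (rule Ionescu_Tulcea.intro[OF \<kappa>[unfolded hist_space_def] prob[unfolded hist_space_def]])
  let ?u = "\<lambda>_. undefined :: 'a"
  define Q where "Q = IT.PF.lim"
  have sets_Q: "sets Q = sets (path_space M)"
    unfolding Q_def path_space_def by (rule IT.PF.sets_lim)
  have up_to: "IT.up_to {0..<t} = t" for t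
  proof (rule antisym)
    show "IT.up_to {0..<t} \<le> t" using IT.up_to_iff_Ico[of "{0..<t}" t] by simp
    show "t \<le> IT.up_to {0..<t}" using IT.up_to_less[of "{0..<t}" "t - 1"] by (cases t) simp_all
  qed
  have u: "?u \<in> space (PiM {0..<0::nat} (\<lambda>_. M))" by (simp add: space_PiM)
  have law: "distr Q (hist_space M t) (cut t) = IT.C 0 t ?u" for t
  proof -
    have "distr Q (PiM {0..<t} (\<lambda>_. M)) (\<lambda>x. restrict x {0..<t}) = IT.CI {0..<t}"
      unfolding Q_def by (rule IT.distr_lim) simp
    also have "\<dots> = IT.C 0 t ?u"
      unfolding IT.CI_def up_to using IT.distr_C[OF order_refl u, of t] unfolding add_0 by (rule sym)
    finally show ?thesis unfolding hist_space_def cut_def[abs_def] .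
  qed
  have cut_Q: "cut t \<in> Q \<rightarrow>\<^sub>M hist_space M t" for t
    unfolding measurable_cong_sets[OF sets_Q refl] by (rule measurable_path_cut)
  have "prob_space (IT.C 0 0 ?u)" by (rule IT.prob_space_C[OF u])
  then have "prob_space Q" by (rule prob_space_distrD[OF cut_Q[of 0], unfolded law])
  then have Q_prob: "Q \<in> space (prob_algebra (path_space M))"
    using sets_Q by (simp add: space_prob_algebra)
  have law_int: "(\<integral>\<^sup>+\<omega>. f (cut t \<omega>) \<partial>Q) = (\<integral>\<^sup>+h. f h \<partial>IT.C 0 t ?u)"
    if "f \<in> borel_measurable (hist_space M t)" for f t
  proof -
    have "f \<in> borel_measurable (distr Q (hist_space M t) (cut t))"
      unfolding measurable_distr_eq1 by (rule that)
    from nn_integral_distr[OF cut_Q this] show ?thesis unfolding law by (rule sym)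
  qed
  have sets_C: "sets (IT.C 0 t ?u) = sets (hist_space M t)" for t
    using sets_distr[of Q "hist_space M t" "cut t"] unfolding law .
  have eP: "IT.eP t \<in> hist_space M t \<rightarrow>\<^sub>M subprob_algebra (hist_space M (Suc t))" for t
    unfolding hist_space_def by (rule IT.measurable_eP)
  show thesis
  proof (rule that[OF Q_prob])
    fix t and f :: "(nat \<Rightarrow> 'a) \<Rightarrow> ennreal"
    assume f: "f \<in> borel_measurable (hist_space M (Suc t))"
    have eP_C: "IT.eP t \<in> IT.C 0 t ?u \<rightarrow>\<^sub>M subprob_algebra (hist_space M (Suc t))"
      unfolding measurable_cong_sets[OF sets_C refl] by (rule eP)
    have "(\<integral>\<^sup>+\<omega>. f (cut (Suc t) \<omega>) \<partial>Q) = (\<integral>\<^sup>+h. f h \<partial>IT.C 0 (Suc t) ?u)" by (rule law_int[OF f])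
    also have "\<dots> = (\<integral>\<^sup>+h. f h \<partial>(IT.C 0 t ?u \<bind> IT.eP t))" by (simp only: IT.C.simps add_0)
    also have "\<dots> = (\<integral>\<^sup>+h. (\<integral>\<^sup>+x. f x \<partial>IT.eP t h) \<partial>IT.C 0 t ?u)"
      by (rule nn_integral_bind[OF f eP_C])
    also have "\<dots> = (\<integral>\<^sup>+\<omega>. (\<integral>\<^sup>+x. f x \<partial>IT.eP t (cut t \<omega>)) \<partial>Q)"
      using law_int[OF measurable_compose[OF eP nn_integral_measurable_subprob_algebra[OF f]]] by (rule sym)
    also have "\<dots> = (\<integral>\<^sup>+\<omega>. (\<integral>\<^sup>+y. f ((cut t \<omega>)(t := y)) \<partial>\<kappa> t (cut t \<omega>)) \<partial>Q)"
    proof (rule nn_integral_cong)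
      fix \<omega> assume "\<omega> \<in> space Q"
      then have h: "cut t \<omega> \<in> space (hist_space M t)" by (rule measurable_space[OF cut_Q])
      show "(\<integral>\<^sup>+x. f x \<partial>IT.eP t (cut t \<omega>)) = (\<integral>\<^sup>+y. f ((cut t \<omega>)(t := y)) \<partial>\<kappa> t (cut t \<omega>))"
        using IT.nn_integral_eP[OF h[unfolded hist_space_def] f[unfolded hist_space_def]] .
    qed
    finally show "(\<integral>\<^sup>+\<omega>. f (cut (Suc t) \<omega>) \<partial>Q) = (\<integral>\<^sup>+\<omega>. (\<integral>\<^sup>+y. f ((cut t \<omega>)(t := y)) \<partial>\<kappa> t (cut t \<omega>)) \<partial>Q)" .
  qed
qed

context moment_constraint
begin

definition strategy :: "nat \<times> (nat \<Rightarrow> real) \<times> (nat \<Rightarrow> 'a) \<Rightarrow> bool" where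
  "strategy s \<longleftrightarrow> snd s \<in> space params \<and> feasible (fst s) (snd s)"

definition strategy_dist :: "nat \<times> (nat \<Rightarrow> real) \<times> (nat \<Rightarrow> 'a) \<Rightarrow> 'a measure" where
  "strategy_dist s = fin_dist M (fst s) (fst (snd s)) (snd (snd s))"

definition strategy_mean :: "nat \<times> (nat \<Rightarrow> real) \<times> (nat \<Rightarrow> 'a) \<Rightarrow> ('a \<Rightarrow> 'v::real_vector) \<Rightarrow> 'v" where
  "strategy_mean s f = (\<Sum>i<fst s. fst (snd s) i *\<^sub>R f (snd (snd s) i))"

lemma strategyD:
  assumes "strategy s"
  shows "simplex_weights (fst s) (fst (snd s))" "snd (snd s) i \<in> D" "snd (snd s) i \<in> space M"
    "strategy_mean s \<Phi> \<in> rel_interior means" "0 \<le> fst (snd s) i \<or> fst s \<le> i"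
proof -
  show "snd (snd s) i \<in> D" using assms unfolding strategy_def by (intro params_mem) blast
  then show "snd (snd s) i \<in> space M" using D_subset by blast
  show *: "simplex_weights (fst s) (fst (snd s))" "strategy_mean s \<Phi> \<in> rel_interior means"
    using assms unfolding strategy_def feasible_def strategy_mean_def by blast+
  show "0 \<le> fst (snd s) i \<or> fst s \<le> i" using *(1) unfolding simplex_weights_def by (meson not_le)
qed

lemma prob_space_strategy_dist: "strategy s \<Longrightarrow> prob_space (strategy_dist s)"
  unfolding strategy_dist_def by (rule prob_space_fin_dist[OF strategyD(1) strategyD(3)])

lemma nn_integral_strategy_dist:
  "strategy s \<Longrightarrow> f \<in> borel_measurable M \<Longrightarrow> (\<integral>\<^sup>+y. f y \<partial>strategy_dist s) = gamble (fst s) (snd s) f"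
  unfolding strategy_dist_def gamble_def by (rule nn_integral_fin_dist[OF strategyD(1) strategyD(3)])

lemma gamble_strategy_mean:
  assumes "strategy s" "\<And>y. 0 \<le> f y"
  shows "gamble (fst s) (snd s) (\<lambda>y. ennreal (f y)) = ennreal (strategy_mean s f)"
proof -
  have p: "0 \<le> fst (snd s) i" if "i < fst s" for i
    using strategyD(1)[OF assms(1)] that unfolding simplex_weights_def by blast
  have "gamble (fst s) (snd s) (\<lambda>y. ennreal (f y)) = (\<Sum>i<fst s. ennreal (fst (snd s) i * f (snd (snd s) i)))"
    unfolding gamble_def by (intro sum.cong refl) (simp add: ennreal_mult p assms(2))
  also have "\<dots> = ennreal (\<Sum>i<fst s. fst (snd s) i * f (snd (snd s) i))"
    by (intro sum_ennreal) (simp add: p assms(2))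
  finally show ?thesis by (simp add: strategy_mean_def)
qed

lemma strategy_mean_nonneg:
  assumes "strategy s" "\<And>y. 0 \<le> f y"
  shows "0 \<le> (strategy_mean s f :: real)"
  unfolding strategy_mean_def
proof (rule sum_nonneg)
  fix i assume "i \<in> {..<fst s}"
  then have "0 \<le> fst (snd s) i" using strategyD(1)[OF assms(1)] unfolding simplex_weights_def by blast
  then show "0 \<le> fst (snd s) i *\<^sub>R f (snd (snd s) i)" using assms(2) by simp
qed

text \<open>With one fixed strategy \<open>s0\<close> outside the finite set \<open>R t\<close>, the
  plan is a finite modification of a constant kernel and hence measurable, whatever the choices in
  \<open>ch\<close>.\<close>

lemma strategy_measure_ex:
  assumes M: "coded M" and fin: "\<And>t. finite (R t)" and R: "\<And>t. R t \<subseteq> space (hist_space M t)"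
    and ch: "\<And>t h. strategy (ch t h)" and s0: "strategy s0"
  defines "pl \<equiv> \<lambda>t h. if h \<in> R t then ch t h else s0"
  obtains Q where "Q \<in> space (prob_algebra (path_space M))"
    "\<And>t f. f \<in> borel_measurable (hist_space M (Suc t)) \<Longrightarrow>
      (\<integral>\<^sup>+\<omega>. f (cut (Suc t) \<omega>) \<partial>Q) = (\<integral>\<^sup>+\<omega>. gamble (fst (pl t (cut t \<omega>))) (snd (pl t (cut t \<omega>))) (\<lambda>y. f ((cut t \<omega>)(t := y))) \<partial>Q)"
proof -
  have pl: "strategy (pl t h)" for t h unfolding pl_def using ch s0 by simp
  have single: "{h} \<in> sets (hist_space M t)" if "h \<in> R t" for t h
    using coded_singleton[of "hist_space M t" h] coded_PiM[OF M] R that unfolding hist_space_def by blast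
  have sub: "strategy_dist s \<in> space (subprob_algebra M)" if "strategy s" for s
    using prob_space_imp_subprob_space[OF prob_space_strategy_dist[OF that]]
    unfolding space_subprob_algebra strategy_dist_def by simp
  have \<kappa>: "(\<lambda>h. if h \<in> R t then strategy_dist (ch t h) else strategy_dist s0) \<in> hist_space M t \<rightarrow>\<^sub>M subprob_algebra M" for t
    by (rule measurable_finite_modification[OF fin single sub[OF ch] sub[OF s0]])
  then have \<kappa>': "(\<lambda>h. strategy_dist (pl t h)) \<in> hist_space M t \<rightarrow>\<^sub>M subprob_algebra M" for t
    unfolding pl_def if_distrib[of strategy_dist] .
  obtain Q where Q: "Q \<in> space (prob_algebra (path_space M))"
    and step: "\<And>t f. f \<in> borel_measurable (hist_space M (Suc t)) \<Longrightarrow>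
      (\<integral>\<^sup>+\<omega>. f (cut (Suc t) \<omega>) \<partial>Q) = (\<integral>\<^sup>+\<omega>. (\<integral>\<^sup>+y. f ((cut t \<omega>)(t := y)) \<partial>strategy_dist (pl t (cut t \<omega>))) \<partial>Q)"
    using Ionescu_Tulcea_path[OF \<kappa>' prob_space_strategy_dist[OF pl]] by blast
  have sp: "space Q = space (path_space M)"
    using Q by (intro sets_eq_imp_space_eq) (simp add: space_prob_algebra)
  show thesis
  proof (rule that[OF Q])
    fix t and f :: "(nat \<Rightarrow> 'a) \<Rightarrow> ennreal"
    assume f: "f \<in> borel_measurable (hist_space M (Suc t))"
    show "(\<integral>\<^sup>+\<omega>. f (cut (Suc t) \<omega>) \<partial>Q) = (\<integral>\<^sup>+\<omega>. gamble (fst (pl t (cut t \<omega>))) (snd (pl t (cut t \<omega>))) (\<lambda>y. f ((cut t \<omega>)(t := y))) \<partial>Q)"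
      unfolding step[OF f]
    proof (rule nn_integral_cong)
      fix \<omega> assume "\<omega> \<in> space Q"
      then have "cut t \<omega> \<in> space (hist_space M t)" unfolding sp by (rule measurable_space[OF measurable_path_cut])
      from measurable_compose[OF measurable_hist_upd_point[OF this] f]
      show "(\<integral>\<^sup>+y. f ((cut t \<omega>)(t := y)) \<partial>strategy_dist (pl t (cut t \<omega>))) =
          gamble (fst (pl t (cut t \<omega>))) (snd (pl t (cut t \<omega>))) (\<lambda>y. f ((cut t \<omega>)(t := y)))"
        by (rule nn_integral_strategy_dist[OF pl])
    qed
  qed
qed

context
  fixes pl :: "nat \<Rightarrow> (nat \<Rightarrow> 'a) \<Rightarrow> nat \<times> (nat \<Rightarrow> real) \<times> (nat \<Rightarrow> 'a)" and Q :: "(nat \<Rightarrow> 'a) measure"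
  assumes pl: "\<And>t h. strategy (pl t h)" and pl_fin: "\<And>t. finite (range (pl t))"
    and mean_meas: "\<And>t (f :: 'a \<Rightarrow> real). (\<lambda>h. strategy_mean (pl t h) f) \<in> borel_measurable (hist_space M t)"
    and Q: "Q \<in> space (prob_algebra (path_space M))"
    and step: "\<And>t f. f \<in> borel_measurable (hist_space M (Suc t)) \<Longrightarrow>
      (\<integral>\<^sup>+\<omega>. f (cut (Suc t) \<omega>) \<partial>Q) = (\<integral>\<^sup>+\<omega>. gamble (fst (pl t (cut t \<omega>))) (snd (pl t (cut t \<omega>))) (\<lambda>y. f ((cut t \<omega>)(t := y))) \<partial>Q)"
begin

lemma strategy_law_prob: "prob_space Q" and strategy_law_sets: "sets Q = sets (path_space M)"
  using Q unfolding space_prob_algebra by blast+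

lemma strategy_law_component: "(\<lambda>\<omega>. \<omega> t) \<in> Q \<rightarrow>\<^sub>M M"
  unfolding measurable_cong_sets[OF strategy_law_sets refl] by (rule measurable_path_component)

lemma strategy_law_cut: "cut t \<in> Q \<rightarrow>\<^sub>M hist_space M t"
  unfolding measurable_cong_sets[OF strategy_law_sets refl] by (rule measurable_path_cut)

lemma strategy_mean_bound:
  fixes f :: "'a \<Rightarrow> real"
  obtains B where "\<And>h. strategy_mean (pl t h) f \<le> B"
proof -
  have "finite ((\<lambda>s. strategy_mean s f) ` range (pl t))" by (rule finite_imageI[OF pl_fin])
  then have "bdd_above ((\<lambda>s. strategy_mean s f) ` range (pl t))" by (rule bdd_above_finite)
  then obtain B where B: "\<And>x. x \<in> (\<lambda>s. strategy_mean s f) ` range (pl t) \<Longrightarrow> x \<le> B" by (auto simp: bdd_above_def)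
  show thesis by (rule that, rule B, rule imageI, rule rangeI)
qed

lemma strategy_law_step:
  fixes \<phi> :: "'a \<Rightarrow> real"
  assumes \<phi>: "\<phi> \<in> borel_measurable M" "\<And>y. 0 \<le> \<phi> y" and B: "B \<in> sets (hist_space M t)"
  shows "(\<integral>\<^sup>+\<omega>. indicator B (cut t \<omega>) * ennreal (\<phi> (\<omega> t)) \<partial>Q) =
    (\<integral>\<^sup>+\<omega>. indicator B (cut t \<omega>) * ennreal (strategy_mean (pl t (cut t \<omega>)) \<phi>) \<partial>Q)"
proof -
  let ?f = "\<lambda>h. indicator B (cut t h) * ennreal (\<phi> (h t))"
  have comp: "(\<lambda>h. h t) \<in> hist_space M (Suc t) \<rightarrow>\<^sub>M M" by (rule measurable_hist_component) simp
  have "cut t \<in> hist_space M (Suc t) \<rightarrow>\<^sub>M hist_space M t" by (rule measurable_hist_cut) simp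
  then have f: "?f \<in> borel_measurable (hist_space M (Suc t))"
    by (intro borel_measurable_times_ennreal measurable_compose[OF _ borel_measurable_indicator[OF B]]
        measurable_compose[OF measurable_compose[OF comp \<phi>(1)] measurable_ennreal])
  have 1: "?f (cut (Suc t) \<omega>) = indicator B (cut t \<omega>) * ennreal (\<phi> (\<omega> t))" for \<omega>
    by (simp add: cut_cut cut_apply)
  have 2: "gamble (fst (pl t (cut t \<omega>))) (snd (pl t (cut t \<omega>))) (\<lambda>y. ?f ((cut t \<omega>)(t := y))) =
      indicator B (cut t \<omega>) * ennreal (strategy_mean (pl t (cut t \<omega>)) \<phi>)" for \<omega>
  proof -
    have "gamble (fst (pl t (cut t \<omega>))) (snd (pl t (cut t \<omega>))) (\<lambda>y. ?f ((cut t \<omega>)(t := y))) =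
        indicator B (cut t \<omega>) * gamble (fst (pl t (cut t \<omega>))) (snd (pl t (cut t \<omega>))) (\<lambda>y. ennreal (\<phi> y))"
      unfolding gamble_def sum_distrib_left
      by (simp add: cut_upd cut_cut mult.left_commute)
    then show ?thesis unfolding gamble_strategy_mean[OF pl \<phi>(2)] .
  qed
  show ?thesis using step[OF f] unfolding 1 2 .
qed

lemma strategy_law_integrable:
  fixes \<phi> :: "'a \<Rightarrow> real"
  assumes \<phi>: "\<phi> \<in> borel_measurable M" "\<And>y. 0 \<le> \<phi> y"
  shows "integrable Q (\<lambda>\<omega>. \<phi> (\<omega> t))"
    "integrable Q (\<lambda>\<omega>. strategy_mean (pl t (cut t \<omega>)) \<phi>)"
proof -
  interpret prob_space Q by (rule strategy_law_prob)
  obtain B where B: "\<And>h. strategy_mean (pl t h) \<phi> \<le> B" using strategy_mean_bound[of t \<phi>] by blast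
  have m: "(\<lambda>\<omega>. strategy_mean (pl t (cut t \<omega>)) \<phi>) \<in> borel_measurable Q"
    by (rule measurable_compose[OF strategy_law_cut mean_meas])
  show "integrable Q (\<lambda>\<omega>. strategy_mean (pl t (cut t \<omega>)) \<phi>)"
  proof (rule integrable_const_bound[of _ B])
    have "norm (strategy_mean (pl t h) \<phi>) \<le> B" for h
      using strategy_mean_nonneg[OF pl \<phi>(2), of t h] B[of h] by simp
    then show "AE \<omega> in Q. norm (strategy_mean (pl t (cut t \<omega>)) \<phi>) \<le> B" by (rule AE_I2)
  qed (rule m)
  have "(\<integral>\<^sup>+\<omega>. ennreal (\<phi> (\<omega> t)) \<partial>Q) = (\<integral>\<^sup>+\<omega>. ennreal (strategy_mean (pl t (cut t \<omega>)) \<phi>) \<partial>Q)"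
  proof -
    have i: "indicator (space (hist_space M t)) (cut t \<omega>) * x = (x::ennreal)" if "\<omega> \<in> space Q" for \<omega> x
      using measurable_space[OF strategy_law_cut that] by simp
    have "(\<integral>\<^sup>+\<omega>. ennreal (\<phi> (\<omega> t)) \<partial>Q) = (\<integral>\<^sup>+\<omega>. indicator (space (hist_space M t)) (cut t \<omega>) * ennreal (\<phi> (\<omega> t)) \<partial>Q)"
      by (rule nn_integral_cong) (simp only: i)
    also have "\<dots> = (\<integral>\<^sup>+\<omega>. indicator (space (hist_space M t)) (cut t \<omega>) * ennreal (strategy_mean (pl t (cut t \<omega>)) \<phi>) \<partial>Q)"
      by (rule strategy_law_step[OF \<phi> sets.top])
    also have "\<dots> = (\<integral>\<^sup>+\<omega>. ennreal (strategy_mean (pl t (cut t \<omega>)) \<phi>) \<partial>Q)"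
      by (rule nn_integral_cong) (simp only: i)
    finally show ?thesis .
  qed
  also have "\<dots> \<le> (\<integral>\<^sup>+\<omega>. ennreal B \<partial>Q)" by (intro nn_integral_mono ennreal_leI B)
  also have "\<dots> < \<infinity>" by (simp add: emeasure_space_1)
  finally show "integrable Q (\<lambda>\<omega>. \<phi> (\<omega> t))"
    by (intro integrableI_nonneg measurable_compose[OF strategy_law_component \<phi>(1)] AE_I2 \<phi>(2))
qed

text \<open>For non-negative functions the defining identity of conditional expectation is the
  recursion of the law tested on events of the past. The signed case follows by splitting into
  positive and negative parts.\<close>

lemma strategy_law_cond_exp_nonneg:
  fixes \<phi> :: "'a \<Rightarrow> real"
  assumes \<phi>: "\<phi> \<in> borel_measurable M" "\<And>y. 0 \<le> \<phi> y"
  shows "AE \<omega> in Q. real_cond_exp Q (nat_filtration M t) (\<lambda>\<omega>. \<phi> (\<omega> t)) \<omega> = strategy_mean (pl t (cut t \<omega>)) \<phi>"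
proof -
  interpret prob_space Q by (rule strategy_law_prob)
  interpret finite_measure_subalgebra Q "nat_filtration M t"
    by unfold_locales (rule subalgebra_nat_filtration[OF strategy_law_sets])
  show ?thesis
  proof (rule real_cond_exp_charact)
    show "(\<lambda>\<omega>. strategy_mean (pl t (cut t \<omega>)) \<phi>) \<in> borel_measurable (nat_filtration M t)"
      by (rule measurable_compose[OF measurable_filtration_cut mean_meas])
  next
    fix A assume "A \<in> sets (nat_filtration M t)"
    then obtain B where B: "B \<in> sets (hist_space M t)"
      and A: "A = {\<omega> \<in> space (path_space M). restrict \<omega> {0..<t} \<in> B}"
      unfolding sets_nat_filtration by blast
    have ind: "(indicator A \<omega> :: real) = indicator B (cut t \<omega>)" if "\<omega> \<in> space Q" for \<omega>
      using that unfolding sets_eq_imp_space_eq[OF strategy_law_sets] A cut_def indicator_def by simp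
    have eq: "(LINT \<omega>:A|Q. u \<omega>) = enn2real (\<integral>\<^sup>+\<omega>. indicator B (cut t \<omega>) * ennreal (u \<omega>) \<partial>Q)"
      if u: "u \<in> borel_measurable Q" "\<And>\<omega>. 0 \<le> u \<omega>" for u
    proof -
      have "(LINT \<omega>:A|Q. u \<omega>) = (LINT \<omega>|Q. indicator B (cut t \<omega>) * u \<omega>)"
        unfolding set_lebesgue_integral_def by (rule Bochner_Integration.integral_cong[OF refl]) (simp add: ind)
      also have "\<dots> = enn2real (\<integral>\<^sup>+\<omega>. ennreal (indicator B (cut t \<omega>) * u \<omega>) \<partial>Q)"
        by (intro integral_eq_nn_integral AE_I2 borel_measurable_times u(1)
            measurable_compose[OF strategy_law_cut borel_measurable_indicator[OF B]] mult_nonneg_nonneg u(2)) simp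
      also have "(\<integral>\<^sup>+\<omega>. ennreal (indicator B (cut t \<omega>) * u \<omega>) \<partial>Q) = (\<integral>\<^sup>+\<omega>. indicator B (cut t \<omega>) * ennreal (u \<omega>) \<partial>Q)"
        by (intro nn_integral_cong) (simp add: indicator_def)
      finally show ?thesis .
    qed
    show "(LINT \<omega>:A|Q. \<phi> (\<omega> t)) = (LINT \<omega>:A|Q. strategy_mean (pl t (cut t \<omega>)) \<phi>)"
      unfolding eq[OF measurable_compose[OF strategy_law_component \<phi>(1)] \<phi>(2)]
        eq[OF measurable_compose[OF strategy_law_cut mean_meas] strategy_mean_nonneg[OF pl \<phi>(2)]]
      by (simp only: strategy_law_step[OF \<phi> B])
  qed (rule strategy_law_integrable[OF \<phi>])+
qed

lemma strategy_law_cond_exp: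
  fixes \<phi> :: "'a \<Rightarrow> real"
  assumes \<phi>: "\<phi> \<in> borel_measurable M"
  shows "AE \<omega> in Q. real_cond_exp Q (nat_filtration M t) (\<lambda>\<omega>. \<phi> (\<omega> t)) \<omega> = strategy_mean (pl t (cut t \<omega>)) \<phi>"
proof -
  interpret prob_space Q by (rule strategy_law_prob)
  interpret finite_measure_subalgebra Q "nat_filtration M t"
    by unfold_locales (rule subalgebra_nat_filtration[OF strategy_law_sets])
  have m: "(\<lambda>y. max 0 (\<phi> y)) \<in> borel_measurable M" "(\<lambda>y. max 0 (- \<phi> y)) \<in> borel_measurable M"
    by (intro borel_measurable_max borel_measurable_const borel_measurable_uminus \<phi>)+
  have split: "max 0 x - max 0 (- x) = x" for x :: real by simp
  have diff: "strategy_mean s (\<lambda>y. max 0 (\<phi> y)) - strategy_mean s (\<lambda>y. max 0 (- \<phi> y)) = strategy_mean s \<phi>" for s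
    unfolding strategy_mean_def sum_subtractf[symmetric] scaleR_diff_right[symmetric] split ..
  have "AE \<omega> in Q. real_cond_exp Q (nat_filtration M t) (\<lambda>\<omega>. max 0 (\<phi> (\<omega> t)) - max 0 (- \<phi> (\<omega> t))) \<omega> =
      real_cond_exp Q (nat_filtration M t) (\<lambda>\<omega>. max 0 (\<phi> (\<omega> t))) \<omega> -
      real_cond_exp Q (nat_filtration M t) (\<lambda>\<omega>. max 0 (- \<phi> (\<omega> t))) \<omega>"
    by (intro real_cond_exp_diff strategy_law_integrable m) simp_all
  moreover have "AE \<omega> in Q. real_cond_exp Q (nat_filtration M t) (\<lambda>\<omega>. max 0 (\<phi> (\<omega> t))) \<omega> = strategy_mean (pl t (cut t \<omega>)) (\<lambda>y. max 0 (\<phi> y))"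
    by (rule strategy_law_cond_exp_nonneg[OF m(1)]) simp
  moreover have "AE \<omega> in Q. real_cond_exp Q (nat_filtration M t) (\<lambda>\<omega>. max 0 (- \<phi> (\<omega> t))) \<omega> = strategy_mean (pl t (cut t \<omega>)) (\<lambda>y. max 0 (- \<phi> y))"
    by (rule strategy_law_cond_exp_nonneg[OF m(2)]) simp
  ultimately show ?thesis unfolding split by eventually_elim (simp only: diff)
qed

text \<open>The conditional mean is the mean of the strategy in force, which lies in the relative
  interior of \<open>means\<close>, hence in \<open>S\<close>. Integrability holds because each time
  uses only finitely many strategies.\<close>

lemma strategy_law_cond_hyp: "Q \<in> cond_hyp M \<Phi> S"
proof -
  have prob: "prob_space Q" by (rule strategy_law_prob)
  have sets: "sets Q = sets (path_space M)" by (rule strategy_law_sets)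
  have comp: "(\<lambda>v. v $ i) \<in> borel_measurable borel" for i :: 'm
    by (intro borel_measurable_continuous_onI continuous_intros)
  have \<Phi>i: "(\<lambda>y. \<Phi> y $ i) \<in> borel_measurable M" for i by (rule measurable_compose[OF measurable_\<Phi> comp])
  have int: "(\<integral>\<^sup>+\<omega>. ennreal (l1_norm (\<Phi> (\<omega> t))) \<partial>Q) < \<infinity>" for t
  proof -
    have m: "(\<lambda>y. l1_norm (\<Phi> y)) \<in> borel_measurable M"
      unfolding l1_norm_def by (rule borel_measurable_sum, rule borel_measurable_abs, rule \<Phi>i)
    have nn: "0 \<le> l1_norm (\<Phi> y)" for y unfolding l1_norm_def by (rule sum_nonneg) (rule abs_ge_zero)
    have "integrable Q (\<lambda>\<omega>. l1_norm (\<Phi> (\<omega> t)))" by (rule strategy_law_integrable(1)[OF m nn])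
    then have "(\<integral>\<^sup>+\<omega>. ennreal (norm (l1_norm (\<Phi> (\<omega> t)))) \<partial>Q) < \<infinity>"
      unfolding integrable_iff_bounded by (rule conjunct2)
    then show ?thesis unfolding real_norm_def abs_of_nonneg[OF nn] .
  qed
  have intv: "integrable Q (\<lambda>\<omega>. \<Phi> (\<omega> t))" for t
  proof (rule integrable_l1)
    show "(\<lambda>\<omega>. \<Phi> (\<omega> t)) \<in> borel_measurable Q" by (rule measurable_compose[OF strategy_law_component measurable_\<Phi>])
    show "(\<integral>\<^sup>+\<omega>. ennreal (l1_norm (\<Phi> (\<omega> t))) \<partial>Q) < \<infinity>" by (rule int)
  qed
  have mean: "AE \<omega> in Q. cond_mean M \<Phi> Q t \<omega> $ i = strategy_mean (pl t (cut t \<omega>)) \<Phi> $ i" for t i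
  proof -
    have comp: "strategy_mean s (\<lambda>y. \<Phi> y $ i) = strategy_mean s \<Phi> $ i" for s
      unfolding strategy_mean_def sum_component vector_scaleR_component real_scaleR_def ..
    have AE: "AE \<omega> in Q. real_cond_exp Q (nat_filtration M t) (\<lambda>\<omega>. \<Phi> (\<omega> t) $ i) \<omega> = strategy_mean (pl t (cut t \<omega>)) \<Phi> $ i"
      unfolding comp[symmetric] by (rule strategy_law_cond_exp[OF \<Phi>i])
    show ?thesis
    proof (cases "t = 0")
      case True
      have "(\<integral>\<omega>. \<Phi> (\<omega> t) \<partial>Q) $ i = (\<integral>\<omega>. \<Phi> (\<omega> t) $ i \<partial>Q)"
        by (rule integral_bounded_linear[OF bounded_linear_vec_nth intv, symmetric])
      moreover have "AE \<omega> in Q. real_cond_exp Q (nat_filtration M t) (\<lambda>\<omega>. \<Phi> (\<omega> t) $ i) \<omega> = (\<integral>\<omega>. \<Phi> (\<omega> t) $ i \<partial>Q)"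
        by (rule cond_exp_trivial[OF prob subalgebra_nat_filtration[OF sets] _ integrable_component[OF intv]])
          (use sets_nat_filtration_0 sets_eq_imp_space_eq[OF sets] True in auto)
      moreover have "cond_mean M \<Phi> Q t \<omega> = (\<integral>\<omega>. \<Phi> (\<omega> t) \<partial>Q)" for \<omega>
        unfolding cond_mean_def True by (simp only: if_True refl)
      ultimately have cm: "AE \<omega> in Q. real_cond_exp Q (nat_filtration M t) (\<lambda>\<omega>. \<Phi> (\<omega> t) $ i) \<omega> = cond_mean M \<Phi> Q t \<omega> $ i"
        by (simp only:)
      from cm AE show ?thesis by eventually_elim (rule trans[OF sym])
    next
      case False
      then have "cond_mean M \<Phi> Q t \<omega> $ i = real_cond_exp Q (nat_filtration M t) (\<lambda>\<omega>. \<Phi> (\<omega> t) $ i) \<omega>" for \<omega>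
        unfolding cond_mean_def by (simp only: if_False vec_lambda_beta)
      then show ?thesis using AE by (simp only:)
    qed
  qed
  have "AE \<omega> in Q. cond_mean M \<Phi> Q t \<omega> \<in> S" for t
  proof -
    have "AE \<omega> in Q. \<forall>i\<in>UNIV. cond_mean M \<Phi> Q t \<omega> $ i = strategy_mean (pl t (cut t \<omega>)) \<Phi> $ i"
      by (rule AE_finite_allI[OF finite mean])
    then show ?thesis
    proof eventually_elim
      case (elim \<omega>)
      then have "cond_mean M \<Phi> Q t \<omega> = strategy_mean (pl t (cut t \<omega>)) \<Phi>" by (simp add: vec_eq_iff)
      moreover have "strategy_mean (pl t (cut t \<omega>)) \<Phi> \<in> means"
        using strategyD(4)[OF pl] rel_interior_subset by blast
      ultimately show ?case unfolding means_def by simp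
    qed
  qed
  then have "AE \<omega> in Q. \<forall>t. cond_mean M \<Phi> Q t \<omega> \<in> S" unfolding AE_all_countable by blast
  then show ?thesis unfolding cond_hyp_def using Q int by blast
qed

end

section \<open>Almost optimal play and the initial value of the envelope\<close>

lemma near_optimal:
  assumes D: "D \<noteq> {}" and e: "0 < e"
    and fin: "(SUP n. SUP q\<in>{q \<in> space params. feasible n q}. gamble n q f) < \<top>"
  shows "\<exists>s. strategy s \<and> (SUP n. SUP q\<in>{q \<in> space params. feasible n q}. gamble n q f) \<le> gamble (fst s) (snd s) f + ennreal e"
proof -
  define V where "V = (SUP n. SUP q\<in>{q \<in> space params. feasible n q}. gamble n q f)"
  obtain v where v: "V = ennreal v" "0 \<le> v" using fin[folded V_def] by (cases V) auto
  obtain y where "y \<in> D" using D by blast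
  then obtain n q where q: "q \<in> space params" "feasible n q" by (rule feasible_through)
  show ?thesis
  \<comment> \<open>If the value is at most \<open>e\<close>, every strategy is good enough;
    otherwise \<open>v - e\<close> is non-negative and strictly below the supremum.\<close>
  proof (cases "v \<le> e")
    case True
    then have "V \<le> ennreal e" unfolding v(1) by (rule ennreal_leI)
    then have "V \<le> gamble (fst (n, q)) (snd (n, q)) f + ennreal e" by (rule order_trans) simp
    moreover have "strategy (n, q)" unfolding strategy_def using q by simp
    ultimately show ?thesis unfolding V_def by blast
  next
    case False
    then have "ennreal (v - e) < V" unfolding v(1) using e by (intro ennreal_lessI) simp_all
    then obtain n q where q: "q \<in> space params" "feasible n q" "ennreal (v - e) < gamble n q f"
      unfolding V_def less_SUP_iff by blast
    have "V = ennreal (v - e) + ennreal e"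
      unfolding v(1) using False e by (subst ennreal_plus[symmetric]) simp_all
    also have "\<dots> \<le> gamble n q f + ennreal e" using q(3) by (intro add_right_mono less_imp_le)
    finally have "V \<le> gamble (fst (n, q)) (snd (n, q)) f + ennreal e" by simp
    moreover have "strategy (n, q)" unfolding strategy_def using q by simp
    ultimately show ?thesis unfolding V_def by blast
  qed
qed

text \<open>
  Starting from the empty history, finite strategies reach only the finitely many histories in \<open>R t\<close>.
  Almost optimal strategies can therefore be chosen there without any measurability condition.
\<close>

lemma env_le_one:
  assumes M: "coded M" and D: "D \<noteq> {}" and E: "e_process M (cond_hyp M \<Phi> S) E" and c: "c < \<top>"
  shows "env c E K 0 (\<lambda>_. undefined) \<le> 1"
proof (rule ennreal_le_epsilon)
  fix e :: real assume e: "0 < e"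
  let ?u = "\<lambda>_. undefined :: 'a"
  \<comment> \<open>Each of the \<open>K\<close> steps loses at most this amount, so the total loss
    is at most \<open>e\<close>; the summand 1 covers \<open>K = 0\<close>.\<close>
  define \<epsilon> where "\<epsilon> = e / (real K + 1)"
  have \<epsilon>: "0 < \<epsilon>" unfolding \<epsilon>_def using e by simp
  have E_meas: "E t \<in> borel_measurable (hist_space M t)" for t
    using E unfolding e_process_def nonneg_process_def by blast
  define nxt where "nxt t h y = env c E (K - Suc t) (Suc t) (h(t := y))" for t h y
  define V where "V t h = (SUP n. SUP q\<in>{q \<in> space params. feasible n q}. gamble n q (nxt t h))" for t h
  have V_fin: "V t h < \<top>" for t h
  proof (rule le_less_trans[OF _ c])
    have "gamble n q (nxt t h) \<le> c" if "q \<in> space params" "feasible n q" for n q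
      using gamble_mono[of "nxt t h" "\<lambda>_. c" q n, OF _ that(1)] gamble_const[OF that(2), of c]
      unfolding nxt_def by (simp only: env_le)
    then show "V t h \<le> c" unfolding V_def by (intro SUP_least) blast
  qed
  have "\<forall>t h. \<exists>s. strategy s \<and> V t h \<le> gamble (fst s) (snd s) (nxt t h) + ennreal \<epsilon>"
    unfolding V_def by (intro allI near_optimal[OF D \<epsilon> V_fin[unfolded V_def]])
  then obtain ch where ch': "\<forall>t h. strategy (ch t h) \<and> V t h \<le> gamble (fst (ch t h)) (snd (ch t h)) (nxt t h) + ennreal \<epsilon>"
    by metis
  have ch: "strategy (ch t h)" and ch_opt: "V t h \<le> gamble (fst (ch t h)) (snd (ch t h)) (nxt t h) + ennreal \<epsilon>" for t h
    using ch' by blast+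
  define R where "R = rec_nat {?u} (\<lambda>t X. \<Union>h\<in>X. (\<lambda>i. h(t := snd (snd (ch t h)) i)) ` {..<fst (ch t h)})"
  have R_0: "R 0 = {?u}" and R_Suc: "R (Suc t) = (\<Union>h\<in>R t. (\<lambda>i. h(t := snd (snd (ch t h)) i)) ` {..<fst (ch t h)})" for t
    unfolding R_def by simp_all
  have R_fin: "finite (R t)" for t
  proof (induction t)
    case (Suc t)
    show ?case unfolding R_Suc by (intro finite_UN_I Suc.IH finite_imageI finite_lessThan)
  qed (simp add: R_0)
  have R_hist: "R t \<subseteq> space (hist_space M t)" for t
  proof (induction t)
    case 0
    show ?case unfolding R_0 hist_space_def space_PiM by simp
  next
    case (Suc t)
    show ?case
    proof
      fix g assume "g \<in> R (Suc t)"
      then obtain h i where h: "h \<in> R t" and g: "g = h(t := snd (snd (ch t h)) i)" unfolding R_Suc by blast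
      have "h \<in> space (hist_space M t)" using Suc.IH h by blast
      from measurable_space[OF measurable_hist_upd_point[OF this] strategyD(3)[OF ch]]
      show "g \<in> space (hist_space M (Suc t))" unfolding g .
    qed
  qed
  have R_single: "{h} \<in> sets (hist_space M t)" if "h \<in> R t" for h t
    using coded_singleton[of "hist_space M t" h] coded_PiM[OF M] R_hist that unfolding hist_space_def by blast
  define s0 where "s0 = ch 0 ?u"
  have s0: "strategy s0" unfolding s0_def by (rule ch)
  define pl where "pl t h = (if h \<in> R t then ch t h else s0)" for t h
  have pl: "strategy (pl t h)" for t h unfolding pl_def using ch s0 by simp
  have "range (pl t) \<subseteq> insert s0 (ch t ` R t)" for t unfolding pl_def by auto
  then have pl_fin: "finite (range (pl t))" for t
    by (rule finite_subset) (intro finite.insertI finite_imageI R_fin)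
  have pl_mean: "(\<lambda>h. strategy_mean (pl t h) f) \<in> borel_measurable (hist_space M t)" for t and f :: "'a \<Rightarrow> real"
    unfolding pl_def if_distrib[of "\<lambda>s. strategy_mean s f"]
    by (rule measurable_finite_modification[OF R_fin R_single]) (simp_all only: space_borel UNIV_I)
  obtain Q where Q: "Q \<in> space (prob_algebra (path_space M))"
    and step: "\<And>t f. f \<in> borel_measurable (hist_space M (Suc t)) \<Longrightarrow>
      (\<integral>\<^sup>+\<omega>. f (cut (Suc t) \<omega>) \<partial>Q) = (\<integral>\<^sup>+\<omega>. gamble (fst (pl t (cut t \<omega>))) (snd (pl t (cut t \<omega>))) (\<lambda>y. f ((cut t \<omega>)(t := y))) \<partial>Q)"
  proof (rule strategy_measure_ex[where ch = ch, OF M R_fin R_hist ch s0, folded pl_def])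
    fix Q assume "Q \<in> space (prob_algebra (path_space M))"
      "\<And>t f. f \<in> borel_measurable (hist_space M (Suc t)) \<Longrightarrow>
      (\<integral>\<^sup>+\<omega>. f (cut (Suc t) \<omega>) \<partial>Q) = (\<integral>\<^sup>+\<omega>. gamble (fst (pl t (cut t \<omega>))) (snd (pl t (cut t \<omega>))) (\<lambda>y. f ((cut t \<omega>)(t := y))) \<partial>Q)"
    then show thesis by (rule that)
  qed
  have Q_hyp: "Q \<in> cond_hyp M \<Phi> S" by (rule strategy_law_cond_hyp[OF pl pl_fin pl_mean Q step])
  have Q_sets: "sets Q = sets (path_space M)" using Q unfolding space_prob_algebra by blast
  interpret Q: prob_space Q using Q unfolding space_prob_algebra by blast
  have cut_Q: "cut t \<in> Q \<rightarrow>\<^sub>M hist_space M t" for t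
    unfolding measurable_cong_sets[OF Q_sets refl] by (rule measurable_path_cut)

  \<comment> \<open>Continue while stopping now pays strictly less than the value of the game.
    Histories outside \<open>R t\<close> stop at once.\<close>
  define cont where "cont t h \<longleftrightarrow> t < K \<and> h \<in> R t \<and> min (E t h) c < env c E (K - t) t h" for t h
  define alive where "alive t h \<longleftrightarrow> (\<forall>s\<in>{..<t}. cont s (cut s h))" for t h
  define val where "val t h = (if h \<in> R t then env c E (K - t) t h else 0)" for t h
  \<comment> \<open>On paths not stopped before \<open>t\<close>, \<open>A\<close> is the value
    still to be collected, and \<open>B\<close> is the payoff collected by stopping exactly at
    \<open>t\<close>. Expected \<open>A\<close> plus the expected sum of earlier \<open>B\<close>
    drops by at most \<open>\<epsilon>\<close> per step.\<close>
  define A where "A t h = (if alive t h then val t h else 0)" for t h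
  define B where "B t h = (if alive t h \<and> \<not> cont t h then E t h else 0)" for t h
  have cont_meas: "{h \<in> space (hist_space M t). cont t h} \<in> sets (hist_space M t)" for t
  proof -
    have "{h \<in> space (hist_space M t). cont t h} = (\<Union>h\<in>{h \<in> R t. cont t h}. {h})"
      using R_hist[of t] unfolding cont_def by auto
    also have "\<dots> \<in> sets (hist_space M t)"
      by (rule sets.finite_UN) (use R_fin R_single in auto)
    finally show ?thesis .
  qed
  have cont_cut_meas: "{h \<in> space (hist_space M t). cont s (cut s h)} \<in> sets (hist_space M t)" if "s \<le> t" for s t
    using measurable_compose[OF measurable_hist_cut[OF that] cont_meas[of s, folded pred_def]] unfolding pred_def .
  have alive_meas: "{h \<in> space (hist_space M t). alive t h} \<in> sets (hist_space M t)" for t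
    unfolding alive_def by (intro sets.sets_Collect_finite_All cont_cut_meas) simp_all
  have stop_meas: "{h \<in> space (hist_space M t). alive t h \<and> \<not> cont t h} \<in> sets (hist_space M t)" for t
    by (intro sets.sets_Collect_conj sets.sets_Collect_neg alive_meas cont_meas)
  have A_meas: "A t \<in> borel_measurable (hist_space M t)" for t
    unfolding A_def val_def
    by (rule measurable_If[OF measurable_finite_modification[OF R_fin R_single] measurable_const alive_meas])
      (simp_all only: space_borel UNIV_I)
  have B_meas: "B t \<in> borel_measurable (hist_space M t)" for t
    unfolding B_def by (rule measurable_If[OF E_meas measurable_const stop_meas]) simp
  have AQ: "(\<lambda>\<omega>. A t (cut t \<omega>)) \<in> borel_measurable Q" and BQ: "(\<lambda>\<omega>. B t (cut t \<omega>)) \<in> borel_measurable Q" for t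
    by (rule measurable_compose[OF cut_Q A_meas], rule measurable_compose[OF cut_Q B_meas])

  have decrease: "(\<integral>\<^sup>+\<omega>. A t (cut t \<omega>) \<partial>Q) \<le>
      (\<integral>\<^sup>+\<omega>. A (Suc t) (cut (Suc t) \<omega>) \<partial>Q) + (\<integral>\<^sup>+\<omega>. B t (cut t \<omega>) \<partial>Q) + ennreal \<epsilon>" if t: "t < K" for t
  proof -
    define G where "G h = (if h \<in> R t then gamble (fst (ch t h)) (snd (ch t h)) (\<lambda>y. A (Suc t) (h(t := y))) else 0)" for h
    have "G \<in> borel_measurable (hist_space M t)"
      unfolding G_def by (rule measurable_finite_modification[OF R_fin R_single]) (simp_all only: space_borel UNIV_I)
    then have GQ: "(\<lambda>\<omega>. G (cut t \<omega>)) \<in> borel_measurable Q" by (rule measurable_compose[OF cut_Q])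
    have alive_upd: "alive (Suc t) ((cut t \<omega>)(t := y)) \<longleftrightarrow> alive t (cut t \<omega>) \<and> cont t (cut t \<omega>)" for \<omega> y
    proof -
      have "cut s ((cut t \<omega>)(t := y)) = cut s (cut t \<omega>)" if "s \<le> t" for s by (rule cut_upd[OF that])
      moreover have "cut t (cut t \<omega>) = cut t \<omega>" by (rule cut_cut) simp
      ultimately show ?thesis unfolding alive_def lessThan_Suc by auto
    qed
    have G: "G (cut t \<omega>) = gamble (fst (pl t (cut t \<omega>))) (snd (pl t (cut t \<omega>))) (\<lambda>y. A (Suc t) ((cut t \<omega>)(t := y)))" for \<omega>
    proof (cases "cut t \<omega> \<in> R t")
      case True
      then show ?thesis unfolding G_def pl_def by simp
    next
      case False
      \<comment> \<open>Outside \<open>R t\<close> play has stopped, so the default strategy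
        \<open>s0\<close> used there contributes nothing.\<close>
      then have "A (Suc t) ((cut t \<omega>)(t := y)) = 0" for y unfolding A_def alive_upd cont_def by simp
      then show ?thesis using False unfolding G_def gamble_def by simp
    qed
    have "A t (cut t \<omega>) \<le> G (cut t \<omega>) + B t (cut t \<omega>) + ennreal \<epsilon>" for \<omega>
    proof -
      let ?h = "cut t \<omega>"
      consider (dead) "\<not> alive t ?h" | (out) "?h \<notin> R t" | (stop) "alive t ?h" "?h \<in> R t" "\<not> cont t ?h"
        | (go) "alive t ?h" "?h \<in> R t" "cont t ?h" by blast
      then show ?thesis
      proof cases
        case dead
        then show ?thesis unfolding A_def by simp
      next
        case out
        then show ?thesis unfolding A_def val_def by simp
      next
        case stop
        \<comment> \<open>Stopping means that the current payoff already attains the value.\<close>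
        then have "env c E (K - t) t ?h \<le> min (E t ?h) c" using t unfolding cont_def by (meson not_le)
        then have "A t ?h \<le> min (E t ?h) c" using stop unfolding A_def val_def by (simp only: if_True)
        also have "\<dots> \<le> B t ?h" using stop unfolding B_def by simp
        also have "\<dots> \<le> G ?h + B t ?h + ennreal \<epsilon>" by (rule add_increasing2[OF zero_le add_increasing[OF zero_le order_refl]])
        finally show ?thesis .
      next
        case go
        have K: "K - t = Suc (K - Suc t)" using t by simp
        have "A t ?h = env c E (K - t) t ?h" using go unfolding A_def val_def by simp
        also have "\<dots> \<le> V t ?h"
        proof -
          have "env c E (K - t) t ?h = max (min (E t ?h) c) (V t ?h)"
            unfolding K env_Suc V_def nxt_def ..
          moreover have "min (E t ?h) c < env c E (K - t) t ?h" using go unfolding cont_def by blast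
          ultimately show ?thesis by (simp add: max_def split: if_splits)
        qed
        also have "\<dots> \<le> gamble (fst (ch t ?h)) (snd (ch t ?h)) (nxt t ?h) + ennreal \<epsilon>" by (rule ch_opt)
        also have "gamble (fst (ch t ?h)) (snd (ch t ?h)) (nxt t ?h) = G ?h"
        proof -
          have "nxt t ?h (snd (snd (ch t ?h)) i) = A (Suc t) (?h(t := snd (snd (ch t ?h)) i))" if "i < fst (ch t ?h)" for i
          proof -
            have "?h(t := snd (snd (ch t ?h)) i) \<in> R (Suc t)" unfolding R_Suc using go(2) that by blast
            then show ?thesis unfolding A_def val_def nxt_def using alive_upd go by simp
          qed
          then show ?thesis unfolding G_def gamble_def using go(2) by (simp cong: sum.cong_simp)
        qed
        also have "G ?h + ennreal \<epsilon> \<le> G ?h + B t ?h + ennreal \<epsilon>" by (rule add_right_mono[OF add_increasing2[OF zero_le order_refl]])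
        finally show ?thesis .
      qed
    qed
    then have "(\<integral>\<^sup>+\<omega>. A t (cut t \<omega>) \<partial>Q) \<le> (\<integral>\<^sup>+\<omega>. G (cut t \<omega>) + B t (cut t \<omega>) + ennreal \<epsilon> \<partial>Q)"
      by (rule nn_integral_mono)
    also have "\<dots> = (\<integral>\<^sup>+\<omega>. G (cut t \<omega>) + B t (cut t \<omega>) \<partial>Q) + (\<integral>\<^sup>+\<omega>. ennreal \<epsilon> \<partial>Q)"
      by (rule nn_integral_add) (intro borel_measurable_add GQ BQ borel_measurable_const)+
    also have "(\<integral>\<^sup>+\<omega>. ennreal \<epsilon> \<partial>Q) = ennreal \<epsilon>" by (simp add: Q.emeasure_space_1)
    also have "(\<integral>\<^sup>+\<omega>. G (cut t \<omega>) + B t (cut t \<omega>) \<partial>Q) = (\<integral>\<^sup>+\<omega>. G (cut t \<omega>) \<partial>Q) + (\<integral>\<^sup>+\<omega>. B t (cut t \<omega>) \<partial>Q)"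
      by (rule nn_integral_add[OF GQ BQ])
    also have "(\<integral>\<^sup>+\<omega>. G (cut t \<omega>) \<partial>Q) = (\<integral>\<^sup>+\<omega>. A (Suc t) (cut (Suc t) \<omega>) \<partial>Q)"
      unfolding G by (rule step[OF A_meas, symmetric])
    finally show ?thesis .
  qed
  have main: "(\<integral>\<^sup>+\<omega>. A 0 (cut 0 \<omega>) \<partial>Q) \<le>
      (\<integral>\<^sup>+\<omega>. A t (cut t \<omega>) \<partial>Q) + (\<integral>\<^sup>+\<omega>. (\<Sum>s<t. B s (cut s \<omega>)) \<partial>Q) + ennreal (real t * \<epsilon>)" if "t \<le> K" for t
    using that
  proof (induction t)
    case 0
    show ?case by simp
  next
    case (Suc t)
    have sum: "(\<lambda>\<omega>. \<Sum>s<t. B s (cut s \<omega>)) \<in> borel_measurable Q" by (intro borel_measurable_sum BQ)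
    have "(\<integral>\<^sup>+\<omega>. (\<Sum>s<Suc t. B s (cut s \<omega>)) \<partial>Q) = (\<integral>\<^sup>+\<omega>. (\<Sum>s<t. B s (cut s \<omega>)) \<partial>Q) + (\<integral>\<^sup>+\<omega>. B t (cut t \<omega>) \<partial>Q)"
      unfolding sum.lessThan_Suc by (rule nn_integral_add[OF sum BQ])
    moreover have "ennreal (real (Suc t) * \<epsilon>) = ennreal (real t * \<epsilon>) + ennreal \<epsilon>"
      using \<epsilon> by (subst ennreal_plus[symmetric]) (simp_all add: algebra_simps)
    moreover have "(\<integral>\<^sup>+\<omega>. A 0 (cut 0 \<omega>) \<partial>Q) \<le>
      ((\<integral>\<^sup>+\<omega>. A (Suc t) (cut (Suc t) \<omega>) \<partial>Q) + (\<integral>\<^sup>+\<omega>. B t (cut t \<omega>) \<partial>Q) + ennreal \<epsilon>) +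
      (\<integral>\<^sup>+\<omega>. (\<Sum>s<t. B s (cut s \<omega>)) \<partial>Q) + ennreal (real t * \<epsilon>)"
    proof (rule order_trans[OF _ add_right_mono[OF add_right_mono[OF decrease]]])
      show "(\<integral>\<^sup>+\<omega>. A 0 (cut 0 \<omega>) \<partial>Q) \<le> (\<integral>\<^sup>+\<omega>. A t (cut t \<omega>) \<partial>Q) +
        (\<integral>\<^sup>+\<omega>. (\<Sum>s<t. B s (cut s \<omega>)) \<partial>Q) + ennreal (real t * \<epsilon>)"
        using Suc.prems by (intro Suc.IH) simp
    qed (use Suc.prems in simp)
    ultimately show ?case by (simp only: ac_simps)
  qed

  \<comment> \<open>The first time at which play stops; it is at most \<open>K\<close> since
    \<open>cont\<close> requires \<open>t < K\<close>.\<close>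
  define \<tau> where "\<tau> \<omega> = (LEAST t. \<not> cont t (cut t \<omega>))" for \<omega>
  have not_cont_K: "\<not> cont K h" for h unfolding cont_def by simp
  have \<tau>_stop: "\<not> cont (\<tau> \<omega>) (cut (\<tau> \<omega>) \<omega>)" for \<omega> unfolding \<tau>_def by (rule LeastI[of _ K]) (rule not_cont_K)
  have \<tau>_least: "\<not> cont t (cut t \<omega>) \<Longrightarrow> \<tau> \<omega> \<le> t" for \<omega> t unfolding \<tau>_def by (rule Least_le)
  have \<tau>_K: "\<tau> \<omega> \<le> K" for \<omega> by (rule \<tau>_least) (rule not_cont_K)
  have \<tau>_iff: "\<tau> \<omega> \<le> t \<longleftrightarrow> (\<exists>s\<in>{..t}. \<not> cont s (cut s (cut t \<omega>)))" for \<omega> t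
  proof
    assume "\<tau> \<omega> \<le> t"
    then show "\<exists>s\<in>{..t}. \<not> cont s (cut s (cut t \<omega>))"
      using \<tau>_stop by (intro bexI[of _ "\<tau> \<omega>"]) (simp_all add: cut_cut)
  next
    assume "\<exists>s\<in>{..t}. \<not> cont s (cut s (cut t \<omega>))"
    then obtain s where s: "s \<le> t" "\<not> cont s (cut s (cut t \<omega>))" by blast
    then have "\<not> cont s (cut s \<omega>)" by (simp add: cut_cut)
    then show "\<tau> \<omega> \<le> t" using s(1) by (intro order_trans[OF \<tau>_least])
  qed
  have "stopping_time (nat_filtration M) \<tau>"
    unfolding stopping_time_def
  proof
    fix t
    have "{h \<in> space (hist_space M t). \<exists>s\<in>{..t}. \<not> cont s (cut s h)} \<in> sets (hist_space M t)"
      by (intro sets.sets_Collect_finite_Ex sets.sets_Collect_neg cont_cut_meas) simp_all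
    from measurable_compose[OF measurable_filtration_cut this[folded pred_def]]
    show "Measurable.pred (nat_filtration M t) (\<lambda>\<omega>. \<tau> \<omega> \<le> t)" unfolding \<tau>_iff .
  qed
  moreover have "\<exists>T\<ge>1. \<forall>\<omega>\<in>space (path_space M). \<tau> \<omega> \<le> T"
  proof (intro exI conjI ballI)
    \<comment> \<open>The bound on a stopping time has to be at least 1, whereas \<open>K\<close>
      may be 0.\<close>
    show "1 \<le> Suc K" by simp
    show "\<tau> \<omega> \<le> Suc K" for \<omega> by (rule le_SucI[OF \<tau>_K])
  qed
  ultimately have "\<tau> \<in> bounded_stopping_times M"
    unfolding bounded_stopping_times_def by blast
  then have stop_le: "(\<integral>\<^sup>+\<omega>. stopped E \<tau> \<omega> \<partial>Q) \<le> 1"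
    using E Q_hyp unfolding e_process_def by blast
  have alive_iff: "alive s (cut s \<omega>) \<longleftrightarrow> s \<le> \<tau> \<omega>" for s \<omega>
  proof -
    have "alive s (cut s \<omega>) \<longleftrightarrow> (\<forall>r<s. cont r (cut r \<omega>))" unfolding alive_def by (auto simp: cut_cut)
    also have "\<dots> \<longleftrightarrow> s \<le> \<tau> \<omega>"
      using \<tau>_stop[of \<omega>] \<tau>_least[of _ \<omega>] by (metis linorder_not_le order_less_le_trans)
    finally show ?thesis .
  qed
  \<comment> \<open>Exactly one of the terms can be non-zero: \<open>B s\<close> with
    \<open>s = \<tau> \<omega>\<close> if play stops before \<open>K\<close>, and otherwise
    \<open>A K\<close>, which is at most \<open>E K\<close>.\<close>
  have stopped: "A K (cut K \<omega>) + (\<Sum>s<K. B s (cut s \<omega>)) \<le> stopped E \<tau> \<omega>" for \<omega>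
  proof -
    have B: "B s (cut s \<omega>) = (if \<tau> \<omega> = s then stopped E \<tau> \<omega> else 0)" if "s < K" for s
    proof -
      have "alive s (cut s \<omega>) \<and> \<not> cont s (cut s \<omega>) \<longleftrightarrow> \<tau> \<omega> = s"
        unfolding alive_iff using \<tau>_stop[of \<omega>] \<tau>_least[of s \<omega>] by (metis order_antisym order_refl)
      then show ?thesis unfolding B_def stopped_def cut_def by auto
    qed
    have sum: "(\<Sum>s<K. B s (cut s \<omega>)) = (if \<tau> \<omega> < K then stopped E \<tau> \<omega> else 0)"
    proof -
      have "(\<Sum>s<K. B s (cut s \<omega>)) = (\<Sum>s<K. if \<tau> \<omega> = s then stopped E \<tau> \<omega> else 0)"
        by (rule sum.cong[OF refl]) (simp add: B)
      also have "\<dots> = (if \<tau> \<omega> < K then stopped E \<tau> \<omega> else 0)" by (simp only: sum.delta'[OF finite_lessThan] lessThan_iff)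
      finally show ?thesis .
    qed
    show ?thesis
    proof (cases "\<tau> \<omega> < K")
      case True
      then show ?thesis unfolding sum A_def alive_iff by simp
    next
      case False
      then have "\<tau> \<omega> = K" using \<tau>_K[of \<omega>] by simp
      then have "stopped E \<tau> \<omega> = E K (cut K \<omega>)" unfolding stopped_def cut_def by (simp only:)
      moreover have "A K (cut K \<omega>) \<le> E K (cut K \<omega>)" unfolding A_def val_def by simp
      ultimately show ?thesis using False unfolding sum by simp
    qed
  qed
  have u: "cut 0 \<omega> = ?u" for \<omega> :: "nat \<Rightarrow> 'a" by (rule cut_0)
  have "env c E K 0 ?u = (\<integral>\<^sup>+\<omega>. A 0 (cut 0 \<omega>) \<partial>Q)"
    unfolding u A_def val_def alive_def R_0 by (simp add: Q.emeasure_space_1)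
  also have "\<dots> \<le> (\<integral>\<^sup>+\<omega>. A K (cut K \<omega>) \<partial>Q) + (\<integral>\<^sup>+\<omega>. (\<Sum>s<K. B s (cut s \<omega>)) \<partial>Q) + ennreal (real K * \<epsilon>)"
    by (rule main[OF order_refl])
  also have "\<dots> \<le> 1 + ennreal e"
  proof (rule add_mono)
    have "(\<integral>\<^sup>+\<omega>. A K (cut K \<omega>) \<partial>Q) + (\<integral>\<^sup>+\<omega>. (\<Sum>s<K. B s (cut s \<omega>)) \<partial>Q) =
        (\<integral>\<^sup>+\<omega>. A K (cut K \<omega>) + (\<Sum>s<K. B s (cut s \<omega>)) \<partial>Q)"
      by (rule nn_integral_add[OF AQ, symmetric]) (intro borel_measurable_sum BQ)
    also have "\<dots> \<le> (\<integral>\<^sup>+\<omega>. stopped E \<tau> \<omega> \<partial>Q)" by (rule nn_integral_mono) (rule stopped)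
    also have "\<dots> \<le> 1" by (rule stop_le)
    finally show "(\<integral>\<^sup>+\<omega>. A K (cut K \<omega>) \<partial>Q) + (\<integral>\<^sup>+\<omega>. (\<Sum>s<K. B s (cut s \<omega>)) \<partial>Q) \<le> 1" .
    show "ennreal (real K * \<epsilon>) \<le> ennreal e"
      unfolding \<epsilon>_def using e by (intro ennreal_leI) (simp add: field_simps)
  qed
  finally show "env c E K 0 ?u \<le> 1 + ennreal e" .
qed

section \<open>Domination by a predictable product\<close>

text \<open>As soon as an observation leaves the effective domain, the product is infinite, so only
  histories inside the domain have to be compared.\<close>

lemma le_pred_product:
  assumes E0: "\<And>x. x \<in> space (hist_space M 0) \<Longrightarrow> E 0 x \<le> 1"
    and le: "\<And>t x. x \<in> {0..<Suc t} \<rightarrow>\<^sub>E D \<Longrightarrow> E (Suc t) x \<le> pred_product M \<Phi> S l (Suc t) x"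
    and x: "x \<in> space (hist_space M t)"
  shows "E t x \<le> pred_product M \<Phi> S l t x"
proof (cases t)
  case 0
  then show ?thesis using E0 x by simp
next
  case (Suc s)
  show ?thesis
  proof (cases "x \<in> {0..<Suc s} \<rightarrow>\<^sub>E D")
    case True
    then show ?thesis unfolding Suc by (rule le)
  next
    case False
    have "x s \<notin> D" if r: "restrict x {0..<s} \<in> {0..<s} \<rightarrow>\<^sub>E D"
    proof
      assume "x s \<in> D"
      from hist_upd_N[OF r this] have "(restrict x {0..<s})(s := x s) \<in> {0..<Suc s} \<rightarrow>\<^sub>E D" .
      moreover have "(restrict x {0..<s})(s := x s) = x"
      proof
        fix i
        have "x i = undefined" if "\<not> i < Suc s"
          using x that unfolding Suc hist_space_def space_PiM by (intro PiE_arb[of x "{0..<Suc s}" "\<lambda>_. space M"]) simp_all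
        then show "((restrict x {0..<s})(s := x s)) i = x i" by (cases "i < s"; cases "i = s") simp_all
      qed
      ultimately show False using False by (simp only: simp_thms)
    qed
    then have "pred_product M \<Phi> S l (Suc s) x = \<infinity>"
      unfolding pred_product_Suc mult_top_def e_var_def
      by (cases "restrict x {0..<s} \<in> {0..<s} \<rightarrow>\<^sub>E D") (simp_all only: if_True if_False simp_thms)
    then show ?thesis unfolding Suc by (simp only: infinity_ennreal_def top_greatest)
  qed
qed

text \<open>With an empty effective domain every vector is an admissible bet, and every product is
  infinite from time 1 on.\<close>

lemma dominating_product_empty:
  assumes D: "D = {}" and E: "e_process M (cond_hyp M \<Phi> S) E"
  shows "\<exists>l\<in>Lambda_seq M \<Phi> S. \<forall>t. \<forall>x\<in>space (hist_space M t). E t x \<le> pred_product M \<Phi> S l t x"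
proof (intro bexI[of _ "\<lambda>_ _. 0"] allI ballI)
  have "0 \<in> Lambda M \<Phi> S" unfolding Lambda_def D by simp
  then have "0 \<in> space (restrict_space borel (Lambda M \<Phi> S))" by (simp add: space_restrict_space)
  then show "(\<lambda>_ _. 0) \<in> Lambda_seq M \<Phi> S" unfolding Lambda_seq_def by (intro CollectI allI measurable_const)
next
  fix t x assume x: "x \<in> space (hist_space M t)"
  show "E t x \<le> pred_product M \<Phi> S (\<lambda>_ _. 0) t x"
  proof (rule le_pred_product[OF _ _ x])
    show "E 0 x \<le> 1" if "x \<in> space (hist_space M 0)" for x using E that unfolding e_process_def by blast
    show "E (Suc t) x \<le> pred_product M \<Phi> S (\<lambda>_ _. 0) (Suc t) x" if "x \<in> {0..<Suc t} \<rightarrow>\<^sub>E D" for t x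
      using PiE_mem[OF that, of t] unfolding D by simp
  qed
qed

text \<open>Dependent choice along time: the running product \<open>G\<close> of the bets chosen so
  far is a finite Borel majorant of the envelope, which is what \<open>envelope_selection\<close>
  needs to choose the next bet. The start is \<open>env_le_one\<close>.\<close>

lemma dominating_product:
  assumes M: "coded M" and D: "D \<noteq> {}" and E: "e_process M (cond_hyp M \<Phi> S) E"
  shows "\<exists>l\<in>Lambda_seq M \<Phi> S. \<forall>t. \<forall>x\<in>space (hist_space M t). E t x \<le> pred_product M \<Phi> S l t x"
proof -
  have nonneg: "nonneg_process M E" using E unfolding e_process_def by blast
  \<comment> \<open>The clause for time 0 fixes the starting wealth, so that \<open>G\<close> can
    later be identified with the predictable product.\<close>
  define P where "P t G \<longleftrightarrow> G \<in> borel_measurable (hist_space N t) \<and>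
    (\<forall>h\<in>{0..<t} \<rightarrow>\<^sub>E D. envelope E t h \<le> G h \<and> G h < \<top>) \<and> (t = 0 \<longrightarrow> G = (\<lambda>_. 1))" for t G
  define J where "J t l G G' \<longleftrightarrow> l \<in> hist_space N t \<rightarrow>\<^sub>M borel \<and> (\<forall>h\<in>{0..<t} \<rightarrow>\<^sub>E D. l h \<in> bets) \<and>
    G' = (\<lambda>x. G (restrict x {0..<t}) * e_var M \<Phi> S (l (restrict x {0..<t})) (x t))" for t l G G'
  have P0: "P 0 (\<lambda>_. 1)"
  proof -
    have "envelope E 0 h \<le> 1" if "h \<in> {0..<0} \<rightarrow>\<^sub>E D" for h
    proof -
      have h: "h = (\<lambda>_. undefined)" using that by simp
      show ?thesis unfolding envelope_def h by (rule SUP_least, rule env_le_one[OF M D E]) (simp add: less_top[symmetric])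
    qed
    then show ?thesis unfolding P_def by (intro conjI ballI borel_measurable_const) simp_all
  qed
  have P_Suc: "\<exists>G'. P (Suc t) G' \<and> (\<exists>l. J t l G G')" if "P t G" for t G
  proof -
    have G: "G \<in> borel_measurable (hist_space N t)" and le: "\<And>h. h \<in> {0..<t} \<rightarrow>\<^sub>E D \<Longrightarrow> envelope E t h \<le> G h"
      and fin: "\<And>h. h \<in> {0..<t} \<rightarrow>\<^sub>E D \<Longrightarrow> G h < \<top>" using that unfolding P_def by blast+
    obtain l where l: "l \<in> hist_space N t \<rightarrow>\<^sub>M borel" "\<And>h. h \<in> {0..<t} \<rightarrow>\<^sub>E D \<Longrightarrow> l h \<in> bets"
      "\<And>h y. h \<in> {0..<t} \<rightarrow>\<^sub>E D \<Longrightarrow> y \<in> D \<Longrightarrow> envelope E (Suc t) (h(t := y)) \<le> G h * e_var M \<Phi> S (l h) y"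
    proof (rule envelope_selection[OF M D nonneg G le fin])
      fix l assume "l \<in> hist_space N t \<rightarrow>\<^sub>M borel" "\<And>h. h \<in> {0..<t} \<rightarrow>\<^sub>E D \<Longrightarrow> l h \<in> bets"
        "\<And>h y. h \<in> {0..<t} \<rightarrow>\<^sub>E D \<Longrightarrow> y \<in> D \<Longrightarrow> envelope E (Suc t) (h(t := y)) \<le> G h * e_var M \<Phi> S (l h) y"
      then show thesis by (rule that)
    qed
    let ?G = "\<lambda>x. G (restrict x {0..<t}) * e_var M \<Phi> S (l (restrict x {0..<t})) (x t)"
    have r: "(\<lambda>x. restrict x {0..<t}) \<in> hist_space N (Suc t) \<rightarrow>\<^sub>M hist_space N t"
      by (rule measurable_hist_restrict) simp
    have c: "(\<lambda>x. x t) \<in> hist_space N (Suc t) \<rightarrow>\<^sub>M M"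
      by (rule measurable_hist_N, rule measurable_hist_component) simp
    have G_meas: "?G \<in> borel_measurable (hist_space N (Suc t))"
      by (rule borel_measurable_times_ennreal[OF measurable_compose[OF r G]
            measurable_e_var[OF D_nonempty(1) measurable_compose[OF r l(1)] c]]) (rule D)
    have G_bounds: "envelope E (Suc t) x \<le> ?G x \<and> ?G x < \<top>" if x: "x \<in> {0..<Suc t} \<rightarrow>\<^sub>E D" for x
    proof
      note h = hist_Suc_N[OF x]
      show "envelope E (Suc t) x \<le> ?G x" using l(3)[OF h(1,2)] unfolding h(3) .
      have "l (restrict x {0..<t}) \<in> Lambda M \<Phi> S" using l(2)[OF h(1)] bets_subset_Lambda by blast
      from fin[OF h(1)] e_var_less_top[OF this h(2)] show "?G x < \<top>"
        by (simp only: ennreal_mult_less_top simp_thms)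
    qed
    have "P (Suc t) ?G"
      unfolding P_def by (rule conjI[OF G_meas conjI[OF ballI[OF G_bounds]]]) simp_all
    moreover have "J t l G ?G"
      unfolding J_def by (rule conjI[OF l(1) conjI[OF ballI[OF l(2)] refl]])
    ultimately show ?thesis by (intro exI conjI)
  qed
  obtain G where G: "\<forall>t. P t (G t) \<and> (\<exists>l. J t l (G t) (G (Suc t)))"
    using exE[OF dependent_nat_choice[of P "\<lambda>t G G'. \<exists>l. J t l G G'", OF exI[of "P 0", OF P0] P_Suc]] .
  note PG = conjunct1[OF spec[OF G], unfolded P_def]
  have "\<forall>t. \<exists>l. J t l (G t) (G (Suc t))" by (rule allI) (rule conjunct2[OF spec[OF G]])
  from choice[OF this] obtain l where "\<forall>t. J t (l t) (G t) (G (Suc t))" by (rule exE)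
  note l = spec[OF this, unfolded J_def]
  have l_bets: "l t h \<in> bets" if "h \<in> {0..<t} \<rightarrow>\<^sub>E D" for t h
    by (rule bspec[OF conjunct1[OF conjunct2[OF l]] that])
  have l_meas: "l t \<in> hist_space N t \<rightarrow>\<^sub>M borel" for t by (rule conjunct1[OF l])
  have G_Suc: "G (Suc t) x = G t (restrict x {0..<t}) * e_var M \<Phi> S (l t (restrict x {0..<t})) (x t)" for t x
    by (rule fun_cong[OF conjunct2[OF conjunct2[OF l]]])
  have seq: "l \<in> Lambda_seq M \<Phi> S"
    unfolding Lambda_seq_def
  proof (intro CollectI allI)
    fix t
    have "l t \<in> space (hist_space N t) \<rightarrow> Lambda M \<Phi> S"
      unfolding space_hist_N by (rule Pi_I) (rule subsetD[OF bets_subset_Lambda l_bets])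
    then show "l t \<in> hist_space N t \<rightarrow>\<^sub>M restrict_space borel (Lambda M \<Phi> S)"
      by (rule measurable_restrict_space2) (rule l_meas)
  qed
  have prod: "pred_product M \<Phi> S l t h = G t h" if "h \<in> {0..<t} \<rightarrow>\<^sub>E D" for t h
    using that
  proof (induction t arbitrary: h)
    case 0
    have "G 0 = (\<lambda>_. 1)" by (rule mp[OF conjunct2[OF conjunct2[OF PG]] refl])
    then show ?case by simp
  next
    case (Suc t)
    note h = hist_Suc_N[OF Suc.prems]
    have "pred_product M \<Phi> S l (Suc t) ((restrict h {0..<t})(t := h t)) =
        pred_product M \<Phi> S l t (restrict h {0..<t}) * e_var M \<Phi> S (l t (restrict h {0..<t})) (h t)"
      by (rule pred_product_Suc_D[OF seq h(1,2)])
    then show ?case unfolding h(3) G_Suc Suc.IH[OF h(1)] .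
  qed
  show ?thesis
  proof (intro bexI[OF _ seq] allI ballI)
    fix t x assume x: "x \<in> space (hist_space M t)"
    show "E t x \<le> pred_product M \<Phi> S l t x"
    proof (rule le_pred_product[OF _ _ x])
      show "E 0 x \<le> 1" if "x \<in> space (hist_space M 0)" for x using E that unfolding e_process_def by blast
      show "E (Suc t) x \<le> pred_product M \<Phi> S l (Suc t) x" if x: "x \<in> {0..<Suc t} \<rightarrow>\<^sub>E D" for t x
      proof -
        have "E (Suc t) x \<le> envelope E (Suc t) x" by (rule envelope_ge)
        also have "\<dots> \<le> G (Suc t) x" by (rule conjunct1[OF bspec[OF conjunct1[OF conjunct2[OF PG]] x]])
        also have "\<dots> = pred_product M \<Phi> S l (Suc t) x" by (rule prod[OF x, symmetric])
        finally show ?thesis .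
      qed
    qed
  qed
qed

end

theorem theorem1:
  fixes M :: "'a measure"
    and \<Phi> :: "'a \<Rightarrow> real ^ 'm"
    and S :: "(real ^ 'm) set"
    and E :: "nat \<Rightarrow> (nat \<Rightarrow> 'a) \<Rightarrow> ennreal"
  assumes "standard_borel M"
    and "\<Phi> \<in> M \<rightarrow>\<^sub>M borel"
    and "S \<noteq> {}"
    and "convex S"
    and "nonneg_process M E"
  shows "e_process M (cond_hyp M \<Phi> S) E \<longleftrightarrow>
           (\<exists>Ehat\<in>pred_products M \<Phi> S. \<forall>t. \<forall>x\<in>space (hist_space M t). E t x \<le> Ehat t x)"
proof -
  \<comment> \<open>A coded space is the image of Baire space and so never empty. An empty
    \<open>M\<close> has an empty effective domain and falls under
    \<open>dominating_product_empty\<close>.\<close>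
  have coded: "coded M" if "space M \<noteq> {}" by (rule coded_standard_borel[OF assms(1) that])
  have "moment_constraint M \<Phi> S"
  proof (rule moment_constraint.intro[OF assms(2,4)])
    fix x assume x: "x \<in> space M"
    then have "space M \<noteq> {}" by blast
    from coded_singleton[OF coded[OF this] x] show "{x} \<in> sets M" .
  qed
  then interpret moment_constraint M \<Phi> S .
  show ?thesis
    unfolding pred_products_def
  proof
    assume E: "e_process M (cond_hyp M \<Phi> S) E"
    have "\<exists>l\<in>Lambda_seq M \<Phi> S. \<forall>t. \<forall>x\<in>space (hist_space M t). E t x \<le> pred_product M \<Phi> S l t x"
    proof (cases "D = {}")
      case True
      then show ?thesis by (rule dominating_product_empty[OF _ E])
    next
      case False
      then have "space M \<noteq> {}" using D_subset by blast
      from dominating_product[OF coded[OF this] False E] show ?thesis .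
    qed
    then obtain l where l: "l \<in> Lambda_seq M \<Phi> S"
      and le: "\<forall>t. \<forall>x\<in>space (hist_space M t). E t x \<le> pred_product M \<Phi> S l t x" by (rule bexE)
    show "\<exists>Ehat\<in>pred_product M \<Phi> S ` Lambda_seq M \<Phi> S. \<forall>t. \<forall>x\<in>space (hist_space M t). E t x \<le> Ehat t x"
      by (rule bexI[where x = "pred_product M \<Phi> S l"]) (rule le, rule imageI[OF l])
  next
    assume "\<exists>Ehat\<in>pred_product M \<Phi> S ` Lambda_seq M \<Phi> S. \<forall>t. \<forall>x\<in>space (hist_space M t). E t x \<le> Ehat t x"
    then obtain Ehat where Ehat: "Ehat \<in> pred_product M \<Phi> S ` Lambda_seq M \<Phi> S"
      and le: "\<forall>t. \<forall>x\<in>space (hist_space M t). E t x \<le> Ehat t x" by (rule bexE)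
    from Ehat obtain l where l: "Ehat = pred_product M \<Phi> S l" "l \<in> Lambda_seq M \<Phi> S" by (rule imageE)
    show "e_process M (cond_hyp M \<Phi> S) E"
      by (rule pred_product_e_process[OF l(2) assms(5) bspec[OF spec[OF le[unfolded l(1)]]]])
  qed
qed

end
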